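(* Let $p\in[1,\infty)$ and $q\in[1,\infty]$. Let $\{A_i\}_{i=1}^\infty$ be an action convergent sequence of $P$-operators (where $A_i$ acts on the probability space $\Omega_i$) such that $\sup_{i\in\mathbb{N}}\|A_i\|_{p\to q}<\infty$. Then there is a $P$-operator $A$ (on some probability space $\Omega$) such that $\lim_{i\to\infty} d_M(A_i,A)=0$ and $\|A\|_{p\to q}\leq \sup_{i\in\mathbb{N}}\|A_i\|_{p\to q}$.
   Context: For a probability space $(\Omega,\mathcal{A},\mu)$, a $P$-operator on $\Omega$ is a linear map $A:L^\infty(\Omega)\to L^1(\Omega)$, written $v\mapsto vA$, with $\|A\|_{\infty\to1}:=\sup_{v\in L^\infty(\Omega)}\|vA\|_1/\|v\|_\infty<\infty$. For $p,q\in[1,\infty]$ let $\|A\|_{p\to q}:=\sup_{v\in L^\infty(\Omega)}\|vA\|_q/\|v\|_p$. For measurable $v_1,\dots,v_m$ on $\Omega$, $\mathcal{D}(v_1,\dots,v_m)$ denotes their joint distribution, a Borel probability measure on $\mathbb{R}^m$. The $k$-profile $\mathcal{S}_k(A)$ is the set of all measures $\mathcal{D}(v_1,\dots,v_k,v_1A,\dots,v_kA)$ on $\mathbb{R}^{2k}$ where $v_1,\dots,v_k$ range over measurable functions $\Omega\to[-1,1]$. The Lévy–Prokhorov distance of Borel probability measures $\eta_1,\eta_2$ on $\mathbb{R}^m$ is $d_{\rm LP}(\eta_1,\eta_2)=\inf\{\varepsilon>0:\eta_1(U)\le\eta_2(U^\varepsilon)+\varepsilon,\ \eta_2(U)\le\eta_1(U^\varepsilon)+\varepsilon\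 \text{for all Borel }U\}$, where $U^\varepsilon$ is the set of points at distance less than $\varepsilon$ from $U$. For sets $X,Y$ of such measures, $d_H(X,Y)=\max\{\sup_{x\in X}\inf_{y\in Y}d_{\rm LP}(x,y),\sup_{y\in Y}\inf_{x\in X}d_{\rm LP}(x,y)\}$. For $P$-operators $A,B$ (possibly on different probability spaces) $d_M(A,B):=\sum_{k=1}^\infty 2^{-k}d_H(\mathcal{S}_k(A),\mathcal{S}_k(B))$. A sequence $\{A_i\}$ of $P$-operators is action convergent if for every $k\in\mathbb{N}$ the sequence $\{\mathcal{S}_k(A_i)\}_i$ is Cauchy with respect to $d_H$. *)

theory Defs
  imports "HOL-Probability.Probability"
begin

definition Linf :: "'a measure \<Rightarrow> ('a \<Rightarrow> real) \<Rightarrow> bool" where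
  "Linf M v \<longleftrightarrow> v \<in> borel_measurable M \<and> (\<exists>C. AE x in M. \<bar>v x\<bar> \<le> C)"

definition lpnorm :: "'a measure \<Rightarrow> ennreal \<Rightarrow> ('a \<Rightarrow> real) \<Rightarrow> ennreal" where
  "lpnorm M p f =
     (if p = \<infinity> then e2ennreal (esssup M (\<lambda>x. ereal \<bar>f x\<bar>))
      else (let I = (\<integral>\<^sup>+ x. ennreal (\<bar>f x\<bar> powr enn2real p) \<partial>M)
            in if I = \<infinity> then \<infinity> else ennreal (enn2real I powr (1 / enn2real p))))"

text \<open>A P-operator on the probability space M: a linear map from L-infinity to L^1 with
  finite infinity-to-1 norm, represented by a map on functions that respects a.e. equality.\<close>
definition P_operator :: "'a measure \<Rightarrow> (('a \<Rightarrow> real) \<Rightarrow> ('a \<Rightarrow> real)) \<Rightarrow> bool" where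
  "P_operator M T \<longleftrightarrow>
     prob_space M \<and>
     (\<forall>v. Linf M v \<longrightarrow> T v \<in> borel_measurable M \<and> integrable M (T v)) \<and>
     (\<forall>v w. Linf M v \<longrightarrow> Linf M w \<longrightarrow> (AE x in M. v x = w x) \<longrightarrow> (AE x in M. T v x = T w x)) \<and>
     (\<forall>v w a b. Linf M v \<longrightarrow> Linf M w \<longrightarrow>
        (AE x in M. T (\<lambda>y. a * v y + b * w y) x = a * T v x + b * T w x)) \<and>
     (\<exists>C::real. \<forall>v. Linf M v \<longrightarrow> lpnorm M 1 (T v) \<le> ennreal C * lpnorm M \<infinity> v)"

text \<open>Operator norm p-to-q (sup over v in L-infinity of the ratio; v with zero p-norm, i.e.
  v = 0 a.e., are excluded, since then vA = 0 a.e.).\<close>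
definition opnorm :: "'a measure \<Rightarrow> (('a \<Rightarrow> real) \<Rightarrow> ('a \<Rightarrow> real)) \<Rightarrow> ennreal \<Rightarrow> ennreal \<Rightarrow> ennreal" where
  "opnorm M T p q = (SUP v \<in> {v. Linf M v \<and> lpnorm M p v \<noteq> 0}. lpnorm M q (T v) / lpnorm M p v)"

abbreviation Rm :: "nat \<Rightarrow> (nat \<Rightarrow> real) measure" where
  "Rm m \<equiv> PiM {..<m} (\<lambda>_. borel)"

definition eucl_dist :: "nat \<Rightarrow> (nat \<Rightarrow> real) \<Rightarrow> (nat \<Rightarrow> real) \<Rightarrow> real" where
  "eucl_dist m x y = sqrt (\<Sum>j<m. (x j - y j)^2)"

definition nbhd :: "nat \<Rightarrow> (nat \<Rightarrow> real) set \<Rightarrow> real \<Rightarrow> (nat \<Rightarrow> real) set" where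
  "nbhd m U e = {y \<in> space (Rm m). \<exists>x\<in>U. eucl_dist m x y < e}"

definition dLP :: "nat \<Rightarrow> (nat \<Rightarrow> real) measure \<Rightarrow> (nat \<Rightarrow> real) measure \<Rightarrow> real" where
  "dLP m \<eta>1 \<eta>2 = Inf {e. e > 0 \<and> (\<forall>U \<in> sets (Rm m).
       measure \<eta>1 U \<le> measure \<eta>2 (nbhd m U e) + e \<and>
       measure \<eta>2 U \<le> measure \<eta>1 (nbhd m U e) + e)}"

definition dH :: "nat \<Rightarrow> (nat \<Rightarrow> real) measure set \<Rightarrow> (nat \<Rightarrow> real) measure set \<Rightarrow> real" where
  "dH m X Y = max (SUP x\<in>X. INF y\<in>Y. dLP m x y) (SUP y\<in>Y. INF x\<in>X. dLP m x y)"

definition profile :: "nat \<Rightarrow> 'a measure \<Rightarrow> (('a \<Rightarrow> real) \<Rightarrow> ('a \<Rightarrow> real)) \<Rightarrow> (nat \<Rightarrow> real) measure set" where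
  "profile k M T = {distr M (Rm (2*k))
        (\<lambda>x. restrict (\<lambda>j. if j < k then v j x else T (v (j - k)) x) {..<2*k}) | v.
      \<forall>j<k. v j \<in> borel_measurable M \<and> (\<forall>x\<in>space M. \<bar>v j x\<bar> \<le> 1)}"

definition dM :: "'a measure \<Rightarrow> (('a \<Rightarrow> real) \<Rightarrow> ('a \<Rightarrow> real)) \<Rightarrow>
                  'b measure \<Rightarrow> (('b \<Rightarrow> real) \<Rightarrow> ('b \<Rightarrow> real)) \<Rightarrow> real" where
  "dM M A N B = (\<Sum>k. (1/2) ^ Suc k * dH (2 * Suc k) (profile (Suc k) M A) (profile (Suc k) N B))"

definition action_convergent :: "(nat \<Rightarrow> 'a measure) \<Rightarrow> (nat \<Rightarrow> ('a \<Rightarrow> real) \<Rightarrow> ('a \<Rightarrow> real)) \<Rightarrow> bool" where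
  "action_convergent M A \<longleftrightarrow>
     (\<forall>k\<ge>1. \<forall>e>0. \<exists>N. \<forall>i\<ge>N. \<forall>j\<ge>N. dH (2*k) (profile k (M i) (A i)) (profile k (M j) (A j)) < e)"

end

theory Submission
  imports Defs
begin

text \<open>
  The limit space is built from countably many bits. On each \<open>\<Omega>\<^sub>i\<close> a sequence of events is chosen
  such that it contains the level sets \<open>[g < t]\<close>, \<open>t\<close> rational, of countably many functions that are
  dense in all profiles, and the level sets \<open>[1\<^sub>w A\<^sub>i < t]\<close> for the indicator \<open>1\<^sub>w\<close> of each event \<open>w\<close>
  prescribing finitely many earlier bits. Along a subsequence all finite-dimensional distributions
  of the bits converge, and the limit distribution is realised by intervals in \<open>[0,1)\<close>. Bits of
  \<open>[1\<^sub>w A\<^sub>i < t]\<close> determine a limit function \<open>h'\<^sub>w\<close>, and \<open>1\<^sub>w \<mapsto> h'\<^sub>w\<close> extends linearly. Joint distributions of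
  the \<open>(1\<^sub>w, 1\<^sub>w A\<^sub>i)\<close> converge to those of the \<open>(1\<^sub>w, h'\<^sub>w)\<close>, so Fatou's lemma on a Skorohod coupling shows
  that the extension does not increase the \<open>p \<rightarrow> q\<close> norm; since \<open>p < \<infinity>\<close> it extends from bit-measurable
  simple functions to all of \<open>L\<^sup>\<infinity>\<close>. Tightness makes finitely many functions suffice for each
  profile and accuracy, which gives convergence of the profiles in both directions.
\<close>

section \<open>The Levy--Prokhorov and Hausdorff distances\<close>

text \<open>Why bits: an event in finitely many bits has a probability in \<open>[0,1]\<close>, so
  compactness is that of a countable product of intervals, and its limit has no boundary effect,
  whereas the level set of a convergent real function may gain or lose mass at the threshold. Escape
  of values to infinity is excluded by Markov's inequality with one constant for all spaces. The
  obstacle is that a limit operator must map functions on the limit space to functions on the same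
  space, so the generated sigma-algebra has to contain the images of its own generators. Letting
  later bits record the images of words in earlier bits closes it up after countably many stages.
  Finiteness of \<open>p\<close> enters because word functions approximate a bounded function
  boundedly and almost everywhere, hence in p-norm, but in general not uniformly. The Cauchy
  property enters at the end, to carry convergence from the subsequence to the whole
  sequence.\<close>

lemma eucl_dist_L2: "eucl_dist m x y = L2_set (\<lambda>j. x j - y j) {..<m}"
  by (simp add: eucl_dist_def L2_set_def)

lemma eucl_dist_commute: "eucl_dist m x y = eucl_dist m y x"
  by (simp add: eucl_dist_def power2_commute)

lemma eucl_dist_triangle: "eucl_dist m x z \<le> eucl_dist m x y + eucl_dist m y z"
  unfolding eucl_dist_L2
  using L2_set_triangle_ineq[of "\<lambda>j. x j - y j" "\<lambda>j. y j - z j" "{..<m}"] by simp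

lemma eucl_dist_le_sum: "eucl_dist m x y \<le> (\<Sum>j<m. \<bar>x j - y j\<bar>)"
  unfolding eucl_dist_L2 by (rule L2_set_le_sum_abs)

lemma eucl_dist_less:
  assumes "\<And>j. j < m \<Longrightarrow> \<bar>x j - y j\<bar> \<le> d" "real m * d < e"
  shows "eucl_dist m x y < e"
proof -
  have "(\<Sum>j<m. \<bar>x j - y j\<bar>) \<le> (\<Sum>j<m. d)" using assms(1) by (intro sum_mono) auto
  then show ?thesis using eucl_dist_le_sum[of m x y] assms(2) by simp
qed

lemma eucl_dist_component: "j < m \<Longrightarrow> \<bar>x j - y j\<bar> \<le> eucl_dist m x y"
  unfolding eucl_dist_L2
  using member_le_L2_set[of "{..<m}" j "\<lambda>j. \<bar>x j - y j\<bar>"] by (simp add: L2_set_def)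

lemma measurable_eucl_dist [measurable]:
  assumes "f \<in> measurable M (Rm m)" "g \<in> measurable M (Rm m)"
  shows "(\<lambda>x. eucl_dist m (f x) (g x)) \<in> borel_measurable M"
proof -
  have "(\<lambda>x. f x j) \<in> borel_measurable M" "(\<lambda>x. g x j) \<in> borel_measurable M" if "j < m" for j
    using that measurable_compose[OF assms(1) measurable_component_singleton, of j]
      measurable_compose[OF assms(2) measurable_component_singleton, of j] by auto
  then show ?thesis unfolding eucl_dist_def by measurable
qed

text \<open>\<open>U\<close> is arbitrary, so the union of balls defining the neighbourhood may be
  uncountable. It is open, hence the union of the countably many balls with rational centre and
  radius that it contains, and each of these is measurable.\<close>

lemma sets_nbhd [measurable]: "nbhd m U e \<in> sets (Rm m)"
proof -
  define Q where "Q = (PiE {..<m} (\<lambda>_. \<rat>) :: (nat \<Rightarrow> real) set)"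
  define B where "B = (\<lambda>(z, r). {y \<in> space (Rm m). eucl_dist m z y < r})"
  define I where "I = {s \<in> Q \<times> \<rat>. B s \<subseteq> nbhd m U e}"
  have Q: "countable Q" unfolding Q_def by (intro countable_PiE) (auto simp: countable_rat)
  have Qs: "Q \<subseteq> space (Rm m)" by (auto simp: Q_def space_PiM)
  have "countable I" unfolding I_def
    by (rule countable_subset[of _ "Q \<times> \<rat>"]) (auto simp: Q countable_rat)
  have "B s \<in> sets (Rm m)" if "s \<in> I" for s
  proof -
    obtain z r where s: "s = (z, r)" by (cases s)
    have [measurable]: "(\<lambda>_. z) \<in> measurable (Rm m) (Rm m)"
      using that Qs by (intro measurable_const) (auto simp: I_def s)
    show ?thesis unfolding B_def s by simp
  qed
  then have "(\<Union>s\<in>I. B s) \<in> sets (Rm m)"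
    using \<open>countable I\<close> by (intro sets.countable_UN') auto
  moreover have "nbhd m U e = (\<Union>s\<in>I. B s)"
  proof
    show "(\<Union>s\<in>I. B s) \<subseteq> nbhd m U e" by (auto simp: I_def)
    show "nbhd m U e \<subseteq> (\<Union>s\<in>I. B s)"
    proof
      fix y assume y: "y \<in> nbhd m U e"
      then obtain x where x: "x \<in> U" "eucl_dist m x y < e" by (auto simp: nbhd_def)
      \<comment> \<open>Half the slack: \<open>y\<close> lies within \<open>s\<close> of the
        rational centre, and a point of the ball lies within \<open>s\<close> of the centre
        again.\<close>
      obtain s where s: "s \<in> \<rat>" "0 < s" "s < (e - eucl_dist m x y) / 2"
        using Rats_dense_in_real[of 0 "(e - eucl_dist m x y) / 2"] x by auto
      have "\<exists>t\<in>\<rat>. \<bar>t - y j\<bar> \<le> s / real (Suc m)" for j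
      proof -
        have "y j < y j + s / real (Suc m)" using s(2) by simp
        from Rats_dense_in_real[OF this] obtain t where "t \<in> \<rat>" "y j < t" "t < y j + s / real (Suc m)" by blast
        then show ?thesis by (intro bexI[of _ t]) auto
      qed
      then obtain t where t: "\<And>j. t j \<in> \<rat>" "\<And>j. \<bar>t j - y j\<bar> \<le> s / real (Suc m)" by metis
      define z where "z = restrict t {..<m}"
      have zQ: "z \<in> Q" using t by (auto simp: Q_def z_def)
      have zy: "eucl_dist m z y < s"
        using t s(2) by (intro eucl_dist_less[where d = "s / real (Suc m)"]) (auto simp: z_def field_simps)
      have "y' \<in> nbhd m U e" if "y' \<in> B (z, s)" for y'
      proof -
        have "eucl_dist m x y' \<le> eucl_dist m x y + eucl_dist m z y + eucl_dist m z y'"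
          using eucl_dist_triangle[of m x y' y] eucl_dist_triangle[of m y y' z] eucl_dist_commute[of m y z] by simp
        also have "\<dots> < e" using that zy s(3) by (simp add: B_def)
        finally show ?thesis using that x by (auto simp: nbhd_def B_def)
      qed
      then have "(z, s) \<in> I" using zQ s by (auto simp: I_def)
      moreover have "y \<in> B (z, s)" using zy y by (auto simp: B_def nbhd_def)
      ultimately show "y \<in> (\<Union>s\<in>I. B s)" by blast
    qed
  qed
  ultimately show ?thesis by simp
qed

definition LPset :: "nat \<Rightarrow> (nat \<Rightarrow> real) measure \<Rightarrow> (nat \<Rightarrow> real) measure \<Rightarrow> real set" where
  "LPset m \<eta>1 \<eta>2 = {e. e > 0 \<and> (\<forall>U \<in> sets (Rm m).
       measure \<eta>1 U \<le> measure \<eta>2 (nbhd m U e) + e \<and>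
       measure \<eta>2 U \<le> measure \<eta>1 (nbhd m U e) + e)}"

lemma LPsetD:
  assumes "e \<in> LPset m \<eta>1 \<eta>2"
  shows "0 < e"
    and "U \<in> sets (Rm m) \<Longrightarrow> measure \<eta>1 U \<le> measure \<eta>2 (nbhd m U e) + e"
    and "U \<in> sets (Rm m) \<Longrightarrow> measure \<eta>2 U \<le> measure \<eta>1 (nbhd m U e) + e"
  using assms by (simp_all add: LPset_def)

lemma LPsetI:
  assumes "0 < e"
    and "\<And>U. U \<in> sets (Rm m) \<Longrightarrow> measure \<eta>1 U \<le> measure \<eta>2 (nbhd m U e) + e"
    and "\<And>U. U \<in> sets (Rm m) \<Longrightarrow> measure \<eta>2 U \<le> measure \<eta>1 (nbhd m U e) + e"
  shows "e \<in> LPset m \<eta>1 \<eta>2"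
  using assms by (simp add: LPset_def)

lemma dLP_Inf: "dLP m \<eta>1 \<eta>2 = Inf (LPset m \<eta>1 \<eta>2)"
  by (simp add: dLP_def LPset_def)

lemma bdd_below_LPset: "bdd_below (LPset m \<eta>1 \<eta>2)"
  by (rule bdd_belowI[of _ 0]) (auto dest: LPsetD(1))

lemma dLP_le: "e \<in> LPset m \<eta>1 \<eta>2 \<Longrightarrow> dLP m \<eta>1 \<eta>2 \<le> e"
  unfolding dLP_Inf by (rule cInf_lower[OF _ bdd_below_LPset])

text \<open>The infimum of an empty set of reals is arbitrary; this witness makes \<open>dLP\<close>
  meaningful and bounds it by 1.\<close>

lemma one_in_LPset:
  assumes "prob_space \<eta>1" "prob_space \<eta>2"
  shows "1 \<in> LPset m \<eta>1 \<eta>2"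
proof -
  have "measure \<eta>1 U \<le> measure \<eta>2 V + 1" "measure \<eta>2 U \<le> measure \<eta>1 V + 1" for U V
    using prob_space.prob_le_1[OF assms(1), of U] prob_space.prob_le_1[OF assms(2), of U]
      measure_nonneg[of \<eta>1 V] measure_nonneg[of \<eta>2 V] by linarith+
  then show ?thesis by (intro LPsetI) auto
qed

lemma dLP_nonneg:
  assumes "prob_space \<eta>1" "prob_space \<eta>2"
  shows "0 \<le> dLP m \<eta>1 \<eta>2"
proof -
  have "LPset m \<eta>1 \<eta>2 \<noteq> {}" using one_in_LPset[OF assms] by blast
  then show ?thesis
    unfolding dLP_Inf by (rule cInf_greatest) (auto dest: LPsetD(1))
qed

lemma dLP_le_1:
  assumes "prob_space \<eta>1" "prob_space \<eta>2"
  shows "dLP m \<eta>1 \<eta>2 \<le> 1"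
  using dLP_le[OF one_in_LPset[OF assms]] .

lemma dLP_less_LPset:
  assumes "prob_space \<eta>1" "prob_space \<eta>2" "dLP m \<eta>1 \<eta>2 < e"
  obtains e' where "e' \<in> LPset m \<eta>1 \<eta>2" "e' < e"
  using cInf_lessD[of "LPset m \<eta>1 \<eta>2" e] one_in_LPset[OF assms(1,2)] assms(3)
  unfolding dLP_Inf by blast

text \<open>Admissible radii add up because a neighbourhood of a neighbourhood lies in the
  neighbourhood of the summed radius. The infima need not be attained, hence the near-optimal
  \<open>a\<close> and \<open>b\<close>.\<close>

lemma dLP_triangle:
  assumes p: "prob_space \<eta>1" "prob_space \<eta>2" "prob_space \<eta>3"
    and s: "sets \<eta>1 = sets (Rm m)" "sets \<eta>2 = sets (Rm m)" "sets \<eta>3 = sets (Rm m)"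
  shows "dLP m \<eta>1 \<eta>3 \<le> dLP m \<eta>1 \<eta>2 + dLP m \<eta>2 \<eta>3"
proof (rule field_le_epsilon)
  fix e :: real assume e: "0 < e"
  obtain a where a: "a \<in> LPset m \<eta>1 \<eta>2" "a < dLP m \<eta>1 \<eta>2 + e / 2"
    using dLP_less_LPset[OF p(1,2), of m "dLP m \<eta>1 \<eta>2 + e / 2"] e by auto
  obtain b where b: "b \<in> LPset m \<eta>2 \<eta>3" "b < dLP m \<eta>2 \<eta>3 + e / 2"
    using dLP_less_LPset[OF p(2,3), of m "dLP m \<eta>2 \<eta>3 + e / 2"] e by auto
  have nb: "nbhd m (nbhd m U s) t \<subseteq> nbhd m U (s + t)" for U s t
  proof
    fix y assume "y \<in> nbhd m (nbhd m U s) t"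
    then obtain z x where "y \<in> space (Rm m)" "x \<in> U" "eucl_dist m x z < s" "eucl_dist m z y < t"
      by (auto simp: nbhd_def)
    then show "y \<in> nbhd m U (s + t)"
      using eucl_dist_triangle[of m x y z] by (auto simp: nbhd_def intro!: bexI[of _ x])
  qed
  interpret E1: prob_space \<eta>1 by fact
  interpret E2: prob_space \<eta>2 by fact
  interpret E3: prob_space \<eta>3 by fact
  have "a + b \<in> LPset m \<eta>1 \<eta>3"
  proof (rule LPsetI)
    show "0 < a + b" using LPsetD(1)[OF a(1)] LPsetD(1)[OF b(1)] by simp
    fix U assume U: "U \<in> sets (Rm m)"
    have "measure \<eta>1 U \<le> measure \<eta>2 (nbhd m U a) + a" using LPsetD(2)[OF a(1) U] .
    also have "measure \<eta>2 (nbhd m U a) \<le> measure \<eta>3 (nbhd m (nbhd m U a) b) + b"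
      using LPsetD(2)[OF b(1) sets_nbhd] .
    also have "measure \<eta>3 (nbhd m (nbhd m U a) b) \<le> measure \<eta>3 (nbhd m U (a + b))"
      by (intro E3.finite_measure_mono nb) (simp add: s sets_nbhd)
    finally show "measure \<eta>1 U \<le> measure \<eta>3 (nbhd m U (a + b)) + (a + b)" by simp
    have "measure \<eta>3 U \<le> measure \<eta>2 (nbhd m U b) + b" using LPsetD(3)[OF b(1) U] .
    also have "measure \<eta>2 (nbhd m U b) \<le> measure \<eta>1 (nbhd m (nbhd m U b) a) + a"
      using LPsetD(3)[OF a(1) sets_nbhd] .
    also have "measure \<eta>1 (nbhd m (nbhd m U b) a) \<le> measure \<eta>1 (nbhd m U (a + b))"
      using nb[of U b a] by (intro E1.finite_measure_mono) (simp_all add: s sets_nbhd add.commute)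
    finally show "measure \<eta>3 U \<le> measure \<eta>1 (nbhd m U (a + b)) + (a + b)" by simp
  qed
  from dLP_le[OF this] a b show "dLP m \<eta>1 \<eta>3 \<le> dLP m \<eta>1 \<eta>2 + dLP m \<eta>2 \<eta>3 + e" by simp
qed

section \<open>Comparing distributions by finite labels and by couplings\<close>

lemma measure_label_sum:
  assumes "prob_space M" "finite C" "S \<subseteq> C"
    and "\<And>u. u \<in> C \<Longrightarrow> {x \<in> space M. c x = u} \<in> sets M"
  shows "measure M {x \<in> space M. c x \<in> S} = (\<Sum>u\<in>S. measure M {x \<in> space M. c x = u})"
    and "{x \<in> space M. c x \<in> S} \<in> sets M"
proof -
  interpret prob_space M by fact
  have eq: "{x \<in> space M. c x \<in> S} = (\<Union>u\<in>S. {x \<in> space M. c x = u})" by auto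
  have f: "finite S" using assms finite_subset by blast
  show "measure M {x \<in> space M. c x \<in> S} = (\<Sum>u\<in>S. measure M {x \<in> space M. c x = u})"
    unfolding eq using assms f
    by (intro finite_measure_finite_Union) (auto simp: disjoint_family_on_def)
  show "{x \<in> space M. c x \<in> S} \<in> sets M"
    unfolding eq using assms f by (intro sets.finite_UN) auto
qed

text \<open>The labels \<open>c\<close> and \<open>d\<close> replace a coupling of the two spaces.
  \<open>S\<close> collects the labels of the points of \<open>X\<close> that \<open>f\<close> sends
  into \<open>U\<close>; its mass changes by at most \<open>b\<close> between the spaces, and
  \<open>g\<close> sends a point of \<open>Y\<close> with label in \<open>S\<close> to within
  \<open>e\<close> of \<open>U\<close>. Each of the two exceptional sets costs another
  \<open>a\<close>.\<close>

lemma LP_one_sided_labels: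
  assumes M: "prob_space M" and N: "prob_space N"
    and f: "f \<in> measurable M (Rm m)" and g: "g \<in> measurable N (Rm m)"
    and C: "finite C" "\<And>x. x \<in> space M \<Longrightarrow> c x \<in> C"
    and cM: "\<And>u. u \<in> C \<Longrightarrow> {x \<in> space M. c x = u} \<in> sets M"
    and dM: "\<And>u. u \<in> C \<Longrightarrow> {x \<in> space N. d x = u} \<in> sets N"
    and X: "X \<in> sets M" "1 - a \<le> measure M X" and Y: "Y \<in> sets N" "1 - a \<le> measure N Y"
    and close: "\<And>x y. x \<in> X \<Longrightarrow> y \<in> Y \<Longrightarrow> c x = d y \<Longrightarrow> eucl_dist m (f x) (g y) < e"
    and b: "(\<Sum>u\<in>C. \<bar>measure M {x \<in> space M. c x = u} - measure N {x \<in> space N. d x = u}\<bar>) \<le> b"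
    and e: "2 * a + b \<le> e" and U: "U \<in> sets (Rm m)"
  shows "measure (distr M (Rm m) f) U \<le> measure (distr N (Rm m) g) (nbhd m U e) + e"
proof -
  interpret M: prob_space M by fact
  interpret N: prob_space N by fact
  define S where "S = c ` (f -` U \<inter> X)"
  have XM: "X \<subseteq> space M" and YN: "Y \<subseteq> space N" using X Y sets.sets_into_space by auto
  have SC: "S \<subseteq> C" using C XM by (auto simp: S_def)
  note MS = measure_label_sum[OF M C(1) SC, of c, OF cM]
  note NS = measure_label_sum[OF N C(1) SC, of d, OF dM]
  have fU: "f -` U \<inter> space M \<in> sets M" using f U by (rule measurable_sets)
  have gU: "g -` nbhd m U e \<inter> space N \<in> sets N" using g sets_nbhd by (rule measurable_sets)
  have "measure (distr M (Rm m) f) U = measure M (f -` U \<inter> space M)"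
    using f U by (rule measure_distr)
  also have "\<dots> \<le> measure M ({x \<in> space M. c x \<in> S} \<union> (space M - X))"
    using MS X by (intro M.finite_measure_mono) (auto simp: S_def)
  also have "\<dots> \<le> measure M {x \<in> space M. c x \<in> S} + measure M (space M - X)"
    using MS X by (intro measure_Un_le) auto
  also have "measure M (space M - X) \<le> a" using X by (simp add: M.prob_compl)
  also have "measure M {x \<in> space M. c x \<in> S} \<le> measure N {x \<in> space N. d x \<in> S} + b"
  proof -
    have "measure M {x \<in> space M. c x \<in> S} - measure N {x \<in> space N. d x \<in> S}
      = (\<Sum>u\<in>S. measure M {x \<in> space M. c x = u} - measure N {x \<in> space N. d x = u})"
      using MS NS by (simp add: sum_subtractf)
    also have "\<dots> \<le> (\<Sum>u\<in>S. \<bar>measure M {x \<in> space M. c x = u} - measure N {x \<in> space N. d x = u}\<bar>)"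
      by (intro sum_mono) auto
    also have "\<dots> \<le> (\<Sum>u\<in>C. \<bar>measure M {x \<in> space M. c x = u} - measure N {x \<in> space N. d x = u}\<bar>)"
      using SC C by (intro sum_mono2) auto
    finally show ?thesis using b by simp
  qed
  also have "measure N {x \<in> space N. d x \<in> S} \<le> measure N ((g -` nbhd m U e \<inter> space N) \<union> (space N - Y))"
  proof (intro N.finite_measure_mono)
    show "{x \<in> space N. d x \<in> S} \<subseteq> (g -` nbhd m U e \<inter> space N) \<union> (space N - Y)"
    proof
      fix y assume y: "y \<in> {x \<in> space N. d x \<in> S}"
      then obtain x where x: "x \<in> X" "f x \<in> U" "c x = d y" by (auto simp: S_def)
      then show "y \<in> (g -` nbhd m U e \<inter> space N) \<union> (space N - Y)"
        using close[of x y] y measurable_space[OF g, of y] by (auto simp: nbhd_def)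
    qed
  qed (use gU Y in auto)
  also have "\<dots> \<le> measure N (g -` nbhd m U e \<inter> space N) + measure N (space N - Y)"
    using gU Y by (intro measure_Un_le) auto
  also have "measure N (space N - Y) \<le> a" using Y by (simp add: N.prob_compl)
  also have "measure N (g -` nbhd m U e \<inter> space N) = measure (distr N (Rm m) g) (nbhd m U e)"
    using g sets_nbhd by (rule measure_distr[symmetric])
  finally show ?thesis using e by simp
qed

text \<open>Applied with bit words as labels for convergence to the limit space, and with the cells
  of a grid as labels for total boundedness.\<close>

lemma dLP_le_labels:
  assumes M: "prob_space M" and N: "prob_space N"
    and f: "f \<in> measurable M (Rm m)" and g: "g \<in> measurable N (Rm m)"
    and C: "finite C" "\<And>x. x \<in> space M \<Longrightarrow> c x \<in> C" "\<And>y. y \<in> space N \<Longrightarrow> d y \<in> C"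
    and cM: "\<And>u. u \<in> C \<Longrightarrow> {x \<in> space M. c x = u} \<in> sets M"
    and dM: "\<And>u. u \<in> C \<Longrightarrow> {x \<in> space N. d x = u} \<in> sets N"
    and X: "X \<in> sets M" "1 - a \<le> measure M X" and Y: "Y \<in> sets N" "1 - a \<le> measure N Y"
    and close: "\<And>x y. x \<in> X \<Longrightarrow> y \<in> Y \<Longrightarrow> c x = d y \<Longrightarrow> eucl_dist m (f x) (g y) < e"
    and b: "(\<Sum>u\<in>C. \<bar>measure M {x \<in> space M. c x = u} - measure N {x \<in> space N. d x = u}\<bar>) \<le> b"
    and e: "2 * a + b \<le> e" "0 < e"
  shows "dLP m (distr M (Rm m) f) (distr N (Rm m) g) \<le> e"
proof (rule dLP_le)
  have "measure (distr M (Rm m) f) U \<le> measure (distr N (Rm m) g) (nbhd m U e) + e"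
    if "U \<in> sets (Rm m)" for U
    using LP_one_sided_labels[OF M N f g C(1,2) cM dM X Y close b e(1) that] by blast
  moreover have "measure (distr N (Rm m) g) U \<le> measure (distr M (Rm m) f) (nbhd m U e) + e"
    if "U \<in> sets (Rm m)" for U
  proof (rule LP_one_sided_labels[OF N M g f C(1,3) dM cM Y X _ _ e(1) that])
    show "eucl_dist m (g y) (f x) < e" if "y \<in> Y" "x \<in> X" "d y = c x" for x y
      using close[of x y] that eucl_dist_commute[of m "g y"] by simp
    show "(\<Sum>u\<in>C. \<bar>measure N {x \<in> space N. d x = u} - measure M {x \<in> space M. c x = u}\<bar>) \<le> b"
      using b by (simp add: abs_minus_commute)
  qed
  ultimately show "e \<in> LPset m (distr M (Rm m) f) (distr N (Rm m) g)"
    using e(2) by (intro LPsetI)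
qed

lemma LP_one_sided_coupling:
  assumes M: "prob_space M"
    and f: "f \<in> measurable M (Rm m)" and g: "g \<in> measurable M (Rm m)"
    and e: "measure M {x \<in> space M. e \<le> eucl_dist m (f x) (g x)} \<le> e" and U: "U \<in> sets (Rm m)"
  shows "measure (distr M (Rm m) f) U \<le> measure (distr M (Rm m) g) (nbhd m U e) + e"
proof -
  interpret M: prob_space M by fact
  note [measurable] = f g
  have gU: "g -` nbhd m U e \<inter> space M \<in> sets M" using g sets_nbhd by (rule measurable_sets)
  have "measure (distr M (Rm m) f) U = measure M (f -` U \<inter> space M)"
    using f U by (rule measure_distr)
  also have "\<dots> \<le> measure M ((g -` nbhd m U e \<inter> space M) \<union> {x \<in> space M. e \<le> eucl_dist m (f x) (g x)})"
    using measurable_space[OF g] gU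
    by (intro M.finite_measure_mono) (auto simp: nbhd_def not_le)
  also have "\<dots> \<le> measure M (g -` nbhd m U e \<inter> space M)
      + measure M {x \<in> space M. e \<le> eucl_dist m (f x) (g x)}"
    using gU by (intro measure_Un_le) auto
  also have "measure M (g -` nbhd m U e \<inter> space M) = measure (distr M (Rm m) g) (nbhd m U e)"
    using g sets_nbhd by (rule measure_distr[symmetric])
  finally show ?thesis using e by simp
qed

lemma dLP_le_coupling:
  assumes M: "prob_space M"
    and f: "f \<in> measurable M (Rm m)" and g: "g \<in> measurable M (Rm m)"
    and e: "measure M {x \<in> space M. e \<le> eucl_dist m (f x) (g x)} \<le> e" "0 < e"
  shows "dLP m (distr M (Rm m) f) (distr M (Rm m) g) \<le> e"
proof (rule dLP_le)
  have "measure M {x \<in> space M. e \<le> eucl_dist m (g x) (f x)} \<le> e"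
    using e(1) by (subst eucl_dist_commute)
  from LP_one_sided_coupling[OF M g f this] LP_one_sided_coupling[OF M f g e(1)]
  show "e \<in> LPset m (distr M (Rm m) f) (distr M (Rm m) g)"
    using e(2) by (intro LPsetI)
qed

text \<open>Real suprema and infima are meaningful only for bounded nonempty families. The bounds 0
  and 1 on \<open>dLP\<close> provide this for all of them at once, after which the Hausdorff
  distance can be used in its epsilon form.\<close>

lemma dH_props:
  assumes X: "X \<noteq> {}" "\<And>x. x \<in> X \<Longrightarrow> prob_space x"
    and Y: "Y \<noteq> {}" "\<And>y. y \<in> Y \<Longrightarrow> prob_space y"
  shows dH_nonneg: "0 \<le> dH m X Y" and dH_le_1: "dH m X Y \<le> 1"
    and dH_leI: "\<And>e. (\<And>x. x \<in> X \<Longrightarrow> \<exists>y\<in>Y. dLP m x y \<le> e) \<Longrightarrow> (\<And>y. y \<in> Y \<Longrightarrow> \<exists>x\<in>X. dLP m x y \<le> e)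
      \<Longrightarrow> dH m X Y \<le> e"
    and dH_less1: "\<And>x e. x \<in> X \<Longrightarrow> dH m X Y < e \<Longrightarrow> \<exists>y\<in>Y. dLP m x y < e"
    and dH_less2: "\<And>y e. y \<in> Y \<Longrightarrow> dH m X Y < e \<Longrightarrow> \<exists>x\<in>X. dLP m x y < e"
proof -
  have b1: "bdd_below ((\<lambda>y. dLP m x y) ` Y)" if "x \<in> X" for x
    using dLP_nonneg X(2)[OF that] Y(2) by (intro bdd_belowI2[of _ 0]) auto
  have b2: "bdd_below ((\<lambda>x. dLP m x y) ` X)" if "y \<in> Y" for y
    using dLP_nonneg Y(2)[OF that] X(2) by (intro bdd_belowI2[of _ 0]) auto
  have n1: "0 \<le> (INF y\<in>Y. dLP m x y)" if "x \<in> X" for x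
    using that X Y dLP_nonneg by (intro cINF_greatest) auto
  have n2: "0 \<le> (INF x\<in>X. dLP m x y)" if "y \<in> Y" for y
    using that X Y dLP_nonneg by (intro cINF_greatest) auto
  have l1: "(INF y\<in>Y. dLP m x y) \<le> e" if "x \<in> X" "\<exists>y\<in>Y. dLP m x y \<le> e" for x e
    using that cINF_lower2[OF b1] by blast
  have l2: "(INF x\<in>X. dLP m x y) \<le> e" if "y \<in> Y" "\<exists>x\<in>X. dLP m x y \<le> e" for y e
    using that cINF_lower2[OF b2] by blast
  have d1: "\<exists>y\<in>Y. dLP m x y \<le> 1" if "x \<in> X" for x
  proof -
    obtain y where "y \<in> Y" using Y by blast
    then show ?thesis using dLP_le_1[OF X(2)[OF that] Y(2)] by blast
  qed
  have d2: "\<exists>x\<in>X. dLP m x y \<le> 1" if "y \<in> Y" for y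
  proof -
    obtain x where "x \<in> X" using X by blast
    then show ?thesis using dLP_le_1[OF X(2) Y(2)[OF that]] by blast
  qed
  have u1: "bdd_above ((\<lambda>x. INF y\<in>Y. dLP m x y) ` X)"
    using l1 d1 by (intro bdd_aboveI2[of _ _ 1]) auto
  have u2: "bdd_above ((\<lambda>y. INF x\<in>X. dLP m x y) ` Y)"
    using l2 d2 by (intro bdd_aboveI2[of _ _ 1]) auto
  show le: "dH m X Y \<le> e" if "\<And>x. x \<in> X \<Longrightarrow> \<exists>y\<in>Y. dLP m x y \<le> e"
    "\<And>y. y \<in> Y \<Longrightarrow> \<exists>x\<in>X. dLP m x y \<le> e" for e
    unfolding dH_def using X Y l1 l2 that
    by (intro max.boundedI cSUP_least) auto
  show "dH m X Y \<le> 1" using le d1 d2 by blast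
  obtain x where x: "x \<in> X" using X by blast
  have "0 \<le> (SUP x\<in>X. INF y\<in>Y. dLP m x y)" using cSUP_upper2[OF u1 x n1[OF x]] .
  then show "0 \<le> dH m X Y" by (simp add: dH_def)
  show "\<exists>y\<in>Y. dLP m x y < e" if "x \<in> X" "dH m X Y < e" for x e
  proof -
    have "(INF y\<in>Y. dLP m x y) \<le> dH m X Y"
      unfolding dH_def using cSUP_upper[OF that(1) u1] by auto
    then show ?thesis using that cINF_less_iff[OF Y(1) b1[OF that(1)], of e] by linarith
  qed
  show "\<exists>x\<in>X. dLP m x y < e" if "y \<in> Y" "dH m X Y < e" for y e
  proof -
    have "(INF x\<in>X. dLP m x y) \<le> dH m X Y"
      unfolding dH_def using cSUP_upper[OF that(1) u2] by auto
    then show ?thesis using that cINF_less_iff[OF X(1) b2[OF that(1)], of e] by linarith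
  qed
qed

section \<open>Semicontinuity of norms\<close>

text \<open>Norms enter the argument mainly through comparison with finite constants; in this form
  the root and the case of an infinite integral disappear.\<close>

lemma lpnorm_le_iff:
  assumes "1 \<le> r" "0 \<le> c"
  shows "lpnorm M (ennreal r) f \<le> ennreal c \<longleftrightarrow> (\<integral>\<^sup>+x. ennreal (\<bar>f x\<bar> powr r) \<partial>M) \<le> ennreal (c powr r)"
proof -
  define I where "I = (\<integral>\<^sup>+x. ennreal (\<bar>f x\<bar> powr r) \<partial>M)"
  have eq: "lpnorm M (ennreal r) f = (if I = \<infinity> then \<infinity> else ennreal (enn2real I powr (1 / r)))"
    using assms by (simp add: lpnorm_def I_def Let_def)
  show ?thesis
  proof (cases I)
    case top
    then show ?thesis by (simp add: eq top_unique flip: I_def)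
  next
    case (real t)
    have "t powr (1 / r) \<le> c \<longleftrightarrow> t \<le> c powr r"
    proof
      assume "t powr (1 / r) \<le> c"
      then have "(t powr (1 / r)) powr r \<le> c powr r" using assms by (intro powr_mono2) auto
      then show "t \<le> c powr r" using assms real by (simp add: powr_powr)
    next
      assume "t \<le> c powr r"
      then have "t powr (1 / r) \<le> (c powr r) powr (1 / r)" using assms real by (intro powr_mono2) auto
      then show "t powr (1 / r) \<le> c" using assms by (simp add: powr_powr)
    qed
    then show ?thesis using real assms by (simp add: eq flip: I_def)
  qed
qed

lemma lpnorm_infinity_le_iff:
  assumes "0 \<le> c" "f \<in> borel_measurable M"
  shows "lpnorm M \<top> f \<le> ennreal c \<longleftrightarrow> (AE x in M. \<bar>f x\<bar> \<le> c)"
proof -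
  let ?e = "esssup M (\<lambda>x. ereal \<bar>f x\<bar>)"
  have "lpnorm M \<top> f \<le> ennreal c \<longleftrightarrow> e2ennreal ?e \<le> e2ennreal (ereal c)"
    by (simp add: lpnorm_def ennreal.abs_eq e2ennreal_def)
  also have "\<dots> \<longleftrightarrow> ?e \<le> ereal c"
  proof
    assume a: "e2ennreal ?e \<le> e2ennreal (ereal c)"
    show "?e \<le> ereal c"
    \<comment> \<open>\<open>e2ennreal\<close> truncates at 0, so it reflects the order only for
      nonnegative values; a negative \<open>?e\<close> lies below \<open>c\<close> anyway.\<close>
    proof (cases "0 \<le> ?e")
      case True
      then show ?thesis using a assms(1) by (simp add: less_eq_ennreal.rep_eq enn2ereal_e2ennreal)
    next
      case False
      then show ?thesis using assms(1) by (metis ereal_less_eq(5) linear order_trans)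
    qed
  qed (rule e2ennreal_mono)
  also have "\<dots> \<longleftrightarrow> (AE x in M. ereal \<bar>f x\<bar> \<le> ereal c)"
  proof
    assume a: "?e \<le> ereal c"
    show "AE x in M. ereal \<bar>f x\<bar> \<le> ereal c"
      using esssup_AE[where f = "\<lambda>x. ereal \<bar>f x\<bar>" and M = M]
    proof eventually_elim
      case (elim x)
      from order_trans[OF elim a] show ?case .
    qed
  next
    assume "AE x in M. ereal \<bar>f x\<bar> \<le> ereal c"
    then show "?e \<le> ereal c" using assms by (intro esssup_I) auto
  qed
  finally show ?thesis by simp
qed

lemma ennreal_ge_1_cases:
  fixes q :: ennreal
  assumes "1 \<le> q"
  obtains "q = \<infinity>" | r where "q = ennreal r" "1 \<le> r"
  using assms by (cases q) (auto simp flip: ennreal_1)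

lemma lpnorm_le_cong_AE:
  assumes "1 \<le> q" "0 \<le> c" "f \<in> borel_measurable M" "g \<in> borel_measurable M" "AE x in M. f x = g x"
    and "lpnorm M q f \<le> ennreal c"
  shows "lpnorm M q g \<le> ennreal c"
  using assms(1)
proof (cases rule: ennreal_ge_1_cases)
  case 1
  have "AE x in M. \<bar>f x\<bar> \<le> c" using assms 1 by (simp add: lpnorm_infinity_le_iff)
  then have "AE x in M. \<bar>g x\<bar> \<le> c" using assms(5) by eventually_elim auto
  then show ?thesis using assms 1 by (simp add: lpnorm_infinity_le_iff)
next
  case (2 r)
  have "(\<integral>\<^sup>+x. ennreal (\<bar>g x\<bar> powr r) \<partial>M) = (\<integral>\<^sup>+x. ennreal (\<bar>f x\<bar> powr r) \<partial>M)"
    using assms(5) by (intro nn_integral_cong_AE) auto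
  then show ?thesis using assms 2 by (simp add: lpnorm_le_iff)
qed

text \<open>The norm depends only on the distribution, which allows moving \<open>f\<close> to the
  space of a Skorohod representation.\<close>

lemma lpnorm_distr_le_iff:
  assumes "1 \<le> q" "0 \<le> c" "f \<in> borel_measurable M"
  shows "lpnorm (distr M borel f) q (\<lambda>x. x) \<le> ennreal c \<longleftrightarrow> lpnorm M q f \<le> ennreal c"
  using assms(1)
proof (cases rule: ennreal_ge_1_cases)
  case 1
  then show ?thesis using assms by (simp add: lpnorm_infinity_le_iff AE_distr_iff)
next
  case (2 r)
  then show ?thesis using assms by (simp add: lpnorm_le_iff nn_integral_distr)
qed

text \<open>The bounds may vary with \<open>n\<close>: they will be \<open>K\<close> times the
  p-norms of arguments, which merely converge.\<close>

lemma lpnorm_Fatou: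
  assumes q: "1 \<le> q" and f: "\<And>n. f n \<in> borel_measurable M" "g \<in> borel_measurable M"
    and lim: "AE x in M. (\<lambda>n. f n x) \<longlonglongrightarrow> g x"
    and le: "\<And>n. lpnorm M q (f n) \<le> ennreal (c n)" "\<And>n. 0 \<le> c n" "c \<longlonglongrightarrow> d"
  shows "lpnorm M q g \<le> ennreal d"
proof -
  have d: "0 \<le> d" using le by (intro LIMSEQ_le_const[OF le(3)]) auto
  from q show ?thesis
  proof (cases rule: ennreal_ge_1_cases)
    case 1
    have "AE x in M. \<forall>n. \<bar>f n x\<bar> \<le> c n"
      using le f 1 by (simp add: AE_all_countable lpnorm_infinity_le_iff)
    with lim have "AE x in M. \<bar>g x\<bar> \<le> d"
    proof eventually_elim
      case (elim x)
      show ?case using elim by (intro LIMSEQ_le[OF tendsto_rabs[OF elim(1)] le(3)]) auto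
    qed
    then show ?thesis using d f 1 by (simp add: lpnorm_infinity_le_iff)
  next
    case (2 r)
    have "(\<integral>\<^sup>+x. ennreal (\<bar>g x\<bar> powr r) \<partial>M) = (\<integral>\<^sup>+x. liminf (\<lambda>n. ennreal (\<bar>f n x\<bar> powr r)) \<partial>M)"
    proof (rule nn_integral_cong_AE, use lim in eventually_elim)
      case (elim x)
      have *: "(\<lambda>n. ennreal (\<bar>f n x\<bar> powr r)) \<longlonglongrightarrow> ennreal (\<bar>g x\<bar> powr r)"
        using elim 2 by (intro tendsto_ennrealI tendsto_powr' tendsto_rabs tendsto_const) auto
      show ?case by (rule lim_imp_Liminf[OF sequentially_bot *, symmetric])
    qed
    also have "\<dots> \<le> liminf (\<lambda>n. \<integral>\<^sup>+x. ennreal (\<bar>f n x\<bar> powr r) \<partial>M)"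
      using f by (intro nn_integral_liminf) auto
    also have "\<dots> \<le> liminf (\<lambda>n. ennreal (c n powr r))"
      using le 2 by (intro Liminf_mono) (auto simp: lpnorm_le_iff)
    also have "\<dots> = ennreal (d powr r)"
      using le 2 by (intro lim_imp_Liminf tendsto_ennrealI tendsto_powr' tendsto_const) auto
    finally show ?thesis using 2 d by (simp add: lpnorm_le_iff)
  qed
qed

text \<open>Young's inequality for the product \<open>1 * y\<close>. The conjugate exponent is
  infinite for \<open>r = 1\<close>, so that case stands apart.\<close>

lemma one_plus_le_powr:
  fixes y :: real
  assumes "0 \<le> y" "1 \<le> r"
  shows "y \<le> 1 - 1 / r + y powr r / r"
proof (cases "r = 1")
  case False
  define s where "s = r / (r - 1)"
  have "1 * y \<le> 1 powr s / s + y powr r / r"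
    using assms False by (intro Youngs_inequality) (auto simp: s_def field_simps)
  also have "1 powr s / s = 1 - 1 / r" using assms False by (simp add: s_def field_simps)
  finally show ?thesis by simp
qed (use assms in auto)

text \<open>By integrating Young's inequality.\<close>
lemma (in prob_space) nn_integral_le_lpnorm:
  assumes q: "1 \<le> q" "0 \<le> c" and f: "f \<in> borel_measurable M" and le: "lpnorm M q f \<le> ennreal c"
  shows "(\<integral>\<^sup>+x. ennreal \<bar>f x\<bar> \<partial>M) \<le> ennreal c"
  using q(1)
proof (cases rule: ennreal_ge_1_cases)
  case 1
  have "AE x in M. \<bar>f x\<bar> \<le> c" using assms 1 by (simp add: lpnorm_infinity_le_iff)
  then have "(\<integral>\<^sup>+x. ennreal \<bar>f x\<bar> \<partial>M) \<le> (\<integral>\<^sup>+x. ennreal c \<partial>M)"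
    by (intro nn_integral_mono_AE) (auto elim: eventually_mono intro: ennreal_leI)
  then show ?thesis by (simp add: emeasure_space_1)
next
  case (2 r)
  have "(\<integral>\<^sup>+x. ennreal \<bar>f x\<bar> \<partial>M) \<le> ennreal b" if b: "c < b" for b
  proof -
    \<comment> \<open>Rescaling by some \<open>b\<close> above \<open>c\<close> allows the division
      also when \<open>c = 0\<close>.\<close>
    have b0: "0 < b" using b q by simp
    have "\<bar>f x\<bar> \<le> b * (1 - 1 / r) + (b / (r * b powr r)) * \<bar>f x\<bar> powr r" for x
      using one_plus_le_powr[of "\<bar>f x\<bar> / b" r] b0 2
      by (simp add: powr_divide field_simps)
    then have "(\<integral>\<^sup>+x. ennreal \<bar>f x\<bar> \<partial>M)
      \<le> (\<integral>\<^sup>+x. ennreal (b * (1 - 1 / r)) + ennreal (b / (r * b powr r)) * ennreal (\<bar>f x\<bar> powr r) \<partial>M)"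
      using b0 2 by (intro nn_integral_mono) (simp add: ennreal_mult'[symmetric] ennreal_plus[symmetric] del: ennreal_plus)
    also have "\<dots> = ennreal (b * (1 - 1 / r)) + ennreal (b / (r * b powr r)) * (\<integral>\<^sup>+x. ennreal (\<bar>f x\<bar> powr r) \<partial>M)"
      using f by (simp add: nn_integral_add nn_integral_cmult emeasure_space_1)
    also have "\<dots> \<le> ennreal (b * (1 - 1 / r)) + ennreal (b / (r * b powr r)) * ennreal (b powr r)"
    proof (intro add_left_mono mult_left_mono)
      have "(\<integral>\<^sup>+x. ennreal (\<bar>f x\<bar> powr r) \<partial>M) \<le> ennreal (c powr r)"
        using le q 2 by (simp add: lpnorm_le_iff)
      also have "\<dots> \<le> ennreal (b powr r)" using b q 2 by (intro ennreal_leI powr_mono2) auto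
      finally show "(\<integral>\<^sup>+x. ennreal (\<bar>f x\<bar> powr r) \<partial>M) \<le> ennreal (b powr r)" .
    qed auto
    also have "\<dots> = ennreal (b * (1 - 1 / r) + b / (r * b powr r) * b powr r)"
      using b0 2 by (simp add: ennreal_mult'[symmetric] ennreal_plus[symmetric] del: ennreal_plus)
    also have "b * (1 - 1 / r) + b / (r * b powr r) * b powr r = b"
      using b0 2 by (simp add: field_simps)
    finally show ?thesis .
  qed
  note le_b = this
  show ?thesis
  proof (rule ennreal_le_epsilon)
    fix e :: real assume "0 < e"
    then show "(\<integral>\<^sup>+x. ennreal \<bar>f x\<bar> \<partial>M) \<le> ennreal c + ennreal e"
      using le_b[of "c + e"] q(2) by simp
  qed
qed

lemma (in prob_space) lpnorm_le_const:
  assumes "1 \<le> r" "0 \<le> c" "AE x in M. \<bar>f x\<bar> \<le> c"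
  shows "lpnorm M (ennreal r) f \<le> ennreal c"
proof -
  have "AE x in M. ennreal (\<bar>f x\<bar> powr r) \<le> ennreal (c powr r)"
    using assms(3) by eventually_elim (use assms in \<open>auto intro!: ennreal_leI powr_mono2\<close>)
  then have "(\<integral>\<^sup>+x. ennreal (\<bar>f x\<bar> powr r) \<partial>M) \<le> (\<integral>\<^sup>+x. ennreal (c powr r) \<partial>M)"
    by (rule nn_integral_mono_AE)
  then show ?thesis using assms by (simp add: lpnorm_le_iff emeasure_space_1)
qed

section \<open>Convergence in distribution and lower semicontinuity of norms\<close>

definition joint :: "nat \<Rightarrow> (nat \<Rightarrow> 'a \<Rightarrow> real) \<Rightarrow> 'a \<Rightarrow> nat \<Rightarrow> real" where
  "joint m f x = restrict (\<lambda>j. f j x) {..<m}"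

lemma joint_apply [simp]: "j < m \<Longrightarrow> joint m f x j = f j x"
  by (simp add: joint_def)

lemma measurable_joint [measurable (raw)]:
  assumes "\<And>j. j < m \<Longrightarrow> f j \<in> borel_measurable M"
  shows "joint m f \<in> measurable M (Rm m)"
  unfolding joint_def[abs_def] using assms by (intro measurable_restrict) auto

lemma distr_joint_cong_AE:
  assumes "\<And>j. j < m \<Longrightarrow> f j \<in> borel_measurable M" "\<And>j. j < m \<Longrightarrow> g j \<in> borel_measurable M"
    "\<And>j. j < m \<Longrightarrow> AE x in M. f j x = g j x"
  shows "distr M (Rm m) (joint m f) = distr M (Rm m) (joint m g)"
proof (rule distr_cong_AE)
  have "AE x in M. \<forall>j\<in>{..<m}. f j x = g j x" using assms by (subst AE_finite_all) auto
  then show "AE x in M. joint m f x = joint m g x"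
    by eventually_elim (auto simp: joint_def)
qed (use assms in auto)

text \<open>Both vectors live on one space, which is a coupling. Dominated convergence, applied to
  the indicators of a large deviation, turns almost sure convergence into convergence in
  probability.\<close>

lemma (in prob_space) dLP_tendsto_AE:
  assumes f: "\<And>n j. j < m \<Longrightarrow> f n j \<in> borel_measurable M" "\<And>j. j < m \<Longrightarrow> g j \<in> borel_measurable M"
    and lim: "\<And>j. j < m \<Longrightarrow> AE x in M. (\<lambda>n. f n j x) \<longlonglongrightarrow> g j x"
    and e: "0 < e"
  shows "\<forall>\<^sub>F n in sequentially. dLP m (distr M (Rm m) (joint m (f n))) (distr M (Rm m) (joint m g)) \<le> e"
proof -
  have [measurable]: "joint m (f n) \<in> measurable M (Rm m)" for n using f by auto
  have [measurable]: "joint m g \<in> measurable M (Rm m)" using f by auto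
  let ?d = "\<lambda>n x. eucl_dist m (joint m (f n) x) (joint m g x)"
  have "(\<lambda>n. \<integral>x. indicator {x \<in> space M. e \<le> ?d n x} x \<partial>M) \<longlonglongrightarrow> (\<integral>x. (0::real) \<partial>M)"
  proof (rule integral_dominated_convergence[where w = "\<lambda>_. 1"])
    have "AE x in M. \<forall>j\<in>{..<m}. (\<lambda>n. f n j x) \<longlonglongrightarrow> g j x" using lim by (subst AE_finite_all) auto
    then show "AE x in M. (\<lambda>n. indicator {x \<in> space M. e \<le> ?d n x} x) \<longlonglongrightarrow> (0::real)"
    proof eventually_elim
      case (elim x)
      have "(\<lambda>n. \<Sum>j<m. (f n j x - g j x)\<^sup>2) \<longlonglongrightarrow> (\<Sum>j<m. (g j x - g j x)\<^sup>2)"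
        using elim by (intro tendsto_intros) auto
      then have "(\<lambda>n. sqrt (\<Sum>j<m. (f n j x - g j x)\<^sup>2)) \<longlonglongrightarrow> sqrt (\<Sum>j<m. (g j x - g j x)\<^sup>2)"
        by (rule tendsto_real_sqrt)
      then have "(\<lambda>n. ?d n x) \<longlonglongrightarrow> 0" by (simp add: eucl_dist_def)
      from order_tendstoD(2)[OF this e] show ?case
        by (intro tendsto_eventually) (auto elim!: eventually_mono)
    qed
  qed auto
  then have "(\<lambda>n. measure M {x \<in> space M. e \<le> ?d n x}) \<longlonglongrightarrow> 0" by simp
  from order_tendstoD(2)[OF this e] show ?thesis
  proof eventually_elim
    case (elim n)
    show ?case using elim e by (intro dLP_le_coupling prob_space_axioms) auto
  qed
qed

text \<open>Skorohod's theorem asks for convergence of distribution functions. A neighbourhood of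
  the half-line \<open>H t\<close> lies in a slightly larger half-line, so the distribution function
  at \<open>x\<close> is squeezed between the limiting ones at \<open>x - d\<close> and
  \<open>x + d\<close>, which are close to each other at a continuity point.\<close>

lemma weak_conv_of_dLP:
  assumes M: "\<And>n. prob_space (M n)" and N: "prob_space N"
    and f: "\<And>n. f n \<in> borel_measurable (M n)" and g: "g \<in> borel_measurable N"
    and lim: "(\<lambda>n. dLP 1 (distr (M n) (Rm 1) (joint 1 (\<lambda>_. f n))) (distr N (Rm 1) (joint 1 (\<lambda>_. g)))) \<longlonglongrightarrow> 0"
  shows "weak_conv_m (\<lambda>n. distr (M n) borel (f n)) (distr N borel g)"
  unfolding weak_conv_m_def weak_conv_def
proof (intro allI impI)
  fix x assume cont: "isCont (cdf (distr N borel g)) x"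
  let ?F = "\<lambda>t. measure N {y \<in> space N. g y \<le> t}"
  let ?Fn = "\<lambda>n t. measure (M n) {y \<in> space (M n). f n y \<le> t}"
  have F: "cdf (distr N borel g) = ?F"
    using g by (auto simp: cdf_def measure_distr fun_eq_iff intro!: arg_cong[where f = "measure N"])
  have Fn: "cdf (distr (M n) borel (f n)) = ?Fn n" for n
    using f[of n] by (auto simp: cdf_def measure_distr fun_eq_iff intro!: arg_cong[where f = "measure (M n)"])
  interpret N: prob_space N by fact
  define \<mu> where "\<mu> n = distr (M n) (Rm 1) (joint 1 (\<lambda>_. f n))" for n
  define \<nu> where "\<nu> = distr N (Rm 1) (joint 1 (\<lambda>_. g))"
  have jf: "joint 1 (\<lambda>_. f n) \<in> measurable (M n) (Rm 1)" for n using f by auto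
  have jg: "joint 1 (\<lambda>_. g) \<in> measurable N (Rm 1)" using g by auto
  have p\<mu>: "prob_space (\<mu> n)" for n unfolding \<mu>_def using jf M by (intro prob_space.prob_space_distr) auto
  have p\<nu>: "prob_space \<nu>" unfolding \<nu>_def using jg N by (intro prob_space.prob_space_distr) auto
  interpret \<nu>: prob_space \<nu> by fact
  define H where "H t = {y \<in> space (Rm 1). y 0 \<le> t}" for t :: real
  have H: "H t \<in> sets (Rm 1)" for t unfolding H_def by measurable
  have \<mu>H: "measure (\<mu> n) (H t) = ?Fn n t" for n t
    unfolding \<mu>_def using measure_distr[OF jf H] measurable_space[OF jf]
    by (auto simp: H_def intro!: arg_cong[where f = "measure (M n)"])
  have \<nu>H: "measure \<nu> (H t) = ?F t" for t
    unfolding \<nu>_def using measure_distr[OF jg H] measurable_space[OF jg]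
    by (auto simp: H_def intro!: arg_cong[where f = "measure N"])
  have nb: "nbhd 1 (H t) e \<subseteq> H (t + d)" if "e \<le> d" for t e d
  proof
    fix y assume "y \<in> nbhd 1 (H t) e"
    then obtain x where "y \<in> space (Rm 1)" "x 0 \<le> t" "eucl_dist 1 x y < e"
      by (auto simp: nbhd_def H_def)
    then show "y \<in> H (t + d)"
      using eucl_dist_component[of 0 1 x y] that unfolding H_def by auto
  qed
  have "(\<lambda>n. ?Fn n x) \<longlonglongrightarrow> ?F x"
  proof (rule LIMSEQ_I)
    fix e :: real assume e: "0 < e"
    obtain d0 where d0: "0 < d0" "\<And>t. \<bar>t - x\<bar> < d0 \<Longrightarrow> \<bar>?F t - ?F x\<bar> < e / 2"
      using cont e unfolding F continuous_at_eps_delta dist_real_def by (meson half_gt_zero)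
    \<comment> \<open>\<open>d < d0\<close> serves continuity, and \<open>d \<le> e / 2\<close>
      absorbs the additive error \<open>s < d\<close> of the Levy--Prokhorov bound.\<close>
    define d where "d = min (d0 / 2) (e / 2)"
    have d: "0 < d" "d < d0" "d \<le> e / 2" using d0 e by (auto simp: d_def)
    have "\<forall>\<^sub>F n in sequentially. dLP 1 (\<mu> n) \<nu> < d"
      using order_tendstoD(2)[OF lim d(1)] unfolding \<mu>_def \<nu>_def .
    then obtain n0 where n0: "\<And>n. n \<ge> n0 \<Longrightarrow> dLP 1 (\<mu> n) \<nu> < d" by (auto simp: eventually_sequentially)
    have "norm (?Fn n x - ?F x) < e" if n: "n \<ge> n0" for n
    proof -
      interpret \<mu>: prob_space "\<mu> n" by fact
      obtain s where s: "s \<in> LPset 1 (\<mu> n) \<nu>" "s < d" using dLP_less_LPset[OF p\<mu> p\<nu> n0[OF n]] .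
      have "measure (\<mu> n) (H x) \<le> measure \<nu> (nbhd 1 (H x) s) + s" using LPsetD(2)[OF s(1) H] .
      also have "measure \<nu> (nbhd 1 (H x) s) \<le> measure \<nu> (H (x + d))"
        using s H by (intro \<nu>.finite_measure_mono nb) (auto simp: \<nu>_def)
      finally have 1: "?Fn n x \<le> ?F (x + d) + s" by (simp only: \<mu>H \<nu>H)
      have "measure \<nu> (H (x - d)) \<le> measure (\<mu> n) (nbhd 1 (H (x - d)) s) + s" using LPsetD(3)[OF s(1) H] .
      also have "measure (\<mu> n) (nbhd 1 (H (x - d)) s) \<le> measure (\<mu> n) (H x)"
        using nb[of s d "x - d"] s H by (intro \<mu>.finite_measure_mono) (auto simp: \<mu>_def)
      finally have 2: "?F (x - d) \<le> ?Fn n x + s" by (simp only: \<mu>H \<nu>H)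
      have "\<bar>?F (x + d) - ?F x\<bar> < e / 2" "\<bar>?F (x - d) - ?F x\<bar> < e / 2" using d by (intro d0(2); simp)+
      then show ?thesis using 1 2 s(2) d(3) unfolding real_norm_def by linarith
    qed
    then show "\<exists>no. \<forall>n\<ge>no. norm (?Fn n x - ?F x) < e" by blast
  qed
  then show "(\<lambda>n. cdf (distr (M n) borel (f n)) x) \<longlonglongrightarrow> cdf (distr N borel g) x"
    by (simp add: F Fn)
qed

text \<open>The variables live on different spaces, but only their distributions matter. Norms of
  images may drop in the limit; for bounding the limit operator semicontinuity is enough.\<close>

lemma lpnorm_lsc:
  assumes M: "\<And>n. prob_space (M n)" and N: "prob_space N"
    and f: "\<And>n. f n \<in> borel_measurable (M n)" and g: "g \<in> borel_measurable N"
    and lim: "(\<lambda>n. dLP 1 (distr (M n) (Rm 1) (joint 1 (\<lambda>_. f n))) (distr N (Rm 1) (joint 1 (\<lambda>_. g)))) \<longlonglongrightarrow> 0"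
    and q: "1 \<le> q" and le: "\<And>n. lpnorm (M n) q (f n) \<le> ennreal (c n)" "\<And>n. 0 \<le> c n" "c \<longlonglongrightarrow> d"
  shows "lpnorm N q g \<le> ennreal d"
proof -
  have rM: "real_distribution (distr (M n) borel (f n))" for n
    using M f by (auto simp: real_distribution_def real_distribution_axioms_def intro!: prob_space.prob_space_distr)
  have rN: "real_distribution (distr N borel g)"
    using N g by (auto simp: real_distribution_def real_distribution_axioms_def intro!: prob_space.prob_space_distr)
  obtain \<Omega> :: "real measure" and Y :: "nat \<Rightarrow> real \<Rightarrow> real" and Z :: "real \<Rightarrow> real" where \<Omega>: "prob_space \<Omega>"
    and Y: "\<And>n. Y n \<in> borel_measurable \<Omega>" "\<And>n. distr \<Omega> borel (Y n) = distr (M n) borel (f n)"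
    and Z: "Z \<in> measurable \<Omega> lborel" "distr \<Omega> borel Z = distr N borel g"
    and YZ: "\<And>x. x \<in> space \<Omega> \<Longrightarrow> (\<lambda>n. Y n x) \<longlonglongrightarrow> Z x"
    using Skorohod[OF rM rN weak_conv_of_dLP[OF M N f g lim]] by metis
  have Zb: "Z \<in> borel_measurable \<Omega>" using Z(1) by simp
  have d: "0 \<le> d" using le by (intro LIMSEQ_le_const[OF le(3)]) auto
  have "lpnorm \<Omega> q (Y n) \<le> ennreal (c n)" for n
    using le(1)[of n] lpnorm_distr_le_iff[OF q le(2) f, of n n] lpnorm_distr_le_iff[OF q le(2) Y(1), of n n] Y(2)[of n] by simp
  then have "lpnorm \<Omega> q Z \<le> ennreal d"
    using YZ le by (intro lpnorm_Fatou[OF q Y(1) Zb _ _ le(2,3)]) auto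
  then show ?thesis
    using lpnorm_distr_le_iff[OF q d g] lpnorm_distr_le_iff[OF q d Zb] Z(2) by simp
qed

section \<open>The space of bit sequences\<close>

text \<open>Words record the newest bit first, so that a prefix of a bit sequence is a suffix of a word.\<close>

locale word_measure =
  fixes P :: "bool list \<Rightarrow> real"
  assumes P_nonneg: "0 \<le> P w"
    and P_Nil: "P [] = 1"
    and P_split: "P w = P (False # w) + P (True # w)"
begin

text \<open>The left end of the interval assigned to a word: an interval of length
  \<open>P w\<close> is cut into the part for \<open>False # w\<close> on the left and the part for
  \<open>True # w\<close> on the right.\<close>

fun lft :: "bool list \<Rightarrow> real" where
  "lft [] = 0"
| "lft (b # w) = (if b then lft w + P (False # w) else lft w)"

text \<open>The address of a point of \<open>[0,1)\<close>: the word of length \<open>n\<close>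
  whose interval contains it.\<close>

primrec wd :: "nat \<Rightarrow> real \<Rightarrow> bool list" where
  "wd 0 x = []"
| "wd (Suc n) x = (\<not> x < lft (wd n x) + P (False # wd n x)) # wd n x"

lemma length_wd [simp]: "length (wd n x) = n"
  by (induction n) auto

lemma wd_eq_iff: "0 \<le> x \<Longrightarrow> x < 1 \<Longrightarrow> wd (length w) x = w \<longleftrightarrow> lft w \<le> x \<and> x < lft w + P w"
proof (induction w)
  case Nil
  then show ?case by (simp add: P_Nil)
next
  case (Cons b w)
  have "wd (length (b # w)) x = b # w \<longleftrightarrow> wd (length w) x = w \<and> b = (\<not> x < lft w + P (False # w))"
    by auto
  then show ?case using Cons P_split[of w] P_nonneg[of "True # w"] P_nonneg[of "False # w"] by auto
qed

lemma lft_bounds: "0 \<le> lft w" "lft w + P w \<le> 1"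
proof (induction w)
  case (Cons b w)
  {
    case 1
    show ?case using Cons P_nonneg[of "False # w"] by auto
  next
    case 2
    show ?case using Cons P_split[of w] P_nonneg[of "True # w"] by auto
  }
qed (auto simp: P_Nil)

definition cyl :: "bool list \<Rightarrow> real set" where
  "cyl w = {x \<in> {0..<1}. wd (length w) x = w}"

lemma cyl_eq: "cyl w = {lft w..<lft w + P w}"
  using lft_bounds[of w] by (auto simp: cyl_def wd_eq_iff)

definition unif :: "real measure" where
  "unif = restrict_space lborel {0..<1}"

text \<open>All Borel sets would be too many: where the bits do not separate points, for instance on
  an atom of the limit law, a Borel function need not be a limit of functions of words. On the
  sigma-algebra generated by the cylinders such functions are dense in \<open>L^1\<close>, so the
  operator is determined by them.\<close>

definition bit_space :: "real measure" where
  "bit_space = restr_to_subalg unif (sigma {0..<1} (range cyl))"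

lemma space_unif: "space unif = {0..<1}"
  by (simp add: unif_def space_restrict_space)

lemma cyl_sets_unif: "cyl w \<in> sets unif"
  unfolding unif_def sets_restrict_space using lft_bounds[of w]
  by (auto simp: cyl_eq intro!: image_eqI[of _ _ "{lft w..<lft w + P w}"])

lemma subalgebra_bits: "subalgebra unif (sigma {0..<1} (range cyl))"
  unfolding subalgebra_def
proof
  have "range cyl \<subseteq> Pow {0..<1}" by (auto simp: cyl_def)
  then show "space (sigma {0..<1} (range cyl)) = space unif"
    "sets (sigma {0..<1} (range cyl)) \<subseteq> sets unif"
    using sets.sigma_sets_subset[of "range cyl" unif] cyl_sets_unif
    by (auto simp: space_unif)
qed

lemma prob_space_unif: "prob_space unif"
  by (rule prob_spaceI) (simp add: unif_def emeasure_restrict_space space_restrict_space)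

lemma prob_space_bit_space: "prob_space bit_space"
  unfolding bit_space_def by (rule prob_space_restr_to_subalg[OF subalgebra_bits prob_space_unif])

sublocale B: prob_space bit_space
  by (rule prob_space_bit_space)

lemma space_bit_space [simp]: "space bit_space = {0..<1}"
  by (simp add: bit_space_def space_restr_to_subalg space_unif)

lemma sets_bit_space: "sets bit_space = sigma_sets {0..<1} (range cyl)"
  unfolding bit_space_def sets_restr_to_subalg[OF subalgebra_bits]
  by (rule sets_measure_of) (auto simp: cyl_def)

lemma cyl_sets [measurable]: "cyl w \<in> sets bit_space"
  by (auto simp: sets_bit_space)

lemma measure_cyl: "measure bit_space (cyl w) = P w"
proof -
  have "emeasure bit_space (cyl w) = emeasure unif (cyl w)"
    unfolding bit_space_def
    using cyl_sets[of w] by (intro emeasure_restr_to_subalg[OF subalgebra_bits])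
      (simp add: bit_space_def sets_restr_to_subalg[OF subalgebra_bits])
  also have "\<dots> = emeasure lborel (cyl w)"
    unfolding unif_def by (rule emeasure_restrict_space) (auto simp: cyl_def)
  also have "\<dots> = ennreal (P w)"
    using P_nonneg[of w] by (simp add: cyl_eq)
  finally show ?thesis using P_nonneg by (simp add: measure_def)
qed

lemma wd_eq_sets [measurable]: "{x \<in> space bit_space. wd n x = w} \<in> sets bit_space"
proof (cases "length w = n")
  case True
  then have "{x \<in> space bit_space. wd n x = w} = cyl w" by (auto simp: cyl_def)
  then show ?thesis by simp
next
  case False
  then have eq: "{x \<in> space bit_space. wd n x = w} = {}" by auto
  show ?thesis unfolding eq by (rule sets.empty_sets)
qed

lemma finite_words: "finite {w :: bool list. length w = n}"
  using finite_lists_length_eq[of "UNIV :: bool set" n] by simp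

lemma measurable_wd [measurable]: "wd n \<in> measurable bit_space (count_space UNIV)"
proof (rule measurable_count_space_eq2_countable[THEN iffD2])
  show "wd n \<in> space bit_space \<rightarrow> UNIV \<and> (\<forall>a\<in>UNIV. wd n -` {a} \<inter> space bit_space \<in> sets bit_space)"
    using wd_eq_sets[of n] by (auto simp: vimage_def Int_def conj_commute)
qed

lemma wd_drop: "m \<le> n \<Longrightarrow> drop (n - m) (wd n x) = wd m x"
proof (induction n)
  case (Suc n)
  then show ?case by (cases "m = Suc n") (auto simp: Suc_diff_le)
qed auto

section \<open>Density of the functions of finitely many bits\<close>

definition approximable :: "real set \<Rightarrow> bool" where
  "approximable A \<longleftrightarrow> (\<forall>e>0. \<exists>m S. measure bit_space {x \<in> {0..<1}. x \<in> A \<longleftrightarrow> wd m x \<notin> S} < e)"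

lemma approximable_Un:
  assumes A: "approximable A" "A \<in> sets bit_space" and B: "approximable B" "B \<in> sets bit_space"
  shows "approximable (A \<union> B)"
  unfolding approximable_def
proof (intro allI impI)
  fix e :: real assume "0 < e"
  then have e2: "0 < e / 2" by simp
  obtain m S where 1: "measure bit_space {x \<in> {0..<1}. x \<in> A \<longleftrightarrow> wd m x \<notin> S} < e / 2"
    using A e2 unfolding approximable_def by blast
  obtain n T where 2: "measure bit_space {x \<in> {0..<1}. x \<in> B \<longleftrightarrow> wd n x \<notin> T} < e / 2"
    using B e2 unfolding approximable_def by blast
  define k where "k = max m n"
  define U where "U = {u. drop (k - m) u \<in> S \<or> drop (k - n) u \<in> T}"
  have wU: "wd k x \<in> U \<longleftrightarrow> wd m x \<in> S \<or> wd n x \<in> T" for x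
    by (simp add: U_def wd_drop k_def)
  have sets: "{x \<in> {0..<1}. x \<in> C \<longleftrightarrow> wd i x \<notin> V} \<in> sets bit_space"
    if [measurable]: "C \<in> sets bit_space" for C i V
  proof -
    have "{x \<in> space bit_space. x \<in> C \<longleftrightarrow> wd i x \<notin> V} \<in> sets bit_space" by measurable
    then show ?thesis by simp
  qed
  have "measure bit_space {x \<in> {0..<1}. x \<in> A \<union> B \<longleftrightarrow> wd k x \<notin> U}
    \<le> measure bit_space ({x \<in> {0..<1}. x \<in> A \<longleftrightarrow> wd m x \<notin> S} \<union> {x \<in> {0..<1}. x \<in> B \<longleftrightarrow> wd n x \<notin> T})"
    using A B sets unfolding wU by (intro B.finite_measure_mono) auto
  also have "\<dots> \<le> measure bit_space {x \<in> {0..<1}. x \<in> A \<longleftrightarrow> wd m x \<notin> S}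
      + measure bit_space {x \<in> {0..<1}. x \<in> B \<longleftrightarrow> wd n x \<notin> T}"
    using A B sets by (intro measure_Un_le) auto
  also have "\<dots> < e" using 1 2 by simp
  finally show "\<exists>m S. measure bit_space {x \<in> {0..<1}. x \<in> A \<union> B \<longleftrightarrow> wd m x \<notin> S} < e" by blast
qed

text \<open>Approximability asks for a small symmetric difference with an event in finitely many
  bits. Cylinders qualify, complements and finite unions preserve the property, and continuity from
  below reduces a countable union to the finite unions \<open>D n\<close>.\<close>

lemma approximable_sets:
  assumes "A \<in> sets bit_space"
  shows "approximable A"
  using assms unfolding sets_bit_space
proof (induction rule: sigma_sets.induct)
  case (Basic A)
  then obtain w where A: "A = cyl w" by auto
  have eq: "{x \<in> {0..<1}. x \<in> A \<longleftrightarrow> wd (length w) x \<notin> {w}} = {}" by (auto simp: A cyl_def)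
  show ?case unfolding approximable_def
  proof (intro allI impI)
    fix e :: real assume "0 < e"
    then have "measure bit_space {x \<in> {0..<1}. x \<in> A \<longleftrightarrow> wd (length w) x \<notin> {w}} < e"
      unfolding eq by simp
    then show "\<exists>m S. measure bit_space {x \<in> {0..<1}. x \<in> A \<longleftrightarrow> wd m x \<notin> S} < e" by blast
  qed
next
  case Empty
  show ?case unfolding approximable_def
  proof (intro allI impI)
    fix e :: real assume "0 < e"
    then have "measure bit_space {x \<in> {0..<1}. x \<in> {} \<longleftrightarrow> wd 0 x \<notin> {}} < e" by simp
    then show "\<exists>m S. measure bit_space {x \<in> {0..<1}. x \<in> {} \<longleftrightarrow> wd m x \<notin> S} < e" by blast
  qed
next
  case (Compl A)
  show ?case unfolding approximable_def
  proof (intro allI impI)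
    fix e :: real assume "0 < e"
    then obtain m S where mS: "measure bit_space {x \<in> {0..<1}. x \<in> A \<longleftrightarrow> wd m x \<notin> S} < e"
      using Compl.IH unfolding approximable_def by blast
    have eq: "{x \<in> {0..<1}. x \<in> {0..<1} - A \<longleftrightarrow> wd m x \<notin> - S} = {x \<in> {0..<1}. x \<in> A \<longleftrightarrow> wd m x \<notin> S}"
      by auto
    then show "\<exists>m S. measure bit_space {x \<in> {0..<1}. x \<in> {0..<1} - A \<longleftrightarrow> wd m x \<notin> S} < e"
      by (intro exI[of _ m] exI[of _ "- S"]) (simp only: eq mS)
  qed
next
  case (Union A)
  have s: "A i \<in> sets bit_space" for i using Union.hyps by (simp add: sets_bit_space)
  define D where "D n = (\<Union>i<n. A i)" for n
  have Ds [measurable]: "D n \<in> sets bit_space" for n unfolding D_def using s by auto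
  have As [measurable]: "(\<Union>i. A i) \<in> sets bit_space" using s by auto
  have aD: "approximable (D n)" for n
  proof (induction n)
    case 0
    show ?case unfolding approximable_def
    proof (intro allI impI)
      fix e :: real assume "0 < e"
      then have "measure bit_space {x \<in> {0..<1}. x \<in> D 0 \<longleftrightarrow> wd 0 x \<notin> {}} < e" by (simp add: D_def)
      then show "\<exists>m S. measure bit_space {x \<in> {0..<1}. x \<in> D 0 \<longleftrightarrow> wd m x \<notin> S} < e" by blast
    qed
  next
    case (Suc n)
    have "D (Suc n) = D n \<union> A n" by (auto simp: D_def less_Suc_eq)
    then show ?case using approximable_Un[OF Suc Ds Union.IH s] by simp
  qed
  have "(\<lambda>n. measure bit_space (D n)) \<longlonglongrightarrow> measure bit_space (\<Union>n. D n)"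
  proof (rule B.finite_Lim_measure_incseq)
    show "incseq D" unfolding incseq_def D_def by (intro allI impI UN_mono) auto
  qed (use Ds in auto)
  moreover have "(\<Union>n. D n) = (\<Union>i. A i)" by (auto simp: D_def)
  ultimately have lim: "(\<lambda>n. measure bit_space (D n)) \<longlonglongrightarrow> measure bit_space (\<Union>i. A i)" by simp
  show ?case unfolding approximable_def
  proof (intro allI impI)
    fix e :: real assume "0 < e"
    then have e2: "0 < e / 2" by simp
    obtain n where n: "\<bar>measure bit_space (D n) - measure bit_space (\<Union>i. A i)\<bar> < e / 2"
      using LIMSEQ_D[OF lim e2] by auto
    obtain m S where mS: "measure bit_space {x \<in> {0..<1}. x \<in> D n \<longleftrightarrow> wd m x \<notin> S} < e / 2"
      using aD[of n] e2 unfolding approximable_def by blast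
    have sets: "{x \<in> {0..<1}. x \<in> D n \<longleftrightarrow> wd m x \<notin> S} \<in> sets bit_space"
    proof -
      have "{x \<in> space bit_space. x \<in> D n \<longleftrightarrow> wd m x \<notin> S} \<in> sets bit_space" by measurable
      then show ?thesis by simp
    qed
    have "measure bit_space {x \<in> {0..<1}. x \<in> (\<Union>i. A i) \<longleftrightarrow> wd m x \<notin> S}
      \<le> measure bit_space (((\<Union>i. A i) - D n) \<union> {x \<in> {0..<1}. x \<in> D n \<longleftrightarrow> wd m x \<notin> S})"
    proof (rule B.finite_measure_mono)
      show "((\<Union>i. A i) - D n) \<union> {x \<in> {0..<1}. x \<in> D n \<longleftrightarrow> wd m x \<notin> S} \<in> sets bit_space"
        using sets As Ds by (intro sets.Un sets.Diff)
    qed (auto simp: D_def)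
    also have "\<dots> \<le> measure bit_space ((\<Union>i. A i) - D n)
        + measure bit_space {x \<in> {0..<1}. x \<in> D n \<longleftrightarrow> wd m x \<notin> S}"
      using sets As Ds by (intro measure_Un_le sets.Diff)
    also have "measure bit_space ((\<Union>i. A i) - D n) = measure bit_space (\<Union>i. A i) - measure bit_space (D n)"
      using As Ds by (intro B.finite_measure_Diff) (auto simp: D_def)
    finally have "measure bit_space {x \<in> {0..<1}. x \<in> (\<Union>i. A i) \<longleftrightarrow> wd m x \<notin> S} < e"
      using n mS by linarith
    then show "\<exists>m S. measure bit_space {x \<in> {0..<1}. x \<in> \<Union> (range A) \<longleftrightarrow> wd m x \<notin> S} < e" by blast
  qed
qed

lemma measurable_word_fun [measurable]: "(\<lambda>x. \<alpha> (wd m x)) \<in> borel_measurable bit_space"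
  by measurable

lemma word_fun_bounded: "\<exists>C. \<forall>x. \<bar>\<alpha> (wd m x) :: real\<bar> \<le> C"
proof
  have "finite ((\<lambda>w. \<bar>\<alpha> w\<bar>) ` {w. length w = m})" using finite_words by simp
  then show "\<forall>x. \<bar>\<alpha> (wd m x)\<bar> \<le> Max ((\<lambda>w. \<bar>\<alpha> w\<bar>) ` {w. length w = m})" by auto
qed

lemma integrable_word_fun: "integrable bit_space (\<lambda>x. \<alpha> (wd m x) :: real)"
proof -
  obtain C where "\<And>x. \<bar>\<alpha> (wd m x)\<bar> \<le> C" using word_fun_bounded[of \<alpha> m] by blast
  then show ?thesis by (intro B.integrable_const_bound[where B = C]) auto
qed

lemma L1_approx:
  fixes v :: "real \<Rightarrow> real"
  assumes "integrable bit_space v" "0 < e"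
  shows "\<exists>m \<alpha>. (\<integral>x. \<bar>v x - \<alpha> (wd m x)\<bar> \<partial>bit_space) < e"
  using assms
proof (induction arbitrary: e rule: integrable_induct)
  case (base A c)
  have A: "A \<in> sets bit_space" using base by simp
  \<comment> \<open>The summand 1 covers \<open>c = 0\<close>.\<close>
  have "0 < e / (\<bar>c\<bar> + 1)" using base by simp
  then obtain m S where mS: "measure bit_space {x \<in> {0..<1}. x \<in> A \<longleftrightarrow> wd m x \<notin> S} < e / (\<bar>c\<bar> + 1)"
    using approximable_sets[OF A] unfolding approximable_def by blast
  define \<alpha> where "\<alpha> w = c * indicator S w" for w
  define T where "T = {x \<in> {0..<1}. x \<in> A \<longleftrightarrow> wd m x \<notin> S}"
  have "{x \<in> space bit_space. x \<in> A \<longleftrightarrow> wd m x \<notin> S} \<in> sets bit_space" using A by measurable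
  then have T: "T \<in> sets bit_space" by (simp add: T_def)
  have "(\<integral>x. \<bar>indicator A x *\<^sub>R c - \<alpha> (wd m x)\<bar> \<partial>bit_space)
    = (\<integral>x. \<bar>c\<bar> * indicator T x \<partial>bit_space)"
    by (rule Bochner_Integration.integral_cong) (auto simp: \<alpha>_def T_def indicator_def)
  also have "\<dots> = \<bar>c\<bar> * measure bit_space T"
    using T by (simp add: sets.Int_space_eq2 del: space_bit_space)
  also have "\<dots> \<le> (\<bar>c\<bar> + 1) * measure bit_space T"
    by (intro mult_right_mono) auto
  also have "\<dots> < e" using mS unfolding T_def[symmetric] by (simp add: field_simps)
  finally show ?case by blast
next
  case (add f g)
  have "0 < e / 2" using add by simp
  obtain m \<alpha> where 1: "(\<integral>x. \<bar>f x - \<alpha> (wd m x)\<bar> \<partial>bit_space) < e / 2" using add.IH(1)[OF \<open>0 < e / 2\<close>] by blast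
  obtain n \<beta> where 2: "(\<integral>x. \<bar>g x - \<beta> (wd n x)\<bar> \<partial>bit_space) < e / 2" using add.IH(2)[OF \<open>0 < e / 2\<close>] by blast
  define k where "k = max m n"
  define \<gamma> where "\<gamma> u = \<alpha> (drop (k - m) u) + \<beta> (drop (k - n) u)" for u
  have \<gamma>: "\<gamma> (wd k x) = \<alpha> (wd m x) + \<beta> (wd n x)" for x by (simp add: \<gamma>_def wd_drop k_def)
  note [simp] = add.hyps integrable_word_fun
  have "(\<integral>x. \<bar>(f x + g x) - \<gamma> (wd k x)\<bar> \<partial>bit_space)
    \<le> (\<integral>x. \<bar>f x - \<alpha> (wd m x)\<bar> + \<bar>g x - \<beta> (wd n x)\<bar> \<partial>bit_space)"
    unfolding \<gamma> by (intro integral_mono) auto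
  also have "\<dots> = (\<integral>x. \<bar>f x - \<alpha> (wd m x)\<bar> \<partial>bit_space) + (\<integral>x. \<bar>g x - \<beta> (wd n x)\<bar> \<partial>bit_space)"
    by (intro Bochner_Integration.integral_add) auto
  finally show ?case using 1 2 by (intro exI[of _ k] exI[of _ \<gamma>]) simp
next
  case (lim f s)
  have [measurable]: "f \<in> borel_measurable bit_space" "\<And>i. s i \<in> borel_measurable bit_space"
    using lim.hyps(1,4) by auto
  note [simp] = lim.hyps(1) lim.hyps(4) integrable_word_fun
  have "(\<lambda>i. \<integral>x. \<bar>f x - s i x\<bar> \<partial>bit_space) \<longlonglongrightarrow> (\<integral>x. 0 \<partial>bit_space)"
  \<comment> \<open>The approximants supplied by \<open>integrable_induct\<close> satisfy
    \<open>\<bar>s i x\<bar> \<le> 2 * \<bar>f x\<bar>\<close>, whence the dominating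
    function.\<close>
  proof (rule integral_dominated_convergence[where w = "\<lambda>x. 3 * \<bar>f x\<bar>"])
    show "AE x in bit_space. (\<lambda>i. \<bar>f x - s i x\<bar>) \<longlonglongrightarrow> 0"
    proof (rule AE_I2)
      fix x assume "x \<in> space bit_space"
      then have "(\<lambda>i. \<bar>f x - s i x\<bar>) \<longlonglongrightarrow> \<bar>f x - f x\<bar>"
        using lim.hyps(2) by (intro tendsto_intros)
      then show "(\<lambda>i. \<bar>f x - s i x\<bar>) \<longlonglongrightarrow> 0" by simp
    qed
    show "AE x in bit_space. norm \<bar>f x - s i x\<bar> \<le> 3 * \<bar>f x\<bar>" for i
    proof (rule AE_I2)
      fix x assume "x \<in> space bit_space"
      then have "\<bar>s i x\<bar> \<le> 2 * \<bar>f x\<bar>" using lim.hyps(3) by simp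
      then show "norm \<bar>f x - s i x\<bar> \<le> 3 * \<bar>f x\<bar>" by simp
    qed
  qed auto
  then have "(\<lambda>i. \<integral>x. \<bar>f x - s i x\<bar> \<partial>bit_space) \<longlonglongrightarrow> 0" by simp
  moreover have e2: "0 < e / 2" using lim by simp
  ultimately obtain i where i: "(\<integral>x. \<bar>f x - s i x\<bar> \<partial>bit_space) < e / 2"
    by (metis (no_types, lifting) eventually_happens order_tendstoD(2) sequentially_bot)
  obtain m \<alpha> where 1: "(\<integral>x. \<bar>s i x - \<alpha> (wd m x)\<bar> \<partial>bit_space) < e / 2" using lim.IH[OF e2] by blast
  have "(\<integral>x. \<bar>f x - \<alpha> (wd m x)\<bar> \<partial>bit_space) \<le> (\<integral>x. \<bar>f x - s i x\<bar> + \<bar>s i x - \<alpha> (wd m x)\<bar> \<partial>bit_space)"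
    by (intro integral_mono) auto
  also have "\<dots> = (\<integral>x. \<bar>f x - s i x\<bar> \<partial>bit_space) + (\<integral>x. \<bar>s i x - \<alpha> (wd m x)\<bar> \<partial>bit_space)"
    by (intro Bochner_Integration.integral_add) auto
  finally show ?case using i 1 by (intro exI[of _ m] exI[of _ \<alpha>]) simp
qed

text \<open>Truncating the \<open>L^1\<close> approximants to the range of \<open>v\<close> brings
  them no farther from \<open>v\<close>, and a subsequence converges almost everywhere. The uniform
  bound is essential later: it keeps the approximants of a profile function admissible and dominates
  their p-th powers.\<close>

lemma AE_approx:
  fixes v :: "real \<Rightarrow> real"
  assumes v: "v \<in> borel_measurable bit_space" "AE x in bit_space. \<bar>v x\<bar> \<le> C" and C: "0 \<le> C"
  obtains m \<alpha> where "\<And>n u. \<bar>\<alpha> n u\<bar> \<le> C" "AE x in bit_space. (\<lambda>n. \<alpha> n (wd (m n) x)) \<longlonglongrightarrow> v x"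
proof -
  have iv: "integrable bit_space v" using v by (intro B.integrable_const_bound) auto
  have "\<forall>n. \<exists>m \<alpha>. (\<integral>x. \<bar>v x - \<alpha> (wd m x)\<bar> \<partial>bit_space) < inverse (real (Suc n))"
    using L1_approx[OF iv] by simp
  then obtain m \<alpha> where \<alpha>: "\<And>n. (\<integral>x. \<bar>v x - \<alpha> n (wd (m n) x)\<bar> \<partial>bit_space) < inverse (real (Suc n))"
    by metis
  define \<beta> where "\<beta> n u = max (- C) (min C (\<alpha> n u))" for n u
  have \<beta>C: "\<bar>\<beta> n u\<bar> \<le> C" for n u using C by (auto simp: \<beta>_def)
  note [simp] = integrable_word_fun iv
  have "(\<integral>x. \<bar>v x - \<beta> n (wd (m n) x)\<bar> \<partial>bit_space) \<le> (\<integral>x. \<bar>v x - \<alpha> n (wd (m n) x)\<bar> \<partial>bit_space)" for n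
    by (intro integral_mono_AE) (use v(2) in \<open>auto simp: \<beta>_def elim!: eventually_mono\<close>)
  then have le: "(\<integral>x. \<bar>v x - \<beta> n (wd (m n) x)\<bar> \<partial>bit_space) \<le> inverse (real (Suc n))" for n
    using \<alpha>[of n] by (meson less_imp_le order_trans)
  have "(\<lambda>n. \<integral>x. norm (v x - \<beta> n (wd (m n) x)) \<partial>bit_space) \<longlonglongrightarrow> 0"
    by (rule tendsto_sandwich[OF _ _ tendsto_const LIMSEQ_inverse_real_of_nat]) (use le in auto)
  from tendsto_L1_AE_subseq[OF _ this] obtain r where r: "strict_mono (r :: nat \<Rightarrow> nat)"
    "AE x in bit_space. (\<lambda>n. v x - \<beta> (r n) (wd (m (r n)) x)) \<longlonglongrightarrow> 0" by auto
  show thesis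
  proof (rule that[of "\<lambda>n. \<beta> (r n)" "\<lambda>n. m (r n)"])
    show "AE x in bit_space. (\<lambda>n. \<beta> (r n) (wd (m (r n)) x)) \<longlonglongrightarrow> v x"
      using r(2)
    proof eventually_elim
      case (elim x)
      from tendsto_diff[OF tendsto_const[of "v x"] elim] show ?case by simp
    qed
  qed (rule \<beta>C)
qed

end

section \<open>Limits of systems of bits\<close>

lemma P_operatorD:
  assumes "P_operator M T"
  shows "prob_space M"
    and "\<And>v. Linf M v \<Longrightarrow> T v \<in> borel_measurable M"
    and "\<And>v. Linf M v \<Longrightarrow> integrable M (T v)"
    and "\<And>v w. Linf M v \<Longrightarrow> Linf M w \<Longrightarrow> AE x in M. v x = w x \<Longrightarrow> AE x in M. T v x = T w x"
    and "\<And>v w a b. Linf M v \<Longrightarrow> Linf M w \<Longrightarrow> AE x in M. T (\<lambda>y. a * v y + b * w y) x = a * T v x + b * T w x"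
  using assms unfolding P_operator_def by blast+

lemma LinfI: "v \<in> borel_measurable M \<Longrightarrow> (\<And>x. x \<in> space M \<Longrightarrow> \<bar>v x\<bar> \<le> C) \<Longrightarrow> Linf M v"
  unfolding Linf_def by (auto intro!: exI[of _ C])

lemma Linf_lincomb:
  assumes "Linf M v" "Linf M w"
  shows "Linf M (\<lambda>x. a * v x + b * w x)"
proof -
  obtain C D where CD: "AE x in M. \<bar>v x\<bar> \<le> C" "AE x in M. \<bar>w x\<bar> \<le> D" using assms by (auto simp: Linf_def)
  have "AE x in M. \<bar>a * v x + b * w x\<bar> \<le> \<bar>a\<bar> * C + \<bar>b\<bar> * D"
    using CD
  proof eventually_elim
    case (elim x)
    have "\<bar>a * v x + b * w x\<bar> \<le> \<bar>a\<bar> * \<bar>v x\<bar> + \<bar>b\<bar> * \<bar>w x\<bar>"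
      by (metis abs_mult abs_triangle_ineq)
    also have "\<dots> \<le> \<bar>a\<bar> * C + \<bar>b\<bar> * D" using elim by (intro add_mono mult_left_mono) auto
    finally show ?case .
  qed
  then show ?thesis using assms unfolding Linf_def by auto
qed

lemma Markov_nn:
  assumes M: "prob_space M" and f: "f \<in> borel_measurable M" and c: "0 < c" "0 \<le> b"
    and le: "(\<integral>\<^sup>+x. ennreal \<bar>f x\<bar> \<partial>M) \<le> ennreal b"
  shows "measure M {x \<in> space M. c \<le> \<bar>f x :: real\<bar>} \<le> b / c"
proof -
  interpret prob_space M by fact
  note [measurable] = f
  have "ennreal c * emeasure M {x \<in> space M. c \<le> \<bar>f x\<bar>}
    = (\<integral>\<^sup>+x. ennreal c * indicator {x \<in> space M. c \<le> \<bar>f x\<bar>} x \<partial>M)"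
    by (simp add: nn_integral_cmult_indicator)
  also have "\<dots> \<le> (\<integral>\<^sup>+x. ennreal \<bar>f x\<bar> \<partial>M)"
    by (intro nn_integral_mono) (auto simp: indicator_def intro!: ennreal_leI)
  also note le
  finally have "c * measure M {x \<in> space M. c \<le> \<bar>f x\<bar>} \<le> b"
    using c by (simp add: emeasure_eq_measure ennreal_mult'[symmetric])
  then show ?thesis using c by (simp add: field_simps)
qed

section \<open>Formal linear combinations and integrals of functions of labels\<close>

definition comb :: "(real \<times> 'w) list \<Rightarrow> ('w \<Rightarrow> real) \<Rightarrow> real" where
  "comb xs f = (\<Sum>(a, w)\<leftarrow>xs. a * f w)"

lemma comb_simps [simp]: "comb [] f = 0" "comb ((a, w) # xs) f = a * f w + comb xs f"
  by (simp_all add: comb_def)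

lemma comb_append [simp]: "comb (xs @ ys) f = comb xs f + comb ys f"
  by (simp add: comb_def)

lemma comb_scale [simp]: "comb (map (\<lambda>(a, w). (c * a, w)) xs) f = c * comb xs f"
  by (induction xs) (auto simp: algebra_simps)

lemma comb_cong: "(\<And>w. w \<in> snd ` set xs \<Longrightarrow> f w = g w) \<Longrightarrow> comb xs f = comb xs g"
  by (induction xs) auto

lemma comb_diff_le:
  "(\<And>w. w \<in> snd ` set xs \<Longrightarrow> \<bar>f w - g w\<bar> \<le> d) \<Longrightarrow> \<bar>comb xs f - comb xs g\<bar> \<le> (\<Sum>(a, w)\<leftarrow>xs. \<bar>a\<bar>) * d"
proof (induction xs)
  case (Cons x xs)
  obtain a w where x: "x = (a, w)" by (cases x)
  have "\<bar>comb (x # xs) f - comb (x # xs) g\<bar> \<le> \<bar>a * (f w - g w)\<bar> + \<bar>comb xs f - comb xs g\<bar>"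
    by (simp add: x algebra_simps)
  also have "\<dots> \<le> \<bar>a\<bar> * d + (\<Sum>(a, w)\<leftarrow>xs. \<bar>a\<bar>) * d"
    using Cons by (intro add_mono) (auto simp: x abs_mult intro!: mult_left_mono)
  finally show ?case by (simp add: x algebra_simps)
qed auto

lemma comb_measurable [measurable (raw)]:
  "(\<And>w. w \<in> snd ` set xs \<Longrightarrow> f w \<in> borel_measurable M) \<Longrightarrow> (\<lambda>x. comb xs (\<lambda>w. f w x)) \<in> borel_measurable M"
  by (induction xs) auto

lemma sum_labels_indicator:
  assumes "finite C" "c x \<in> C" "x \<in> space M"
  shows "(\<Sum>u\<in>C. g u * indicator {x \<in> space M. c x = u} x) = (g (c x) :: ennreal)"
proof -
  have "(\<Sum>u\<in>C. g u * indicator {x \<in> space M. c x = u} x) = (\<Sum>u\<in>C. if c x = u then g u else 0)"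
    using assms by (intro sum.cong) auto
  then show ?thesis using assms by simp
qed

lemma nn_integral_labels:
  assumes M: "prob_space M" and C: "finite C" "\<And>x. x \<in> space M \<Longrightarrow> c x \<in> C"
    and s: "\<And>u. u \<in> C \<Longrightarrow> {x \<in> space M. c x = u} \<in> sets M" and g: "\<And>u. 0 \<le> g u"
  shows "(\<integral>\<^sup>+x. ennreal (g (c x)) \<partial>M) = ennreal (\<Sum>u\<in>C. g u * measure M {x \<in> space M. c x = u})"
proof -
  interpret prob_space M by fact
  have "(\<integral>\<^sup>+x. ennreal (g (c x)) \<partial>M)
    = (\<integral>\<^sup>+x. (\<Sum>u\<in>C. ennreal (g u) * indicator {x \<in> space M. c x = u} x) \<partial>M)"
    using C by (intro nn_integral_cong sum_labels_indicator[symmetric, where g = "\<lambda>u. ennreal (g u)"]) auto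
  also have "\<dots> = (\<Sum>u\<in>C. \<integral>\<^sup>+x. ennreal (g u) * indicator {x \<in> space M. c x = u} x \<partial>M)"
    using s by (intro nn_integral_sum) auto
  also have "\<dots> = (\<Sum>u\<in>C. ennreal (g u * measure M {x \<in> space M. c x = u}))"
    using s g by (intro sum.cong) (auto simp: nn_integral_cmult_indicator emeasure_eq_measure ennreal_mult)
  also have "\<dots> = ennreal (\<Sum>u\<in>C. g u * measure M {x \<in> space M. c x = u})"
    using g by (intro sum_ennreal) auto
  finally show ?thesis .
qed

text \<open>\<open>ix w t\<close> is the position of the bit that tells whether the image of the indicator of the word \<open>w\<close>
  is below \<open>t\<close>.\<close>
locale bit_system =
  fixes M :: "nat \<Rightarrow> 'a measure" and A :: "nat \<Rightarrow> ('a \<Rightarrow> real) \<Rightarrow> 'a \<Rightarrow> real"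
    and K p :: real and q :: ennreal
    and bl :: "nat \<Rightarrow> nat \<Rightarrow> 'a \<Rightarrow> bool list" and P :: "bool list \<Rightarrow> real"
    and ix :: "bool list \<Rightarrow> rat \<Rightarrow> nat"
  assumes p1: "1 \<le> p" and q1: "1 \<le> q" and K0: "0 \<le> K"
    and P_op: "\<And>i. P_operator (M i) (A i)"
    and bound: "\<And>i v c. Linf (M i) v \<Longrightarrow> 0 \<le> c \<Longrightarrow> lpnorm (M i) (ennreal p) v \<le> ennreal c
      \<Longrightarrow> lpnorm (M i) q (A i v) \<le> ennreal (K * c)"
    and tl_bl: "\<And>i n x. tl (bl i (Suc n) x) = bl i n x"
    and length_bl [simp]: "\<And>i n x. length (bl i n x) = n"
    and bl_sets: "\<And>i n w. {x \<in> space (M i). bl i n x = w} \<in> sets (M i)"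
    and bl_lim: "\<And>w. (\<lambda>i. measure (M i) {x \<in> space (M i). bl i (length w) x = w}) \<longlonglongrightarrow> P w"
    and ix: "\<And>i w t x. x \<in> space (M i) \<Longrightarrow>
      hd (bl i (Suc (ix w t)) x) \<longleftrightarrow> A i (\<lambda>y. of_bool (bl i (length w) y = w)) x < of_rat t"
begin

lemma prob_space_M: "prob_space (M i)"
  using P_operatorD(1)[OF P_op] .

lemma bl_Cons: "bl i (Suc n) x = b # w \<longleftrightarrow> bl i n x = w \<and> hd (bl i (Suc n) x) = b"
proof (cases "bl i (Suc n) x")
  case Nil
  then show ?thesis using length_bl[of i "Suc n" x] by simp
next
  case (Cons c u)
  then show ?thesis using tl_bl[of i n x] by auto
qed

text \<open>A word has exactly two one-bit extensions, so the splitting rule holds for the word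
  probabilities on every \<open>M i\<close>; it is a finite identity and survives the limit.\<close>

sublocale word_measure P
proof
  fix w
  show "0 \<le> P w" by (rule LIMSEQ_le_const[OF bl_lim]) auto
  have "bl i 0 x = []" for i x by (metis length_0_conv length_bl)
  then have one: "(\<lambda>i. measure (M i) {x \<in> space (M i). bl i (length []) x = []}) = (\<lambda>i. 1)"
    using prob_space.prob_space[OF prob_space_M] by (simp add: fun_eq_iff)
  have "(\<lambda>i. 1) \<longlonglongrightarrow> P []" using bl_lim[of "[]"] unfolding one .
  then show "P [] = 1" by (simp add: LIMSEQ_const_iff)
  have "measure (M i) {x \<in> space (M i). bl i (length w) x = w}
    = measure (M i) {x \<in> space (M i). bl i (length (False # w)) x = False # w}
      + measure (M i) {x \<in> space (M i). bl i (length (True # w)) x = True # w}" for i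
  proof -
    interpret prob_space "M i" by (rule prob_space_M)
    let ?F = "{x \<in> space (M i). bl i (length (False # w)) x = False # w}"
    let ?T = "{x \<in> space (M i). bl i (length (True # w)) x = True # w}"
    have eq: "{x \<in> space (M i). bl i (length w) x = w} = ?F \<union> ?T"
      unfolding list.size(4) add_Suc_right add_0_right bl_Cons by auto
    have "?F \<inter> ?T = {}" by auto
    from finite_measure_Union[OF bl_sets bl_sets this] show ?thesis unfolding eq .
  qed
  then have "(\<lambda>i. measure (M i) {x \<in> space (M i). bl i (length w) x = w}) \<longlonglongrightarrow> P (False # w) + P (True # w)"
    using tendsto_add[OF bl_lim[of "False # w"] bl_lim[of "True # w"]] by (simp only:)
  then show "P w = P (False # w) + P (True # w)" using LIMSEQ_unique[OF bl_lim] by blast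
qed

abbreviation words :: "nat \<Rightarrow> bool list set" where
  "words n \<equiv> {w. length w = n}"

lemma bl_drop: "m \<le> n \<Longrightarrow> drop (n - m) (bl i n x) = bl i m x"
proof (induction n)
  case (Suc n)
  show ?case
  proof (cases "m = Suc n")
    case False
    then have "drop (Suc n - m) (bl i (Suc n) x) = drop (n - m) (tl (bl i (Suc n) x))"
      using Suc.prems by (simp add: Suc_diff_le drop_Suc)
    then show ?thesis using Suc False by (simp add: tl_bl)
  qed simp
qed (use length_bl[of i 0 x] in simp)

lemma bl_lim': "(\<lambda>i. measure (M i) {x \<in> space (M i). bl i n x = w}) \<longlonglongrightarrow> measure bit_space {y \<in> space bit_space. wd n y = w}"
proof (cases "length w = n")
  case True
  then have "{y \<in> space bit_space. wd n y = w} = cyl w" by (auto simp: cyl_def)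
  then show ?thesis using bl_lim[of w] True by (simp add: measure_cyl)
next
  case False
  then have eq: "{y \<in> space bit_space. wd n y = w} = {}" "\<And>i. {x \<in> space (M i). bl i n x = w} = {}" by auto
  show ?thesis unfolding eq by simp
qed

text \<open>There are finitely many words of a given length. The sum is the label error
  \<open>b\<close> of \<open>dLP_le_labels\<close>.\<close>

lemma label_distance_lim:
  "(\<lambda>i. \<Sum>u\<in>words n. \<bar>measure (M i) {x \<in> space (M i). bl i n x = u}
      - measure bit_space {y \<in> space bit_space. wd n y = u}\<bar>) \<longlonglongrightarrow> 0"
proof -
  have "(\<lambda>i. \<Sum>u\<in>words n. \<bar>measure (M i) {x \<in> space (M i). bl i n x = u}
      - measure bit_space {y \<in> space bit_space. wd n y = u}\<bar>)
    \<longlonglongrightarrow> (\<Sum>u\<in>words n. \<bar>measure bit_space {y \<in> space bit_space. wd n y = u} - measure bit_space {y \<in> space bit_space. wd n y = u}\<bar>)"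
    by (intro tendsto_sum tendsto_rabs tendsto_diff bl_lim' tendsto_const)
  then show ?thesis by simp
qed

lemma word_event_lim:
  assumes "Q \<subseteq> words n"
  shows "(\<lambda>i. measure (M i) {x \<in> space (M i). bl i n x \<in> Q}) \<longlonglongrightarrow> measure bit_space {y \<in> space bit_space. wd n y \<in> Q}"
  unfolding measure_label_sum(1)[OF prob_space_M finite_words assms bl_sets]
    measure_label_sum(1)[OF prob_space_bit_space finite_words assms wd_eq_sets]
  by (intro tendsto_sum bl_lim')

section \<open>Images of word indicators read off from the bits\<close>

definition ind :: "nat \<Rightarrow> bool list \<Rightarrow> 'a \<Rightarrow> real" where
  "ind i w x = of_bool (bl i (length w) x = w)"

definition ind' :: "bool list \<Rightarrow> real \<Rightarrow> real" where
  "ind' w y = of_bool (wd (length w) y = w)"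

definition h :: "nat \<Rightarrow> bool list \<Rightarrow> 'a \<Rightarrow> real" where
  "h i w = A i (ind i w)"

definition bit :: "bool list \<Rightarrow> rat \<Rightarrow> real \<Rightarrow> bool" where
  "bit w t y \<longleftrightarrow> hd (wd (Suc (ix w t)) y)"

text \<open>The bit at \<open>t\<close> claims that the image lies below \<open>t\<close>, so the
  image is the infimum of the accepted thresholds. It is taken in the extended reals, where it
  always exists; on the null set where \<open>good\<close> fails, the conversion may yield a default
  value.\<close>

definition h' :: "bool list \<Rightarrow> real \<Rightarrow> real" where
  "h' w y = real_of_ereal (INF t. if bit w t y then ereal (of_rat t) else \<infinity>)"

lemma ix_h: "x \<in> space (M i) \<Longrightarrow> hd (bl i (Suc (ix w t)) x) \<longleftrightarrow> h i w x < of_rat t"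
  using ix unfolding h_def ind_def[abs_def] .

lemma ind_measurable [measurable]: "ind i w \<in> borel_measurable (M i)"
proof -
  have [measurable]: "Measurable.pred (M i) (\<lambda>x. bl i (length w) x = w)"
    using bl_sets by (simp add: pred_def)
  show ?thesis unfolding ind_def[abs_def] by measurable
qed

lemma Linf_ind: "Linf (M i) (ind i w)"
  by (rule LinfI[where C = 1]) (auto simp: ind_def)

lemma h_measurable [measurable]: "h i w \<in> borel_measurable (M i)"
  unfolding h_def by (rule P_operatorD(2)[OF P_op Linf_ind])

lemma ind'_measurable [measurable]: "ind' w \<in> borel_measurable bit_space"
  unfolding ind'_def[abs_def] by measurable

lemma bit_measurable [measurable]: "Measurable.pred bit_space (bit w t)"
  unfolding bit_def[abs_def] by measurable

lemma h'_measurable [measurable]: "h' w \<in> borel_measurable bit_space"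
  unfolding h'_def[abs_def] by measurable

text \<open>An indicator has p-norm at most 1, and on a probability space the q-norm dominates the
  \<open>L^1\<close> norm. The bound is uniform in the space and in the word, which is the source of
  all tightness below.\<close>

lemma h_L1: "(\<integral>\<^sup>+x. ennreal \<bar>h i w x\<bar> \<partial>M i) \<le> ennreal K"
proof -
  interpret prob_space "M i" by (rule prob_space_M)
  have "lpnorm (M i) (ennreal p) (ind i w) \<le> ennreal 1"
    using p1 by (intro lpnorm_le_const) (auto simp: ind_def)
  then have "lpnorm (M i) q (h i w) \<le> ennreal K"
    unfolding h_def using bound[OF Linf_ind, of 1] by simp
  then show ?thesis using q1 K0 by (intro nn_integral_le_lpnorm[of q]) auto
qed

lemma h_Markov: "0 < L \<Longrightarrow> measure (M i) {x \<in> space (M i). L \<le> \<bar>h i w x\<bar>} \<le> K / L"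
  by (rule Markov_nn[OF prob_space_M h_measurable _ K0 h_L1])

text \<open>The bits of \<open>w\<close> at \<open>y\<close> describe a proper cut of the rationals,
  hence a finite real number.\<close>

definition good :: "bool list \<Rightarrow> real \<Rightarrow> bool" where
  "good w y \<longleftrightarrow> (\<forall>t t'. t < t' \<longrightarrow> bit w t y \<longrightarrow> bit w t' y) \<and> (\<exists>t. \<not> bit w t y) \<and> (\<exists>t. bit w t y)"

text \<open>A violation is an event in finitely many bits, and it is empty on every
  \<open>M i\<close>; so its limiting probability is 0.\<close>

lemma AE_bit_mono: "AE y in bit_space. t < t' \<longrightarrow> bit w t y \<longrightarrow> bit w t' y"
proof (cases "t < t'")
  case True
  define n where "n = Suc (max (ix w t) (ix w t'))"
  define val where "val s u = hd (drop (n - Suc (ix w s)) u)" for s and u :: "bool list"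
  define Q where "Q = {u \<in> words n. val t u \<and> \<not> val t' u}"
  have val_bl: "val s (bl i n x) = hd (bl i (Suc (ix w s)) x)" if "s \<in> {t, t'}" for s i x
    using that unfolding val_def by (subst bl_drop) (auto simp: n_def)
  have val_wd: "val s (wd n y) = bit w s y" if "s \<in> {t, t'}" for s y
    using that unfolding val_def bit_def by (subst wd_drop) (auto simp: n_def)
  have lt: "of_rat t < (of_rat t' :: real)" using True by (simp add: of_rat_less)
  have eq: "{x \<in> space (M i). bl i n x \<in> Q} = {}" for i
  proof -
    have "\<not> (val t (bl i n x) \<and> \<not> val t' (bl i n x))" if "x \<in> space (M i)" for x
      using lt by (simp add: val_bl ix_h[OF that])
    then show ?thesis by (auto simp: Q_def)
  qed
  then have Q0: "measure bit_space {y \<in> space bit_space. wd n y \<in> Q} = 0"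
  proof -
    have "Q \<subseteq> words n" by (auto simp: Q_def)
    from word_event_lim[OF this] show ?thesis unfolding eq by (simp add: LIMSEQ_const_iff)
  qed
  have "{y \<in> space bit_space. wd n y \<in> Q} \<in> sets bit_space" by measurable
  from iffD1[OF B.prob_Collect_eq_0[OF this] Q0] have "AE y in bit_space. wd n y \<notin> Q" .
  then show ?thesis by eventually_elim (simp add: Q_def val_wd)
qed simp

lemma measure_bit_le:
  assumes "\<And>i. measure (M i) {x \<in> space (M i). (h i w x < of_rat t) = b} \<le> c"
  shows "measure bit_space {y \<in> space bit_space. bit w t y = b} \<le> c"
proof -
  let ?n = "Suc (ix w t)"
  let ?Q = "{u \<in> words ?n. hd u = b}"
  have "measure bit_space {y \<in> space bit_space. wd ?n y \<in> ?Q} \<le> c"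
  proof (rule LIMSEQ_le_const2[OF word_event_lim])
    have "{x \<in> space (M i). bl i ?n x \<in> ?Q} = {x \<in> space (M i). (h i w x < of_rat t) = b}" for i
      using ix_h by auto
    then show "\<exists>N. \<forall>i\<ge>N. measure (M i) {x \<in> space (M i). bl i ?n x \<in> ?Q} \<le> c"
      using assms by simp
  qed auto
  then show ?thesis by (simp add: bit_def del: wd.simps)
qed

text \<open>No mass escapes to infinity: a single bit expresses that an image lies beyond an
  integer, Markov's inequality bounds this event uniformly in \<open>i\<close>, and the bound passes
  to the limit and tends to 0 as the integer grows.\<close>

lemma AE_bit_tail: "AE y in bit_space. \<exists>t. bit w t y = b"
proof -
  \<comment> \<open>If all bits are false, the image exceeds every positive integer; if all are
    true, it lies below every negative one.\<close>
  define s where "s n = (if b then of_nat (Suc n) else - of_nat (Suc n) :: rat)" for n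
  have le: "measure bit_space {y \<in> space bit_space. bit w (s n) y = (\<not> b)} \<le> K / real (Suc n)" for n
  proof (rule measure_bit_le)
    fix i
    interpret prob_space "M i" by (rule prob_space_M)
    have "measure (M i) {x \<in> space (M i). (h i w x < of_rat (s n)) = (\<not> b)}
      \<le> measure (M i) {x \<in> space (M i). real (Suc n) \<le> \<bar>h i w x\<bar>}"
      by (intro finite_measure_mono) (auto simp: s_def of_rat_add of_rat_minus of_rat_diff)
    also have "\<dots> \<le> K / real (Suc n)" by (rule h_Markov) simp
    finally show "measure (M i) {x \<in> space (M i). (h i w x < of_rat (s n)) = (\<not> b)} \<le> K / real (Suc n)" .
  qed
  let ?E = "{y \<in> space bit_space. \<forall>t. bit w t y = (\<not> b)}"
  have E: "?E \<in> sets bit_space" by measurable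
  have "measure bit_space ?E \<le> K / real (Suc n)" for n
  proof (rule order_trans[OF B.finite_measure_mono le[of n]])
    show "{y \<in> space bit_space. bit w (s n) y = (\<not> b)} \<in> sets bit_space" by measurable
  qed auto
  moreover have "(\<lambda>n. K / real (Suc n)) \<longlonglongrightarrow> 0"
    using LIMSEQ_Suc[OF lim_const_over_n[of K]] by simp
  ultimately have "measure bit_space ?E \<le> 0" by (intro LIMSEQ_le_const) auto
  then have E0: "measure bit_space ?E = 0" by (simp add: measure_le_0_iff)
  have "AE y in bit_space. \<not> (\<forall>t. bit w t y = (\<not> b))"
    using iffD1[OF B.prob_Collect_eq_0[OF E] E0] .
  then show ?thesis by eventually_elim auto
qed

lemma AE_good: "AE y in bit_space. \<forall>w. good w y"
proof -
  have "AE y in bit_space. \<forall>t t'. t < t' \<longrightarrow> bit w t y \<longrightarrow> bit w t' y" for w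
    using AE_bit_mono by (simp add: AE_all_countable)
  moreover have "AE y in bit_space. \<exists>t. bit w t y" for w using AE_bit_tail[of w True] by simp
  moreover have "AE y in bit_space. \<exists>t. \<not> bit w t y" for w using AE_bit_tail[of w False] by simp
  ultimately have "AE y in bit_space. good w y" for w unfolding good_def by eventually_elim auto
  then show ?thesis by (simp add: AE_all_countable)
qed

text \<open>Only non-strict inequalities survive, since the infimum may equal \<open>t\<close>
  whatever the bit at \<open>t\<close> says. They suffice to enclose \<open>h'\<close> between
  neighbouring grid points.\<close>

lemma good_bit:
  assumes "good w y"
  shows "bit w t y \<Longrightarrow> h' w y \<le> of_rat t" "\<not> bit w t y \<Longrightarrow> of_rat t \<le> h' w y"
proof -
  let ?I = "INF t. if bit w t y then ereal (of_rat t) else \<infinity>"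
  have up: "?I \<le> ereal (of_rat t)" if "bit w t y" for t
    using that by (intro INF_lower2[of t]) auto
  have lo: "ereal (of_rat t) \<le> ?I" if "\<not> bit w t y" for t
  proof (rule INF_greatest)
    fix t'
    have "t \<le> t'" if "bit w t' y" using assms that \<open>\<not> bit w t y\<close> unfolding good_def by (meson not_le)
    then show "ereal (of_rat t) \<le> (if bit w t' y then ereal (of_rat t') else \<infinity>)"
      by (simp add: of_rat_less_eq)
  qed
  obtain t0 t1 where "\<not> bit w t0 y" "bit w t1 y" using assms by (auto simp: good_def)
  then have "\<bar>?I\<bar> \<noteq> \<infinity>" using up[of t1] lo[of t0] by auto
  then have I: "ereal (h' w y) = ?I" unfolding h'_def by (simp add: ereal_real')
  show "bit w t y \<Longrightarrow> h' w y \<le> of_rat t" using up[of t] unfolding I[symmetric] by simp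
  show "\<not> bit w t y \<Longrightarrow> of_rat t \<le> h' w y" using lo[of t] unfolding I[symmetric] by simp
qed

lemma bit_transfer:
  assumes "x \<in> space (M i)" "bl i n x = wd n y" "ix w t < n"
  shows "bit w t y \<longleftrightarrow> h i w x < of_rat t"
proof -
  have "bl i (Suc (ix w t)) x = wd (Suc (ix w t)) y"
    using bl_drop[of "Suc (ix w t)" n i x] wd_drop[of "Suc (ix w t)" n y] assms
    by (simp add: Suc_le_eq del: wd.simps)
  then show ?thesis using ix_h[OF assms(1), of w t] by (simp add: bit_def del: wd.simps)
qed

lemma ind_transfer:
  assumes "bl i n x = wd n y" "length w \<le> n"
  shows "ind i w x = ind' w y"
  using bl_drop[OF assms(2), of i x] wd_drop[OF assms(2), of y] assms(1)
  by (simp add: ind_def ind'_def)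

text \<open>One list \<open>xs\<close>, possibly mixing words of different lengths, names a simple
  function and its image on every \<open>M i\<close> and, primed, in the limit.
  \<open>Z i xs\<close> agrees with the image of \<open>S i xs\<close> only almost
  everywhere.\<close>

definition S :: "nat \<Rightarrow> (real \<times> bool list) list \<Rightarrow> 'a \<Rightarrow> real" where
  "S i xs x = comb xs (\<lambda>w. ind i w x)"

definition S' :: "(real \<times> bool list) list \<Rightarrow> real \<Rightarrow> real" where
  "S' xs y = comb xs (\<lambda>w. ind' w y)"

definition Z :: "nat \<Rightarrow> (real \<times> bool list) list \<Rightarrow> 'a \<Rightarrow> real" where
  "Z i xs x = comb xs (\<lambda>w. h i w x)"

definition Z' :: "(real \<times> bool list) list \<Rightarrow> real \<Rightarrow> real" where
  "Z' xs y = comb xs (\<lambda>w. h' w y)"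

lemma SZ_measurable [measurable]:
  "S i xs \<in> borel_measurable (M i)" "Z i xs \<in> borel_measurable (M i)"
  "S' xs \<in> borel_measurable bit_space" "Z' xs \<in> borel_measurable bit_space"
  unfolding S_def[abs_def] Z_def[abs_def] S'_def[abs_def] Z'_def[abs_def]
  by (intro comb_measurable; measurable)+

lemma comb_bounded: "(\<And>w. \<bar>f w\<bar> \<le> 1) \<Longrightarrow> \<bar>comb xs f\<bar> \<le> (\<Sum>(a, w)\<leftarrow>xs. \<bar>a\<bar>)"
  using comb_diff_le[of xs f "\<lambda>_. 0" 1] by (simp add: comb_def split_def)

lemma Linf_S: "Linf (M i) (S i xs)"
  by (rule LinfI[where C = "\<Sum>(a, w)\<leftarrow>xs. \<bar>a\<bar>"]) (auto simp: S_def ind_def intro!: comb_bounded)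

lemma Linf_S': "Linf bit_space (S' xs)"
  by (rule LinfI[where C = "\<Sum>(a, w)\<leftarrow>xs. \<bar>a\<bar>"]) (auto simp: S'_def ind'_def intro!: comb_bounded)

lemma A_S: "AE x in M i. A i (S i xs) x = Z i xs x"
proof (induction xs)
  case Nil
  \<comment> \<open>Linearity is available as a two-term rule; with both coefficients 0 it yields
    the image of the zero function.\<close>
  have "AE x in M i. A i (\<lambda>y. 0 * S i [] y + 0 * S i [] y) x = 0 * A i (S i []) x + 0 * A i (S i []) x"
    by (rule P_operatorD(5)[OF P_op Linf_S Linf_S])
  moreover have "S i [] = (\<lambda>y. 0 * S i [] y + 0 * S i [] y)" by (simp add: S_def fun_eq_iff)
  ultimately show ?case by (simp add: Z_def)
next
  case (Cons aw xs)
  obtain a w where aw: "aw = (a, w)" by (cases aw)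
  have "AE x in M i. A i (\<lambda>y. a * ind i w y + 1 * S i xs y) x = a * A i (ind i w) x + 1 * A i (S i xs) x"
    by (rule P_operatorD(5)[OF P_op Linf_ind Linf_S])
  moreover have "S i (aw # xs) = (\<lambda>y. a * ind i w y + 1 * S i xs y)" by (simp add: S_def fun_eq_iff aw)
  ultimately show ?case using Cons by simp (auto simp: Z_def aw h_def elim: eventually_elim2)
qed

text \<open>A sufficiently long word determines \<open>S\<close> exactly. Through the threshold bits
  on a grid of mesh \<open>1 / D\<close> it also determines each \<open>h\<close> occurring in
  \<open>Z\<close> up to \<open>1 / D\<close>, as long as that \<open>h\<close> stays below
  \<open>L\<close> in absolute value. So words can serve as labels: points with equal words have
  close vectors, and the word probabilities converge.\<close>

lemma dLP_lim:
  assumes e: "0 < e"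
  shows "\<forall>\<^sub>F i in sequentially. dLP m (distr (M i) (Rm m) (joint m (\<lambda>j x. S i (xs j) x + Z i (ys j) x)))
    (distr bit_space (Rm m) (joint m (\<lambda>j y. S' (xs j) y + Z' (ys j) y))) \<le> e"
proof -
  define W where "W = (\<Union>j<m. snd ` set (xs j @ ys j))"
  have W: "finite W" by (simp add: W_def)
  define T where "T = (\<Sum>j<m. \<Sum>(a, w)\<leftarrow>ys j. \<bar>a\<bar>)"
  have Tj0: "0 \<le> (\<Sum>(a, w)\<leftarrow>ys j. \<bar>a\<bar>)" for j by (auto intro!: sum_list_nonneg)
  have Tj: "(\<Sum>(a, w)\<leftarrow>ys j. \<bar>a\<bar>) \<le> T" if "j < m" for j
    unfolding T_def using that Tj0 by (intro member_le_sum) auto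
  have T0: "0 \<le> T" unfolding T_def using Tj0 by (intro sum_nonneg)
  \<comment> \<open>The coefficients magnify an error \<open>1 / D\<close> in the images by at most
    \<open>T\<close>, and the errors of \<open>m\<close> coordinates add up.\<close>
  obtain D0 where D0: "real m * T / e < real D0" using reals_Archimedean2 by blast
  define D where "D = Suc D0"
  have D: "0 < D" "real m * (T * (1 / real D)) < e"
    using D0 e by (auto simp: D_def field_simps)
  \<comment> \<open>With this cut-off the exceptional set has measure at most \<open>e / 4\<close>.
    It counts twice in \<open>dLP_le_labels\<close>, and the word probabilities contribute the other
    \<open>e / 2\<close>.\<close>
  obtain L0 where L0: "4 * real (card W) * K / e < real L0" using reals_Archimedean2 by blast
  define L where "L = Suc L0"
  have L: "0 < L" "real (card W) * (K / real L) \<le> e / 4"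
    using L0 e by (auto simp: L_def field_simps)
  define t where "t z = (of_int z / of_nat D :: rat)" for z
  have t: "real_of_rat (t z) = real_of_int z / real D" for z by (simp add: t_def of_rat_divide)
  \<comment> \<open>Both \<open>z = \<lfloor>h i w x * real D\<rfloor>\<close> and
    \<open>z + 1\<close> must be thresholds: the margin at the upper end makes room for
    \<open>z + 1\<close>, the one at the lower end for the crude estimate of \<open>z\<close> from
    below.\<close>
  define zs where "zs = {- int (L * D) - 1..int (L * D) + 1}"
  have "finite (length ` W \<union> (\<lambda>(w, z). Suc (ix w (t z))) ` (W \<times> zs))" using W by (simp add: zs_def)
  then obtain n where n: "\<forall>k\<in>length ` W \<union> (\<lambda>(w, z). Suc (ix w (t z))) ` (W \<times> zs). k \<le> n"
    using finite_nat_set_iff_bounded_le by blast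
  have nW: "length w \<le> n" "z \<in> zs \<Longrightarrow> ix w (t z) < n" if "w \<in> W" for w z
  proof -
    show "length w \<le> n" using n that by auto
    assume "z \<in> zs"
    then have "Suc (ix w (t z)) \<in> (\<lambda>(w, z). Suc (ix w (t z))) ` (W \<times> zs)"
      using that by (intro image_eqI[of _ _ "(w, z)"]) auto
    then have "Suc (ix w (t z)) \<le> n" using bspec[OF n UnI2] by blast
    then show "ix w (t z) < n" by simp
  qed
  \<comment> \<open>The limit space gets no cut-off: its points are compared only with points of
    \<open>X\<close> having the same word, and that word confines \<open>h'\<close> as well.\<close>
  obtain Y where Y: "Y \<subseteq> {y \<in> space bit_space. \<forall>w. good w y}" "Y \<in> sets bit_space" "measure bit_space Y = 1"
    using B.AE_E_prob[OF AE_good] by blast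
  have "0 < e / 2" using e by simp
  from order_tendstoD(2)[OF label_distance_lim[of n] this]
  show ?thesis
  proof eventually_elim
    case (elim i)
    interpret prob_space "M i" by (rule prob_space_M)
    define X where "X = {x \<in> space (M i). \<forall>w\<in>W. \<bar>h i w x\<bar> < real L}"
    have X: "X \<in> sets (M i)" unfolding X_def using W by measurable
    have "measure (M i) (space (M i) - X) \<le> measure (M i) (\<Union>w\<in>W. {x \<in> space (M i). real L \<le> \<bar>h i w x\<bar>})"
      using W by (intro finite_measure_mono) (auto simp: X_def not_less)
    also have "\<dots> \<le> (\<Sum>w\<in>W. measure (M i) {x \<in> space (M i). real L \<le> \<bar>h i w x\<bar>})"
      using W by (intro measure_UNION_le) auto
    also have "\<dots> \<le> (\<Sum>w\<in>W. K / real L)" using L by (intro sum_mono h_Markov) auto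
    also have "\<dots> \<le> e / 4" using L by simp
    finally have mX: "1 - e / 4 \<le> measure (M i) X" using X by (simp add: prob_compl)
    show ?case
    proof (rule dLP_le_labels[OF prob_space_M prob_space_bit_space _ _ finite_words _ _ bl_sets wd_eq_sets X mX Y(2), where b = "e / 2" and n7 = n])
      fix x y assume x: "x \<in> X" and y: "y \<in> Y" and eq: "bl i n x = wd n y"
      have xs: "x \<in> space (M i)" using x by (simp add: X_def)
      have hh: "\<bar>h i w x - h' w y\<bar> \<le> 1 / real D" if w: "w \<in> W" for w
      proof -
        define z where "z = \<lfloor>h i w x * real D\<rfloor>"
        have z: "real_of_int z \<le> h i w x * real D" "h i w x * real D < real_of_int z + 1"
          by (auto simp: z_def)
        have "\<bar>h i w x\<bar> * real D \<le> real L * real D"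
          using x w by (intro mult_right_mono) (auto simp: X_def)
        then have "\<bar>h i w x * real D\<bar> \<le> real (L * D)" by (simp add: abs_mult)
        then have "real_of_int z \<le> real_of_int (int (L * D))" "real_of_int (- int (L * D) - 1) \<le> real_of_int z"
          using z by (simp_all add: abs_le_iff)
        then have "z \<le> int (L * D)" "- int (L * D) - 1 \<le> z" by (simp_all only: of_int_le_iff)
        then have zz: "z \<in> zs" "z + 1 \<in> zs" unfolding zs_def by simp_all
        have g: "good w y" using y Y by auto
        have hz: "real_of_int z / real D \<le> h i w x" "h i w x < (real_of_int z + 1) / real D"
          using z D by (simp_all add: field_simps)
        have "\<not> bit w (t z) y" "bit w (t (z + 1)) y"
          using hz unfolding bit_transfer[OF xs eq nW(2)[OF w zz(1)]] bit_transfer[OF xs eq nW(2)[OF w zz(2)]] t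
          by simp_all
        then have "real_of_int z / real D \<le> h' w y" "h' w y \<le> (real_of_int z + 1) / real D"
          using good_bit(2)[OF g, of "t z"] good_bit(1)[OF g, of "t (z + 1)"] by (simp_all add: t)
        then show ?thesis using hz unfolding add_divide_distrib by linarith
      qed
      show "eucl_dist m (joint m (\<lambda>j x. S i (xs j) x + Z i (ys j) x) x)
        (joint m (\<lambda>j y. S' (xs j) y + Z' (ys j) y) y) < e"
      proof (rule eucl_dist_less[OF _ D(2)])
        fix j assume j: "j < m"
        have "S i (xs j) x = S' (xs j) y"
          unfolding S_def S'_def using j by (intro comb_cong ind_transfer[OF eq] nW) (auto simp: W_def)
        moreover have "\<bar>Z i (ys j) x - Z' (ys j) y\<bar> \<le> (\<Sum>(a, w)\<leftarrow>ys j. \<bar>a\<bar>) * (1 / real D)"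
          unfolding Z_def Z'_def using j by (intro comb_diff_le hh) (auto simp: W_def)
        moreover have "(\<Sum>(a, w)\<leftarrow>ys j. \<bar>a\<bar>) * (1 / real D) \<le> T * (1 / real D)"
          using Tj[OF j] by (intro mult_right_mono) auto
        ultimately show "\<bar>joint m (\<lambda>j x. S i (xs j) x + Z i (ys j) x) x j
          - joint m (\<lambda>j y. S' (xs j) y + Z' (ys j) y) y j\<bar> \<le> T * (1 / real D)"
          using j by simp
      qed
    qed (use e elim Y in auto)
  qed
qed

text \<open>All words in the list are suffixes of words of one common length. As
  \<open>\<gamma>\<close> is the same everywhere, p-norms on all spaces become one finite expression
  in the word probabilities.\<close>

lemma S_transfer_norm:
  "\<exists>n \<gamma>. (\<forall>i x. S i xs x = \<gamma> (bl i n x)) \<and> (\<forall>y. S' xs y = \<gamma> (wd n y))"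
proof -
  obtain n where n: "\<forall>k\<in>length ` snd ` set xs. k \<le> n"
    using finite_nat_set_iff_bounded_le[of "length ` snd ` set xs"] by auto
  define \<gamma> where "\<gamma> u = comb xs (\<lambda>w. of_bool (drop (n - length w) u = w))" for u
  show ?thesis
  proof (intro exI conjI allI)
    show "S i xs x = \<gamma> (bl i n x)" for i x
      unfolding S_def \<gamma>_def by (rule comb_cong) (use n in \<open>auto simp: ind_def bl_drop\<close>)
    show "S' xs y = \<gamma> (wd n y)" for y
      unfolding S'_def \<gamma>_def by (rule comb_cong) (use n in \<open>auto simp: ind'_def wd_drop\<close>)
  qed
qed

text \<open>The p-norms of the arguments converge, being finite sums over words (\<open>a i\<close>
  and \<open>b\<close> are their p-th powers), while the q-norm of the images is lower
  semicontinuous. So the bound by \<open>K\<close> passes to the limit.\<close>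

lemma norm_le:
  assumes c: "0 \<le> c" "lpnorm bit_space (ennreal p) (S' xs) \<le> ennreal c"
  shows "lpnorm bit_space q (Z' xs) \<le> ennreal (K * c)"
proof -
  obtain n \<gamma> where \<gamma>: "\<And>i x. S i xs x = \<gamma> (bl i n x)" "\<And>y. S' xs y = \<gamma> (wd n y)"
    using S_transfer_norm[of xs] by blast
  define a where "a i = (\<Sum>u\<in>words n. \<bar>\<gamma> u\<bar> powr p * measure (M i) {x \<in> space (M i). bl i n x = u})" for i
  define b where "b = (\<Sum>u\<in>words n. \<bar>\<gamma> u\<bar> powr p * measure bit_space {y \<in> space bit_space. wd n y = u})"
  have ab: "a \<longlonglongrightarrow> b" unfolding a_def[abs_def] b_def by (intro tendsto_sum tendsto_mult tendsto_const bl_lim')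
  have a0: "0 \<le> a i" for i unfolding a_def by (intro sum_nonneg) auto
  have b0: "0 \<le> b" unfolding b_def by (intro sum_nonneg) auto
  have ai: "(\<integral>\<^sup>+x. ennreal (\<bar>S i xs x\<bar> powr p) \<partial>M i) = ennreal (a i)" for i
    unfolding \<gamma> a_def by (rule nn_integral_labels[OF prob_space_M finite_words _ bl_sets, where g = "\<lambda>u. \<bar>\<gamma> u\<bar> powr p"]) auto
  have bi: "(\<integral>\<^sup>+y. ennreal (\<bar>S' xs y\<bar> powr p) \<partial>bit_space) = ennreal b"
    unfolding \<gamma> b_def by (rule nn_integral_labels[OF prob_space_bit_space finite_words _ wd_eq_sets, where g = "\<lambda>u. \<bar>\<gamma> u\<bar> powr p"]) auto
  have "lpnorm bit_space q (Z' xs) \<le> ennreal (K * b powr (1 / p))"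
  proof (rule lpnorm_lsc[OF prob_space_M prob_space_bit_space _ _ _ q1])
    show "(\<lambda>i. K * a i powr (1 / p)) \<longlonglongrightarrow> K * b powr (1 / p)"
      using ab a0 p1 by (intro tendsto_mult tendsto_const tendsto_powr') auto
    show "0 \<le> K * a i powr (1 / p)" for i using K0 by simp
    show "lpnorm (M i) q (Z i xs) \<le> ennreal (K * a i powr (1 / p))" for i
    proof (rule lpnorm_le_cong_AE[OF q1 _ _ _ A_S])
      show "lpnorm (M i) q (A i (S i xs)) \<le> ennreal (K * a i powr (1 / p))"
      proof (rule bound[OF Linf_S])
        show "lpnorm (M i) (ennreal p) (S i xs) \<le> ennreal (a i powr (1 / p))"
          using p1 a0[of i] by (simp add: lpnorm_le_iff ai powr_powr)
      qed simp
      show "A i (S i xs) \<in> borel_measurable (M i)" by (rule P_operatorD(2)[OF P_op Linf_S])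
    qed (use K0 in auto)
    show "(\<lambda>i. dLP 1 (distr (M i) (Rm 1) (joint 1 (\<lambda>_. Z i xs))) (distr bit_space (Rm 1) (joint 1 (\<lambda>_. Z' xs)))) \<longlonglongrightarrow> 0"
    proof (rule tendstoI)
      fix e :: real assume e: "0 < e"
      then have "0 < e / 2" by simp
      from dLP_lim[OF this, where m = 1 and xs = "\<lambda>_. []" and ys = "\<lambda>_. xs"]
      show "\<forall>\<^sub>F i in sequentially. dist (dLP 1 (distr (M i) (Rm 1) (joint 1 (\<lambda>_. Z i xs)))
        (distr bit_space (Rm 1) (joint 1 (\<lambda>_. Z' xs)))) 0 < e"
      proof eventually_elim
        case (elim i)
        have "0 \<le> dLP 1 (distr (M i) (Rm 1) (joint 1 (\<lambda>_. Z i xs))) (distr bit_space (Rm 1) (joint 1 (\<lambda>_. Z' xs)))"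
          by (intro dLP_nonneg prob_space.prob_space_distr prob_space_M prob_space_bit_space measurable_joint) auto
        then show ?case using elim e by (simp add: S_def S'_def)
      qed
    qed
  qed auto
  also have "\<dots> \<le> ennreal (K * c)"
  proof (intro ennreal_leI mult_left_mono K0)
    have "ennreal b \<le> ennreal (c powr p)" using c p1 by (simp add: lpnorm_le_iff bi)
    then have "b \<le> c powr p" by simp
    then have "b powr (1 / p) \<le> (c powr p) powr (1 / p)" using b0 p1 by (intro powr_mono2) auto
    then show "b powr (1 / p) \<le> c" using c p1 by (simp add: powr_powr)
  qed
  finally show ?thesis .
qed

end

section \<open>The limit operator\<close>

definition profile_vec :: "nat \<Rightarrow> (nat \<Rightarrow> 'a \<Rightarrow> real) \<Rightarrow> (nat \<Rightarrow> 'a \<Rightarrow> real) \<Rightarrow> 'a \<Rightarrow> nat \<Rightarrow> real" where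
  "profile_vec k v w = joint (2 * k) (\<lambda>j. if j < k then v j else w (j - k))"

lemma measurable_profile_vec:
  assumes "\<And>j. j < k \<Longrightarrow> v j \<in> borel_measurable M" "\<And>j. j < k \<Longrightarrow> w j \<in> borel_measurable M"
  shows "profile_vec k v w \<in> measurable M (Rm (2 * k))"
  unfolding profile_vec_def using assms by (intro measurable_joint) auto

lemma profile_eq:
  "profile k M T = {distr M (Rm (2 * k)) (profile_vec k v (\<lambda>j. T (v j))) | v.
      \<forall>j<k. v j \<in> borel_measurable M \<and> (\<forall>x\<in>space M. \<bar>v j x\<bar> \<le> 1)}"
proof -
  have "(\<lambda>x. restrict (\<lambda>j. if j < k then v j x else T (v (j - k)) x) {..<2 * k})
    = profile_vec k v (\<lambda>j. T (v j))" for v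
    by (auto simp: profile_vec_def joint_def fun_eq_iff restrict_def)
  then show ?thesis unfolding profile_def by simp
qed

text \<open>A distribution ignores null sets, so any version \<open>w\<close> of the images may be
  used. This matters because images of simple functions are known only almost everywhere.\<close>

lemma profileI:
  assumes T: "P_operator M T"
    and v: "\<And>j. j < k \<Longrightarrow> v j \<in> borel_measurable M" "\<And>j x. j < k \<Longrightarrow> x \<in> space M \<Longrightarrow> \<bar>v j x\<bar> \<le> 1"
    and w: "\<And>j. j < k \<Longrightarrow> w j \<in> borel_measurable M" "\<And>j. j < k \<Longrightarrow> AE x in M. T (v j) x = w j x"
  shows "distr M (Rm (2 * k)) (profile_vec k v w) \<in> profile k M T"
proof -
  have Tv: "T (v j) \<in> borel_measurable M" if "j < k" for j
    using v[OF that] by (intro P_operatorD(2)[OF T] LinfI) auto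
  have wT: "AE x in M. w j x = T (v j) x" if "j < k" for j
    using w(2)[OF that] by eventually_elim simp
  have "distr M (Rm (2 * k)) (profile_vec k v w) = distr M (Rm (2 * k)) (profile_vec k v (\<lambda>j. T (v j)))"
    unfolding profile_vec_def
    by (rule distr_joint_cong_AE) (use v(1) w(1) Tv wT in auto)
  then show ?thesis unfolding profile_eq using v by auto
qed

lemma profileE:
  assumes "\<eta> \<in> profile k M T" "P_operator M T"
  obtains v where "\<And>j. j < k \<Longrightarrow> v j \<in> borel_measurable M" "\<And>j x. j < k \<Longrightarrow> x \<in> space M \<Longrightarrow> \<bar>v j x\<bar> \<le> 1"
    "\<And>j. j < k \<Longrightarrow> Linf M (v j)" "\<And>j. j < k \<Longrightarrow> T (v j) \<in> borel_measurable M"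
    "\<eta> = distr M (Rm (2 * k)) (profile_vec k v (\<lambda>j. T (v j)))"
proof -
  obtain v where v: "\<forall>j<k. v j \<in> borel_measurable M \<and> (\<forall>x\<in>space M. \<bar>v j x\<bar> \<le> 1)"
    "\<eta> = distr M (Rm (2 * k)) (profile_vec k v (\<lambda>j. T (v j)))"
    using assms unfolding profile_eq by blast
  have L: "Linf M (v j)" if "j < k" for j using v that by (intro LinfI) auto
  show thesis
    by (rule that[of v]) (use v L P_operatorD(2)[OF assms(2)] in auto)
qed

lemma profile_prob_space:
  assumes "\<eta> \<in> profile k M T" "P_operator M T"
  shows "prob_space \<eta>" "sets \<eta> = sets (Rm (2 * k))"
proof -
  obtain v where v: "\<And>j. j < k \<Longrightarrow> v j \<in> borel_measurable M" "\<And>j. j < k \<Longrightarrow> T (v j) \<in> borel_measurable M"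
    "\<eta> = distr M (Rm (2 * k)) (profile_vec k v (\<lambda>j. T (v j)))"
    using profileE[OF assms] by metis
  show "prob_space \<eta>" unfolding v(3)
    by (intro prob_space.prob_space_distr P_operatorD(1)[OF assms(2)] measurable_profile_vec v)
  show "sets \<eta> = sets (Rm (2 * k))" by (simp add: v(3))
qed

lemma profile_nonempty:
  assumes "P_operator M T"
  shows "profile k M T \<noteq> {}"
proof -
  have "Linf M (\<lambda>_. 0 :: real)" by (rule LinfI[where C = 0]) auto
  then have "distr M (Rm (2 * k)) (profile_vec k (\<lambda>_ _. 0) (\<lambda>j. T (\<lambda>_. 0))) \<in> profile k M T"
    by (intro profileI[OF assms]) (auto intro: P_operatorD(2)[OF assms])
  then show ?thesis by blast
qed

lemma LinfE:
  assumes "Linf M v"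
  obtains C where "v \<in> borel_measurable M" "0 \<le> C" "AE x in M. \<bar>v x\<bar> \<le> C"
proof -
  obtain C where "v \<in> borel_measurable M" "AE x in M. \<bar>v x\<bar> \<le> C" using assms by (auto simp: Linf_def)
  then show thesis by (intro that[of "max 0 C"]) (auto elim!: eventually_mono)
qed

context bit_system
begin

abbreviation "N \<equiv> bit_space"

section \<open>Extension from word functions to bounded functions\<close>

definition word_list :: "nat \<Rightarrow> (bool list \<Rightarrow> real) \<Rightarrow> (real \<times> bool list) list" where
  "word_list n \<alpha> = map (\<lambda>w. (\<alpha> w, w)) (List.n_lists n [False, True])"

lemma comb_word_list: "comb (word_list n \<alpha>) f = (\<Sum>w\<in>words n. \<alpha> w * f w)"
proof -
  have "set (List.n_lists n [False, True]) = words n" by (auto simp: set_n_lists)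
  then show ?thesis
    by (simp add: comb_def word_list_def o_def sum_list_distinct_conv_sum_set distinct_n_lists)
qed

lemma S_word_list [simp]: "S i (word_list n \<alpha>) x = \<alpha> (bl i n x)" "S' (word_list n \<alpha>) y = \<alpha> (wd n y)"
proof -
  have eq: "(\<Sum>w\<in>words n. \<alpha> w * of_bool (u = w)) = \<alpha> u" if "u \<in> words n" for u
  proof -
    have "(\<Sum>w\<in>words n. \<alpha> w * of_bool (u = w)) = (\<Sum>w\<in>words n. if u = w then \<alpha> w else 0)"
      by (intro sum.cong) auto
    then show ?thesis using that finite_words by simp
  qed
  have "S i (word_list n \<alpha>) x = (\<Sum>w\<in>words n. \<alpha> w * of_bool (bl i n x = w))"
    unfolding S_def comb_word_list by (intro sum.cong) (auto simp: ind_def)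
  then show "S i (word_list n \<alpha>) x = \<alpha> (bl i n x)" by (simp add: eq)
  have "S' (word_list n \<alpha>) y = (\<Sum>w\<in>words n. \<alpha> w * of_bool (wd n y = w))"
    unfolding S'_def comb_word_list by (intro sum.cong) (auto simp: ind'_def)
  then show "S' (word_list n \<alpha>) y = \<alpha> (wd n y)" by (simp add: eq)
qed

definition lincomb :: "real \<Rightarrow> (real \<times> bool list) list \<Rightarrow> real \<Rightarrow> (real \<times> bool list) list \<Rightarrow> (real \<times> bool list) list" where
  "lincomb a xs b ys = map (\<lambda>(c, w). (a * c, w)) xs @ map (\<lambda>(c, w). (b * c, w)) ys"

lemma lincomb_SZ:
  "S' (lincomb a xs b ys) y = a * S' xs y + b * S' ys y"
  "Z' (lincomb a xs b ys) y = a * Z' xs y + b * Z' ys y"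
  unfolding S'_def Z'_def lincomb_def by simp_all

text \<open>The graph of the limit operator.\<close>
definition rel :: "(real \<Rightarrow> real) \<Rightarrow> (real \<Rightarrow> real) \<Rightarrow> bool" where
  "rel v z \<longleftrightarrow> v \<in> borel_measurable N \<and> z \<in> borel_measurable N \<and>
    (\<exists>C X. (\<forall>n y. \<bar>S' (X n) y\<bar> \<le> C) \<and> (AE y in N. (\<lambda>n. S' (X n) y) \<longlonglongrightarrow> v y) \<and>
      (AE y in N. (\<lambda>n. Z' (X n) y) \<longlonglongrightarrow> z y))"

lemma rel_S': "rel (S' xs) (Z' xs)"
proof -
  have "\<bar>S' xs y\<bar> \<le> (\<Sum>(a, w)\<leftarrow>xs. \<bar>a\<bar>)" for y
    unfolding S'_def by (rule comb_bounded) (simp add: ind'_def)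
  then show ?thesis
    unfolding rel_def by (intro conjI exI[of _ "\<lambda>_. xs"] exI[of _ "\<Sum>(a, w)\<leftarrow>xs. \<bar>a\<bar>"]) auto
qed

lemma rel_lincomb:
  assumes "rel v z" "rel w u"
  shows "rel (\<lambda>y. a * v y + b * w y) (\<lambda>y. a * z y + b * u y)"
proof -
  obtain C X where 1: "v \<in> borel_measurable N" "z \<in> borel_measurable N" "\<And>n y. \<bar>S' (X n) y\<bar> \<le> C"
    "AE y in N. (\<lambda>n. S' (X n) y) \<longlonglongrightarrow> v y" "AE y in N. (\<lambda>n. Z' (X n) y) \<longlonglongrightarrow> z y"
    using assms(1) unfolding rel_def by blast
  obtain D Y where 2: "w \<in> borel_measurable N" "u \<in> borel_measurable N" "\<And>n y. \<bar>S' (Y n) y\<bar> \<le> D"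
    "AE y in N. (\<lambda>n. S' (Y n) y) \<longlonglongrightarrow> w y" "AE y in N. (\<lambda>n. Z' (Y n) y) \<longlonglongrightarrow> u y"
    using assms(2) unfolding rel_def by blast
  let ?X = "\<lambda>n. lincomb a (X n) b (Y n)"
  have "\<forall>n y. \<bar>S' (?X n) y\<bar> \<le> \<bar>a\<bar> * C + \<bar>b\<bar> * D"
  proof (intro allI)
    fix n y
    have "\<bar>S' (?X n) y\<bar> \<le> \<bar>a\<bar> * \<bar>S' (X n) y\<bar> + \<bar>b\<bar> * \<bar>S' (Y n) y\<bar>"
      unfolding lincomb_SZ by (metis abs_mult abs_triangle_ineq)
    also have "\<dots> \<le> \<bar>a\<bar> * C + \<bar>b\<bar> * D" using 1 2 by (intro add_mono mult_left_mono) auto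
    finally show "\<bar>S' (?X n) y\<bar> \<le> \<bar>a\<bar> * C + \<bar>b\<bar> * D" .
  qed
  moreover have "AE y in N. (\<lambda>n. S' (?X n) y) \<longlonglongrightarrow> a * v y + b * w y"
    using 1(4) 2(4) unfolding lincomb_SZ by eventually_elim (intro tendsto_intros)
  moreover have "AE y in N. (\<lambda>n. Z' (?X n) y) \<longlonglongrightarrow> a * z y + b * u y"
    using 1(5) 2(5) unfolding lincomb_SZ by eventually_elim (intro tendsto_intros)
  moreover have "(\<lambda>y. a * v y + b * w y) \<in> borel_measurable N" "(\<lambda>y. a * z y + b * u y) \<in> borel_measurable N"
    using 1 2 by auto
  ultimately show ?thesis unfolding rel_def by (intro conjI exI[of _ "\<bar>a\<bar> * C + \<bar>b\<bar> * D"] exI[of _ ?X])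
qed

lemma rel_cong:
  assumes "rel v z" "AE y in N. v y = v2 y" "v2 \<in> borel_measurable N"
  shows "rel v2 z"
proof -
  obtain C X where 1: "z \<in> borel_measurable N" "\<forall>n y. \<bar>S' (X n) y\<bar> \<le> C"
    "AE y in N. (\<lambda>n. S' (X n) y) \<longlonglongrightarrow> v y" "AE y in N. (\<lambda>n. Z' (X n) y) \<longlonglongrightarrow> z y"
    using assms(1) unfolding rel_def by blast
  have "AE y in N. (\<lambda>n. S' (X n) y) \<longlonglongrightarrow> v2 y" using 1(3) assms(2) by eventually_elim simp
  then show ?thesis unfolding rel_def using 1 assms(3) by blast
qed

lemma integrable_bounded_powr:
  assumes "f \<in> borel_measurable N" "AE y in N. \<bar>f y\<bar> \<le> C"
  shows "integrable N (\<lambda>y. \<bar>f y\<bar> powr p)"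
proof (rule B.integrable_const_bound)
  show "AE y in N. norm (\<bar>f y\<bar> powr p) \<le> C powr p"
    using assms(2) by eventually_elim (use p1 in \<open>auto intro!: powr_mono2\<close>)
qed (use assms in measurable)

lemma lpnorm_p_le_iff:
  assumes "f \<in> borel_measurable N" "AE y in N. \<bar>f y\<bar> \<le> C" "0 \<le> c"
  shows "lpnorm N (ennreal p) f \<le> ennreal c \<longleftrightarrow> (\<integral>y. \<bar>f y\<bar> powr p \<partial>N) \<le> c powr p"
  using integrable_bounded_powr[OF assms(1,2)] p1 assms(3)
  by (simp add: lpnorm_le_iff nn_integral_eq_integral)

lemma AE_bound_limit:
  assumes "\<And>n y. \<bar>f n y\<bar> \<le> C" "AE y in N. (\<lambda>n. f n y) \<longlonglongrightarrow> g y"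
  shows "AE y in N. \<bar>g y :: real\<bar> \<le> C"
  using assms(2)
proof eventually_elim
  case (elim y)
  show ?case using assms(1) by (intro LIMSEQ_le_const2[OF tendsto_rabs[OF elim]]) auto
qed

lemma powr_integral_lim:
  assumes f: "\<And>n. f n \<in> borel_measurable N" "g \<in> borel_measurable N"
    and C: "\<And>n. AE y in N. \<bar>f n y\<bar> \<le> C" and lim: "AE y in N. (\<lambda>n. f n y) \<longlonglongrightarrow> g y"
  shows "(\<lambda>n. \<integral>y. \<bar>f n y\<bar> powr p \<partial>N) \<longlonglongrightarrow> (\<integral>y. \<bar>g y\<bar> powr p \<partial>N)"
proof (rule integral_dominated_convergence[where w = "\<lambda>_. C powr p"])
  show "AE y in N. (\<lambda>n. \<bar>f n y\<bar> powr p) \<longlonglongrightarrow> \<bar>g y\<bar> powr p"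
    using lim by eventually_elim (use p1 in \<open>auto intro!: tendsto_powr' tendsto_rabs\<close>)
  show "AE y in N. norm (\<bar>f n y\<bar> powr p) \<le> C powr p" for n
    using C[of n] by eventually_elim (use p1 in \<open>auto intro!: powr_mono2\<close>)
qed (use f in measurable)

text \<open>The uniform bound on the approximants makes their p-norms converge to that of
  \<open>v\<close> by dominated convergence; Fatou's lemma handles the images.\<close>

lemma rel_norm:
  assumes r: "rel v z" and c: "0 \<le> c" "lpnorm N (ennreal p) v \<le> ennreal c"
  shows "lpnorm N q z \<le> ennreal (K * c)"
proof -
  obtain C X where 1: "v \<in> borel_measurable N" "z \<in> borel_measurable N" "\<And>n y. \<bar>S' (X n) y\<bar> \<le> C"
    "AE y in N. (\<lambda>n. S' (X n) y) \<longlonglongrightarrow> v y" "AE y in N. (\<lambda>n. Z' (X n) y) \<longlonglongrightarrow> z y"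
    using r unfolding rel_def by blast
  have vC: "AE y in N. \<bar>v y\<bar> \<le> C" by (rule AE_bound_limit[OF 1(3,4)])
  define I where "I n = (\<integral>y. \<bar>S' (X n) y\<bar> powr p \<partial>N)" for n
  define J where "J = (\<integral>y. \<bar>v y\<bar> powr p \<partial>N)"
  have IJ: "I \<longlonglongrightarrow> J" unfolding I_def J_def using 1 by (intro powr_integral_lim[where C = C]) auto
  have I0: "0 \<le> I n" for n unfolding I_def by simp
  have J0: "0 \<le> J" unfolding J_def by simp
  have "lpnorm N q z \<le> ennreal (K * J powr (1 / p))"
  proof (rule lpnorm_Fatou[OF q1 _ 1(2,5)])
    show "(\<lambda>n. K * I n powr (1 / p)) \<longlonglongrightarrow> K * J powr (1 / p)"
      using IJ I0 p1 by (intro tendsto_mult tendsto_const tendsto_powr') auto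
    show "lpnorm N q (Z' (X n)) \<le> ennreal (K * I n powr (1 / p))" for n
    proof (rule norm_le)
      show "lpnorm N (ennreal p) (S' (X n)) \<le> ennreal (I n powr (1 / p))"
        using p1 I0[of n] 1(3) by (subst lpnorm_p_le_iff[where C = C]) (auto simp: powr_powr simp flip: I_def)
    qed simp
  qed (use K0 in auto)
  also have "\<dots> \<le> ennreal (K * c)"
  proof (intro ennreal_leI mult_left_mono K0)
    have "J \<le> c powr p" using c 1(1) vC unfolding J_def by (simp add: lpnorm_p_le_iff)
    then have "J powr (1 / p) \<le> (c powr p) powr (1 / p)" using J0 p1 by (intro powr_mono2) auto
    then show "J powr (1 / p) \<le> c" using c p1 by (simp add: powr_powr)
  qed
  finally show ?thesis .
qed

lemma rel_nn_integral:
  assumes "rel v z" "0 \<le> c" "lpnorm N (ennreal p) v \<le> ennreal c"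
  shows "(\<integral>\<^sup>+y. ennreal \<bar>z y\<bar> \<partial>N) \<le> ennreal (K * c)"
  using rel_norm[OF assms] q1 K0 assms by (intro B.nn_integral_le_lpnorm[of q]) (auto simp: rel_def)

text \<open>By linearity \<open>z - u\<close> is related to the zero function, and the norm bound
  with constant 0 annihilates it. Hence all approximating sequences of \<open>v\<close> lead to the
  same image.\<close>

lemma rel_unique:
  assumes "rel v z" "rel v u"
  shows "AE y in N. z y = u y"
proof -
  have "rel (\<lambda>y. 1 * v y + (- 1) * v y) (\<lambda>y. 1 * z y + (- 1) * u y)" using assms by (rule rel_lincomb)
  moreover have "lpnorm N (ennreal p) (\<lambda>y. 1 * v y + (- 1) * v y) \<le> ennreal 0"
    using p1 by (intro B.lpnorm_le_const) auto
  ultimately have "(\<integral>\<^sup>+y. ennreal \<bar>1 * z y + (- 1) * u y\<bar> \<partial>N) \<le> ennreal (K * 0)"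
    by (intro rel_nn_integral) auto
  then have "(\<integral>\<^sup>+y. ennreal \<bar>z y - u y\<bar> \<partial>N) = 0" by simp
  moreover have "z \<in> borel_measurable N" "u \<in> borel_measurable N" using assms by (auto simp: rel_def)
  ultimately have "AE y in N. ennreal \<bar>z y - u y\<bar> = 0" by (subst (asm) nn_integral_0_iff_AE) auto
  then show ?thesis by eventually_elim simp
qed

lemma integrable_rel:
  assumes "rel v z"
  shows "integrable N z"
proof -
  obtain C X where 1: "z \<in> borel_measurable N" "\<And>n y. \<bar>S' (X n) y\<bar> \<le> C"
    "AE y in N. (\<lambda>n. S' (X n) y) \<longlonglongrightarrow> v y"
    using assms unfolding rel_def by blast
  have C0: "0 \<le> C" using 1(2)[of 0 0] by linarith
  have "lpnorm N (ennreal p) v \<le> ennreal C"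
    using p1 C0 AE_bound_limit[OF 1(2,3)] by (intro B.lpnorm_le_const) auto
  from rel_nn_integral[OF assms C0 this] show ?thesis
    using 1(1) by (intro integrableI_bounded) (auto simp: top.not_eq_extremum[symmetric] top_unique)
qed

text \<open>Bounded convergence almost everywhere is convergence in p-norm, so the approximants are
  Cauchy in p-norm and their images Cauchy in \<open>L^1\<close>; a subsequence of the images
  converges almost everywhere. The approximants are exported because approximating a profile
  requires both sequences together.\<close>

lemma rel_approx:
  assumes v: "v \<in> borel_measurable N" "AE y in N. \<bar>v y\<bar> \<le> C" "0 \<le> C"
  obtains z m \<alpha> where "rel v z" "\<And>n u. \<bar>\<alpha> n u\<bar> \<le> C"
    "AE y in N. (\<lambda>n. S' (word_list (m n) (\<alpha> n)) y) \<longlonglongrightarrow> v y"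
    "AE y in N. (\<lambda>n. Z' (word_list (m n) (\<alpha> n)) y) \<longlonglongrightarrow> z y"
proof -
  obtain m \<alpha> where \<alpha>: "\<And>n u. \<bar>\<alpha> n u\<bar> \<le> C" and lim: "AE y in N. (\<lambda>n. \<alpha> n (wd (m n) y)) \<longlonglongrightarrow> v y"
    using AE_approx[OF v] by metis
  define X where "X n = word_list (m n) (\<alpha> n)" for n :: nat
  have SX: "S' (X n) y = \<alpha> n (wd (m n) y)" for n y by (simp add: X_def)
  define D where "D n = (\<integral>y. \<bar>S' (X n) y - v y\<bar> powr p \<partial>N)" for n
  have bd: "AE y in N. \<bar>S' (X n) y - v y\<bar> \<le> 2 * C" for n
    using v(2) by eventually_elim (use \<alpha>[of n] in \<open>simp add: SX abs_le_iff; smt (verit)\<close>)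
  have "D \<longlonglongrightarrow> (\<integral>y. \<bar>0\<bar> powr p \<partial>N)"
    unfolding D_def
  proof (rule powr_integral_lim[where C = "2 * C"])
    show "AE y in N. (\<lambda>n. S' (X n) y - v y) \<longlonglongrightarrow> 0"
      using lim by eventually_elim (simp add: SX LIM_zero)
  qed (use v bd in auto)
  then have D: "D \<longlonglongrightarrow> 0" using p1 by simp
  have cauchy: "\<exists>n0. \<forall>i\<ge>n0. \<forall>j\<ge>n0. (LINT y|N. norm (Z' (X i) y - Z' (X j) y)) < e" if e: "0 < e" for e
  proof -
    \<comment> \<open>The denominator contains \<open>K + 1\<close> to cover \<open>K = 0\<close>;
      the factor 2 makes \<open>K * c < e\<close> strict.\<close>
    define c where "c = e / (2 * (K + 1))"
    have c: "0 < c" using e K0 by (simp add: c_def)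
    have Kc: "K * c < e"
    proof -
      have "K * c \<le> (K + 1) * c" using c by (intro mult_right_mono) auto
      also have "\<dots> = e / 2" using K0 by (simp add: c_def divide_simps)
      finally show ?thesis using e by simp
    qed
    \<comment> \<open>Chosen so that \<open>2 powr p * (d + d) = c powr p\<close>.\<close>
    define d where "d = c powr p / (2 * 2 powr p)"
    have "0 < d" using c by (simp add: d_def)
    then obtain n0 where n0: "\<And>n. n \<ge> n0 \<Longrightarrow> D n < d"
      using order_tendstoD(2)[OF D] unfolding eventually_sequentially by blast
    have "(LINT y|N. norm (Z' (X i) y - Z' (X j) y)) < e" if ij: "i \<ge> n0" "j \<ge> n0" for i j
    proof -
      let ?X = "lincomb 1 (X i) (- 1) (X j)"
      have SX': "S' ?X y = S' (X i) y - S' (X j) y" for y by (simp add: lincomb_SZ)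
      have SC: "\<bar>S' (X n) y\<bar> \<le> C" for n y using \<alpha> by (simp add: SX)
      have SC2: "\<bar>S' (X i) y - S' (X j) y\<bar> \<le> 2 * C" for y
        using SC[of i y] SC[of j y] by linarith
      note int = integrable_bounded_powr[where C = "2 * C"]
      \<comment> \<open>A crude replacement for Minkowski's inequality: the difference is at most
        twice the larger of the two deviations from \<open>t\<close>.\<close>
      have powr_le: "\<bar>a - b\<bar> powr p \<le> 2 powr p * (\<bar>a - t\<bar> powr p + \<bar>b - t\<bar> powr p)" for a b t :: real
      proof -
        have two_max: "r + s \<le> 2 * max r s" for r s :: real by (simp add: max_def)
        have "\<bar>(a - t) - (b - t)\<bar> \<le> \<bar>a - t\<bar> + \<bar>b - t\<bar>" by (rule abs_triangle_ineq4)
        from order_trans[OF this two_max] have "\<bar>a - b\<bar> \<le> 2 * max \<bar>a - t\<bar> \<bar>b - t\<bar>" by simp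
        then have "\<bar>a - b\<bar> powr p \<le> (2 * max \<bar>a - t\<bar> \<bar>b - t\<bar>) powr p" using p1 by (intro powr_mono2) auto
        also have "\<dots> = 2 powr p * (max \<bar>a - t\<bar> \<bar>b - t\<bar>) powr p" by (subst powr_mult) auto
        also have "\<dots> \<le> 2 powr p * (\<bar>a - t\<bar> powr p + \<bar>b - t\<bar> powr p)"
          by (intro mult_left_mono) (auto simp: max_def)
        finally show ?thesis .
      qed
      have "(\<integral>y. \<bar>S' ?X y\<bar> powr p \<partial>N) = (\<integral>y. \<bar>S' (X i) y - S' (X j) y\<bar> powr p \<partial>N)" by (simp add: SX')
      also have "\<dots> \<le> (\<integral>y. 2 powr p * (\<bar>S' (X i) y - v y\<bar> powr p + \<bar>S' (X j) y - v y\<bar> powr p) \<partial>N)"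
        by (intro integral_mono integrable_mult_right Bochner_Integration.integrable_add int powr_le)
          (use v(1) bd SC2 in auto)
      also have "\<dots> = 2 powr p * (D i + D j)"
        unfolding D_def by (subst integral_mult_right_zero, subst Bochner_Integration.integral_add)
          (use v(1) bd in \<open>auto intro!: int\<close>)
      also have "\<dots> \<le> 2 powr p * (d + d)"
        using n0[OF ij(1)] n0[OF ij(2)] by (intro mult_left_mono add_mono) auto
      also have "\<dots> = c powr p" by (simp add: d_def)
      finally have "lpnorm N (ennreal p) (S' ?X) \<le> ennreal c"
        using c SC2 by (subst lpnorm_p_le_iff[where C = "2 * C"]) (auto simp: SX')
      from rel_nn_integral[OF rel_S' _ this] c
      have nn: "(\<integral>\<^sup>+y. ennreal \<bar>Z' ?X y\<bar> \<partial>N) \<le> ennreal (K * c)" by simp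
      have "integrable N (Z' ?X)" by (rule integrable_rel[OF rel_S'])
      then have "(\<integral>y. \<bar>Z' ?X y\<bar> \<partial>N) \<le> K * c"
        using nn K0 c by (subst (asm) nn_integral_eq_integral) auto
      then show ?thesis using Kc by (simp add: lincomb_SZ)
    qed
    then show ?thesis by blast
  qed
  have "integrable N (Z' (X n))" for n by (rule integrable_rel[OF rel_S'])
  from cauchy_L1_AE_cauchy_subseq[OF this cauchy] obtain r where
    r: "strict_mono (r :: nat \<Rightarrow> nat)" "AE y in N. Cauchy (\<lambda>i. Z' (X (r i)) y)" by blast
  define z where "z y = Lim sequentially (\<lambda>i. Z' (X (r i)) y)" for y
  have z: "z \<in> borel_measurable N" unfolding z_def by measurable
  have Zz: "AE y in N. (\<lambda>i. Z' (X (r i)) y) \<longlonglongrightarrow> z y"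
    using r(2)
  proof eventually_elim
    case (elim y)
    then have "convergent (\<lambda>i. Z' (X (r i)) y)" by (simp add: Cauchy_convergent_iff)
    then show ?case unfolding z_def by (simp add: convergent_LIMSEQ_iff)
  qed
  have Sv: "AE y in N. (\<lambda>i. S' (X (r i)) y) \<longlonglongrightarrow> v y"
    using lim
  proof eventually_elim
    case (elim y)
    from LIMSEQ_subseq_LIMSEQ[OF elim r(1)] show ?case by (simp add: SX o_def)
  qed
  have "rel v z" unfolding rel_def
    using v z Zz Sv \<alpha> by (intro conjI exI[of _ C] exI[of _ "\<lambda>i. X (r i)"]) (auto simp: SX)
  then show thesis
    using that[of z "\<lambda>n. \<alpha> (r n)" "\<lambda>n. m (r n)"] \<alpha> Zz Sv unfolding X_def by blast
qed

text \<open>An image is determined only up to null sets, and a P-operator is only asked to be linear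
  up to null sets, so an arbitrary choice is enough.\<close>

definition Op :: "(real \<Rightarrow> real) \<Rightarrow> real \<Rightarrow> real" where
  "Op v = (SOME z. rel v z)"

lemma rel_Op:
  assumes "Linf N v"
  shows "rel v (Op v)"
proof -
  obtain C where "v \<in> borel_measurable N" "0 \<le> C" "AE x in N. \<bar>v x\<bar> \<le> C" using LinfE[OF assms] .
  then obtain z where "rel v z" using rel_approx[of v C] by blast
  then show ?thesis unfolding Op_def by (rule someI[of "rel v"])
qed

lemma AE_le_lpnorm_infinity:
  assumes "Linf N v"
  obtains c where "0 \<le> c" "lpnorm N \<infinity> v = ennreal c" "AE x in N. \<bar>v x\<bar> \<le> c"
proof -
  obtain C where C: "v \<in> borel_measurable N" "0 \<le> C" "AE x in N. \<bar>v x\<bar> \<le> C" using LinfE[OF assms] .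
  then have "lpnorm N \<top> v \<le> ennreal C" by (simp add: lpnorm_infinity_le_iff)
  then obtain c where c: "0 \<le> c" "lpnorm N \<top> v = ennreal c" by (cases "lpnorm N \<top> v") (auto simp: top_unique)
  then have "AE x in N. \<bar>v x\<bar> \<le> c" using lpnorm_infinity_le_iff[OF c(1) C(1)] by simp
  then show thesis using that c by simp
qed

text \<open>The algebraic clauses follow from uniqueness: two candidates for the image of one
  function agree almost everywhere. The constant \<open>K\<close> serves for the last clause, since
  on a probability space the p-norm is at most the essential supremum and the q-norm at least the
  \<open>L^1\<close> norm.\<close>

lemma P_operator_Op: "P_operator N Op"
  unfolding P_operator_def
proof (intro conjI allI impI)
  show "prob_space N" by (rule prob_space_bit_space)
  show "Op v \<in> borel_measurable N" if "Linf N v" for v using rel_Op[OF that] by (simp add: rel_def)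
  show "integrable N (Op v)" if "Linf N v" for v using integrable_rel[OF rel_Op[OF that]] .
  show "AE x in N. Op v x = Op w x" if "Linf N v" "Linf N w" "AE x in N. v x = w x" for v w
  proof (rule rel_unique)
    show "rel w (Op v)" using rel_cong[OF rel_Op[OF that(1)] that(3)] that(2) by (simp add: Linf_def)
    show "rel w (Op w)" by (rule rel_Op[OF that(2)])
  qed
  show "AE x in N. Op (\<lambda>y. a * v y + b * w y) x = a * Op v x + b * Op w x" if "Linf N v" "Linf N w" for v w a b
    by (rule rel_unique[OF rel_Op[OF Linf_lincomb[OF that]] rel_lincomb[OF rel_Op[OF that(1)] rel_Op[OF that(2)]]])
  have "lpnorm N 1 (Op v) \<le> ennreal K * lpnorm N \<infinity> v" if v: "Linf N v" for v
  proof -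
    obtain c where c: "0 \<le> c" "lpnorm N \<infinity> v = ennreal c" "AE x in N. \<bar>v x\<bar> \<le> c"
      using AE_le_lpnorm_infinity[OF v] .
    have "lpnorm N (ennreal p) v \<le> ennreal c" using p1 c by (intro B.lpnorm_le_const)
    from rel_nn_integral[OF rel_Op[OF v] c(1) this]
    have "(\<integral>\<^sup>+x. ennreal (\<bar>Op v x\<bar> powr 1) \<partial>N) \<le> ennreal ((K * c) powr 1)" using K0 c by simp
    then have "lpnorm N (ennreal 1) (Op v) \<le> ennreal (K * c)"
      using K0 c by (subst lpnorm_le_iff) auto
    then show ?thesis using K0 c by (simp add: ennreal_mult)
  qed
  then show "\<exists>C. \<forall>v. Linf N v \<longrightarrow> lpnorm N 1 (Op v) \<le> ennreal C * lpnorm N \<infinity> v" by blast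
qed

lemma opnorm_Op: "opnorm N Op (ennreal p) q \<le> ennreal K"
  unfolding opnorm_def
proof (rule SUP_least)
  fix v assume "v \<in> {v. Linf N v \<and> lpnorm N (ennreal p) v \<noteq> 0}"
  then have v: "Linf N v" "lpnorm N (ennreal p) v \<noteq> 0" by auto
  obtain C where C: "v \<in> borel_measurable N" "0 \<le> C" "AE x in N. \<bar>v x\<bar> \<le> C" using LinfE[OF v(1)] .
  have "lpnorm N (ennreal p) v \<le> ennreal C" using p1 C by (intro B.lpnorm_le_const)
  then obtain c where c: "0 \<le> c" "lpnorm N (ennreal p) v = ennreal c"
    by (cases "lpnorm N (ennreal p) v") (auto simp: top_unique)
  then have "0 < c" using v(2) by (cases "c = 0") auto
  have "lpnorm N q (Op v) \<le> ennreal (K * c)" using rel_norm[OF rel_Op[OF v(1)] c(1)] c(2) by simp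
  then have "lpnorm N q (Op v) / ennreal c \<le> ennreal (K * c) / ennreal c"
    by (rule divide_right_mono_ennreal)
  also have "\<dots> = ennreal K" using \<open>0 < c\<close> K0 by (simp add: divide_ennreal)
  finally show "lpnorm N q (Op v) / lpnorm N (ennreal p) v \<le> ennreal K" unfolding c(2) .
qed

lemma Op_S': "AE y in N. Op (S' xs) y = Z' xs y"
  by (rule rel_unique[OF rel_Op[OF Linf_S'] rel_S'])

section \<open>Profiles of the limit operator are approximated by profiles of the sequence\<close>

lemma profile_S:
  assumes "\<And>j u. j < k \<Longrightarrow> \<bar>\<alpha> j u\<bar> \<le> 1"
  shows "distr (M i) (Rm (2 * k)) (profile_vec k (\<lambda>j. S i (word_list (m j) (\<alpha> j))) (\<lambda>j. Z i (word_list (m j) (\<alpha> j))))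
      \<in> profile k (M i) (A i)"
    and "distr N (Rm (2 * k)) (profile_vec k (\<lambda>j. S' (word_list (m j) (\<alpha> j))) (\<lambda>j. Z' (word_list (m j) (\<alpha> j))))
      \<in> profile k N Op"
  using assms by (auto intro!: profileI[OF P_op] profileI[OF P_operator_Op] A_S Op_S')

lemma profile_S_lim:
  assumes "0 < e"
  shows "\<forall>\<^sub>F i in sequentially. dLP (2 * k)
    (distr (M i) (Rm (2 * k)) (profile_vec k (\<lambda>j. S i (xs j)) (\<lambda>j. Z i (xs j))))
    (distr N (Rm (2 * k)) (profile_vec k (\<lambda>j. S' (xs j)) (\<lambda>j. Z' (xs j)))) \<le> e"
proof -
  \<comment> \<open>In each coordinate one of the two lists is empty, so the sum in
    \<open>dLP_lim\<close> reduces to an argument or to an image.\<close>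
  define ss where "ss j = (if j < k then xs j else [])" for j
  define zs where "zs j = (if j < k then [] else xs (j - k))" for j
  have "(\<lambda>j x. S i (ss j) x + Z i (zs j) x) = (\<lambda>j. if j < k then S i (xs j) else Z i (xs (j - k)))" for i
    by (auto simp: ss_def zs_def fun_eq_iff S_def Z_def)
  moreover have "(\<lambda>j x. S' (ss j) x + Z' (zs j) x) = (\<lambda>j. if j < k then S' (xs j) else Z' (xs (j - k)))"
    by (auto simp: ss_def zs_def fun_eq_iff S'_def Z'_def)
  ultimately show ?thesis
    using dLP_lim[OF assms, of "2 * k" ss zs] unfolding profile_vec_def by simp
qed

text \<open>The functions are first replaced by word functions on the limit space, and the same word
  functions are then evaluated on \<open>M i\<close>. How far out \<open>i\<close> must lie depends
  on \<open>\<eta>\<close>.\<close>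

lemma profile_Op_approx:
  assumes \<eta>: "\<eta> \<in> profile k N Op" and e: "0 < e"
  shows "\<forall>\<^sub>F i in sequentially. \<exists>\<mu>\<in>profile k (M i) (A i). dLP (2 * k) \<mu> \<eta> \<le> e"
proof -
  obtain v where v: "\<And>j. j < k \<Longrightarrow> v j \<in> borel_measurable N" "\<And>j x. j < k \<Longrightarrow> x \<in> space N \<Longrightarrow> \<bar>v j x\<bar> \<le> 1"
    "\<And>j. j < k \<Longrightarrow> Linf N (v j)" "\<And>j. j < k \<Longrightarrow> Op (v j) \<in> borel_measurable N"
    "\<eta> = distr N (Rm (2 * k)) (profile_vec k v (\<lambda>j. Op (v j)))"
    using profileE[OF \<eta> P_operator_Op] by metis
  define Q where "Q j z m \<alpha> \<longleftrightarrow> rel (v j) z \<and> (\<forall>n u. \<bar>\<alpha> n u\<bar> \<le> 1) \<and>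
    (AE y in N. (\<lambda>n. S' (word_list (m n) (\<alpha> n)) y) \<longlonglongrightarrow> v j y) \<and>
    (AE y in N. (\<lambda>n. Z' (word_list (m n) (\<alpha> n)) y) \<longlonglongrightarrow> z y)" for j z m \<alpha>
  have "\<exists>z m \<alpha>. Q j z m \<alpha>" if j: "j < k" for j
  proof -
    have "AE y in N. \<bar>v j y\<bar> \<le> 1" using v(2)[OF j] by (intro AE_I2)
    from v(1)[OF j] this zero_le_one obtain z m \<alpha> where "rel (v j) z" "\<And>n u. \<bar>\<alpha> n u\<bar> \<le> 1"
      "AE y in N. (\<lambda>n. S' (word_list (m n) (\<alpha> n)) y) \<longlonglongrightarrow> v j y"
      "AE y in N. (\<lambda>n. Z' (word_list (m n) (\<alpha> n)) y) \<longlonglongrightarrow> z y"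
      by (rule rel_approx) (rule that)
    then show ?thesis unfolding Q_def by (intro exI[of _ z] exI[of _ m] exI[of _ \<alpha>]) simp
  qed
  then obtain z m \<alpha> where "\<And>j. j < k \<Longrightarrow> Q j (z j) (m j) (\<alpha> j)" by metis
  then have z: "\<And>j. j < k \<Longrightarrow> rel (v j) (z j)"
    and \<alpha>: "\<And>j n u. j < k \<Longrightarrow> \<bar>\<alpha> j n u\<bar> \<le> 1"
    and Sv: "\<And>j. j < k \<Longrightarrow> AE y in N. (\<lambda>n. S' (word_list (m j n) (\<alpha> j n)) y) \<longlonglongrightarrow> v j y"
    and Zz: "\<And>j. j < k \<Longrightarrow> AE y in N. (\<lambda>n. Z' (word_list (m j n) (\<alpha> j n)) y) \<longlonglongrightarrow> z j y"
    unfolding Q_def by blast+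
  have Zv: "AE y in N. (\<lambda>n. Z' (word_list (m j n) (\<alpha> j n)) y) \<longlonglongrightarrow> Op (v j) y" if j: "j < k" for j
    using Zz[OF j] rel_unique[OF z[OF j] rel_Op[OF v(3)[OF j]]] by eventually_elim simp
  let ?\<nu> = "\<lambda>n. distr N (Rm (2 * k)) (profile_vec k (\<lambda>j. S' (word_list (m j n) (\<alpha> j n))) (\<lambda>j. Z' (word_list (m j n) (\<alpha> j n))))"
  have e2: "0 < e / 2" using e by simp
  have "\<forall>\<^sub>F n in sequentially. dLP (2 * k) (?\<nu> n) \<eta> \<le> e / 2"
    unfolding v(5) profile_vec_def
    by (rule B.dLP_tendsto_AE[OF _ _ _ e2]) (use v Sv Zv in auto)
  then obtain n where n: "dLP (2 * k) (?\<nu> n) \<eta> \<le> e / 2" by (auto simp: eventually_sequentially)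
  have \<nu>: "?\<nu> n \<in> profile k N Op" using \<alpha> by (intro profile_S(2))
  from profile_S_lim[OF e2, of k "\<lambda>j. word_list (m j n) (\<alpha> j n)"] show ?thesis
  proof eventually_elim
    case (elim i)
    let ?\<mu> = "distr (M i) (Rm (2 * k)) (profile_vec k (\<lambda>j. S i (word_list (m j n) (\<alpha> j n))) (\<lambda>j. Z i (word_list (m j n) (\<alpha> j n))))"
    have \<mu>: "?\<mu> \<in> profile k (M i) (A i)" using \<alpha> by (intro profile_S(1))
    have "dLP (2 * k) ?\<mu> \<eta> \<le> dLP (2 * k) ?\<mu> (?\<nu> n) + dLP (2 * k) (?\<nu> n) \<eta>"
      by (intro dLP_triangle profile_prob_space[OF \<mu> P_op] profile_prob_space[OF \<nu> P_operator_Op]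
          profile_prob_space[OF \<eta> P_operator_Op])
    then show ?case using elim n \<mu> by (intro bexI[of _ ?\<mu>]) auto
  qed
qed

end

section \<open>Total boundedness of profiles\<close>

lemma lpnorm_zero_le:
  assumes "1 \<le> q"
  shows "lpnorm M q (\<lambda>_. 0) \<le> ennreal 0"
  using assms
proof (cases rule: ennreal_ge_1_cases)
  case 1
  have "lpnorm M \<top> (\<lambda>_. 0) \<le> ennreal 0" by (subst lpnorm_infinity_le_iff) auto
  then show ?thesis using 1 by simp
next
  case (2 r)
  then show ?thesis by (subst 2(1), subst lpnorm_le_iff) auto
qed

text \<open>The supremum leaves out functions of vanishing p-norm. Such a function is null, and an
  operator that is linear and respects equality almost everywhere sends it to a null
  function.\<close>

lemma opnorm_bound:
  assumes T: "P_operator M T" and pq: "1 \<le> p" "1 \<le> q" and K: "0 \<le> K" "opnorm M T (ennreal p) q \<le> ennreal K"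
    and v: "Linf M v" and c: "0 \<le> c" "lpnorm M (ennreal p) v \<le> ennreal c"
  shows "lpnorm M q (T v) \<le> ennreal (K * c)"
proof (cases "lpnorm M (ennreal p) v = 0")
  case True
  then have "lpnorm M (ennreal p) v \<le> ennreal 0" by simp
  then have "(\<integral>\<^sup>+x. ennreal (\<bar>v x\<bar> powr p) \<partial>M) = 0" using pq by (subst (asm) lpnorm_le_iff) auto
  moreover have "v \<in> borel_measurable M" using v by (simp add: Linf_def)
  ultimately have "AE x in M. ennreal (\<bar>v x\<bar> powr p) = 0" by (subst (asm) nn_integral_0_iff_AE) auto
  then have "AE x in M. v x = 0 * v x + 0 * v x" by eventually_elim (auto simp: ennreal_eq_0_iff)
  then have "AE x in M. T v x = T (\<lambda>y. 0 * v y + 0 * v y) x"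
    by (rule P_operatorD(4)[OF T v Linf_lincomb[OF v v]])
  with P_operatorD(5)[OF T v v, of 0 0] have "AE x in M. 0 = T v x" by eventually_elim simp
  then have "lpnorm M q (T v) \<le> ennreal 0"
    using pq P_operatorD(2)[OF T v] by (intro lpnorm_le_cong_AE[OF _ _ _ _ _ lpnorm_zero_le]) auto
  then show ?thesis using K c by (simp add: le_zero_eq)
next
  case False
  let ?b = "lpnorm M (ennreal p) v"
  have b: "?b \<noteq> \<top>" using c(2) by (auto simp: top_unique)
  have "lpnorm M q (T v) / ?b \<le> opnorm M T (ennreal p) q"
    unfolding opnorm_def using v False by (intro SUP_upper) auto
  then have "lpnorm M q (T v) / ?b * ?b \<le> ennreal K * ?b" using K by (intro mult_right_mono) auto
  also have "lpnorm M q (T v) / ?b * ?b = lpnorm M q (T v)"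
    using False b by (simp add: ennreal_divide_times ennreal_divide_self top.not_eq_extremum)
  also have "ennreal K * ?b \<le> ennreal K * ennreal c" using c by (intro mult_left_mono) auto
  also have "\<dots> = ennreal (K * c)" using K c by (simp add: ennreal_mult)
  finally show ?thesis .
qed

locale bounded_operator =
  fixes M :: "'a measure" and T :: "('a \<Rightarrow> real) \<Rightarrow> 'a \<Rightarrow> real" and K p :: real and q :: ennreal
  assumes T: "P_operator M T" and p: "1 \<le> p" and q: "1 \<le> q" and K: "0 \<le> K"
    and T_bound: "\<And>v c. Linf M v \<Longrightarrow> 0 \<le> c \<Longrightarrow> lpnorm M (ennreal p) v \<le> ennreal c
      \<Longrightarrow> lpnorm M q (T v) \<le> ennreal (K * c)"
begin

lemma L1_bound:
  assumes v: "Linf M v" and c: "0 \<le> c" "AE x in M. \<bar>v x\<bar> \<le> c"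
  shows "(\<integral>\<^sup>+x. ennreal \<bar>T v x\<bar> \<partial>M) \<le> ennreal (K * c)"
proof -
  interpret prob_space M by (rule P_operatorD(1)[OF T])
  have "lpnorm M (ennreal p) v \<le> ennreal c" using p c by (intro lpnorm_le_const)
  from T_bound[OF v c(1) this] show ?thesis
    using q K c P_operatorD(2)[OF T v] by (intro nn_integral_le_lpnorm[of q]) auto
qed

lemma tail_bound:
  assumes v: "Linf M v" and c: "0 \<le> c" "AE x in M. \<bar>v x\<bar> \<le> c" and L: "0 < L"
  shows "measure M {x \<in> space M. L \<le> \<bar>T v x\<bar>} \<le> K * c / L"
  using L1_bound[OF v c] K c
  by (intro Markov_nn P_operatorD(1)[OF T] P_operatorD(2)[OF T v] L) auto

lemma tail_bound_diff:
  assumes v: "Linf M v" "Linf M w" and c: "0 \<le> c" "\<And>x. x \<in> space M \<Longrightarrow> \<bar>v x - w x\<bar> \<le> c" and L: "0 < L"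
  shows "measure M {x \<in> space M. L \<le> \<bar>T v x - T w x\<bar>} \<le> K * c / L"
proof (rule Markov_nn[OF P_operatorD(1)[OF T] _ L])
  have "AE x in M. T (\<lambda>y. 1 * v y + (- 1) * w y) x = 1 * T v x + (- 1) * T w x"
    by (rule P_operatorD(5)[OF T v])
  then have "(\<integral>\<^sup>+x. ennreal \<bar>T v x - T w x\<bar> \<partial>M) = (\<integral>\<^sup>+x. ennreal \<bar>T (\<lambda>y. 1 * v y + (- 1) * w y) x\<bar> \<partial>M)"
    by (intro nn_integral_cong_AE) (auto elim: eventually_mono)
  also have "\<dots> \<le> ennreal (K * c)" using c by (intro L1_bound Linf_lincomb v AE_I2) auto
  finally show "(\<integral>\<^sup>+x. ennreal \<bar>T v x - T w x\<bar> \<partial>M) \<le> ennreal (K * c)" .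
  have "T v \<in> borel_measurable M" "T w \<in> borel_measurable M" using P_operatorD(2)[OF T] v by auto
  then show "(\<lambda>x. T v x - T w x) \<in> borel_measurable M" by measurable
qed (use K c in auto)

text \<open>Two scales are at work: if the arguments differ by at most \<open>d\<close>, Markov's
  inequality confines the points where an image changes by \<open>c\<close> or more to a set of
  measure at most \<open>K * d / c\<close>. So \<open>d\<close> has to be small compared with
  \<open>c\<close>.\<close>

lemma profile_perturb:
  assumes v: "\<And>j. j < k \<Longrightarrow> Linf M (v j)" "\<And>j. j < k \<Longrightarrow> Linf M (w j)"
    and d: "\<And>j x. j < k \<Longrightarrow> x \<in> space M \<Longrightarrow> \<bar>v j x - w j x\<bar> \<le> d" "0 \<le> d" "d \<le> c"
    and c: "0 < c" "real (2 * k) * c < e" "real k * (K * d / c) \<le> e"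
  shows "dLP (2 * k) (distr M (Rm (2 * k)) (profile_vec k v (\<lambda>j. T (v j))))
    (distr M (Rm (2 * k)) (profile_vec k w (\<lambda>j. T (w j)))) \<le> e"
proof -
  interpret prob_space M by (rule P_operatorD(1)[OF T])
  have m: "v j \<in> borel_measurable M" "w j \<in> borel_measurable M" "T (v j) \<in> borel_measurable M" "T (w j) \<in> borel_measurable M"
    if "j < k" for j
    using v[OF that] P_operatorD(2)[OF T] by (auto simp: Linf_def)
  have e0: "0 < e" using c(1,2) by (meson less_le_trans mult_nonneg_nonneg of_nat_0_le_iff less_imp_le order.strict_trans1)
  let ?E = "\<lambda>j. {x \<in> space M. c \<le> \<bar>T (v j) x - T (w j) x\<bar>}"
  let ?f = "profile_vec k v (\<lambda>j. T (v j))" and ?g = "profile_vec k w (\<lambda>j. T (w j))"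
  have E: "?E j \<in> sets M" if "j < k" for j using m[OF that] by measurable
  have lt: "eucl_dist (2 * k) (?f x) (?g x) < e" if x: "x \<in> space M" "x \<notin> (\<Union>j<k. ?E j)" for x
  proof (rule eucl_dist_less[OF _ c(2)])
    fix j assume j: "j < 2 * k"
    show "\<bar>?f x j - ?g x j\<bar> \<le> c"
    proof (cases "j < k")
      case True
      then show ?thesis using d(1)[OF True x(1)] d(3) j by (simp add: profile_vec_def)
    next
      case False
      then have "j - k < k" using j by simp
      then have "\<not> c \<le> \<bar>T (v (j - k)) x - T (w (j - k)) x\<bar>" using x by blast
      then show ?thesis using False j by (simp add: profile_vec_def)
    qed
  qed
  have "measure M {x \<in> space M. e \<le> eucl_dist (2 * k) (?f x) (?g x)} \<le> measure M (\<Union>j<k. ?E j)"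
  proof (rule finite_measure_mono)
    show "{x \<in> space M. e \<le> eucl_dist (2 * k) (?f x) (?g x)} \<subseteq> (\<Union>j<k. ?E j)"
      using lt by (fastforce simp: not_le)
    show "(\<Union>j<k. ?E j) \<in> sets M" using E by auto
  qed
  also have "\<dots> \<le> (\<Sum>j<k. measure M (?E j))" using E by (intro measure_UNION_le) auto
  also have "\<dots> \<le> (\<Sum>j<k. K * d / c)"
    using v d c by (intro sum_mono tail_bound_diff) auto
  also have "\<dots> \<le> e" using c(3) by simp
  finally show ?thesis
    using m by (intro dLP_le_coupling measurable_profile_vec prob_space_axioms e0) auto
qed

end

text \<open>The properties of a profile vector on which total boundedness rests; how
  \<open>w\<close> arises from \<open>v\<close> is forgotten and only its tails are kept.\<close>

definition tame :: "real \<Rightarrow> nat \<Rightarrow> 'a measure \<Rightarrow> (nat \<Rightarrow> 'a \<Rightarrow> real) \<Rightarrow> (nat \<Rightarrow> 'a \<Rightarrow> real) \<Rightarrow> bool" where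
  "tame K k M v w \<longleftrightarrow> prob_space M \<and>
    (\<forall>j<k. v j \<in> borel_measurable M \<and> w j \<in> borel_measurable M \<and> (\<forall>x\<in>space M. \<bar>v j x\<bar> \<le> 1) \<and>
      (\<forall>L>0. measure M {x \<in> space M. L \<le> \<bar>w j x\<bar>} \<le> K / L))"

text \<open>The classifying number is obtained by rounding the
  probabilities of the cells of a grid in a large box.\<close>
lemma finite_classification:
  assumes K: "0 \<le> K" and e: "0 < e"
  shows "\<exists>(R :: nat) (\<kappa> :: 'a measure \<Rightarrow> (nat \<Rightarrow> 'a \<Rightarrow> real) \<Rightarrow> (nat \<Rightarrow> 'a \<Rightarrow> real) \<Rightarrow> nat).
    (\<forall>M v w. \<kappa> M v w < R) \<and>
    (\<forall>M v w v' w'. tame K k M v w \<longrightarrow> tame K k M v' w' \<longrightarrow> \<kappa> M v w = \<kappa> M v' w' \<longrightarrow>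
      dLP (2 * k) (distr M (Rm (2 * k)) (profile_vec k v w)) (distr M (Rm (2 * k)) (profile_vec k v' w')) \<le> e)"
proof -
  obtain D0 where D0: "real (2 * k) / e < real D0" using reals_Archimedean2 by blast
  define D where "D = Suc D0"
  have D: "0 < D" "real (2 * k) * (1 / real D) < e" using D0 e by (auto simp: D_def field_simps)
  obtain L0 where L0: "4 * real k * K / e < real L0" using reals_Archimedean2 by blast
  \<comment> \<open>The summand 2 gives \<open>1 < L\<close>, so the argument coordinates lie
    strictly inside the box; the tails of the images outside it have total mass at most
    \<open>e / 4\<close>.\<close>
  define L where "L = L0 + 2"
  have L: "1 < L" "real k * (K / real L) \<le> e / 4" using L0 e by (auto simp: L_def field_simps)
  define zL where "zL = int (L * D)"
  \<comment> \<open>Clipping keeps the labels in a finite set; inside the box it changes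
    nothing.\<close>
  define lab where "lab y = restrict (\<lambda>j. max (- zL) (min zL \<lfloor>real D * y j\<rfloor>)) {..<2 * k}" for y :: "nat \<Rightarrow> real"
  define C where "C = PiE {..<2 * k} (\<lambda>_. {- zL..zL})"
  have finC: "finite C" unfolding C_def by (intro finite_PiE) auto
  have labC: "lab y \<in> C" for y unfolding lab_def C_def by (auto simp: zL_def)
  \<comment> \<open>Rounding the probabilities of \<open>card C\<close> cells to multiples of
    \<open>1 / R0\<close> costs at most \<open>e / 2\<close> in total.\<close>
  obtain R0 where R0: "2 * real (card C) / e < real R0" using reals_Archimedean2 by blast
  have R0': "0 < R0"
  proof -
    have "0 \<le> 2 * real (card C) / e" using e by simp
    then have "0 < real R0" using R0 by linarith
    then show ?thesis by simp
  qed
  have cR: "real (card C) * (1 / real R0) \<le> e / 2" using R0 R0' e by (simp add: field_simps)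
  define pr where "pr M v w u = measure M {x \<in> space M. lab (profile_vec k v w x) = u}"
    for M :: "'a measure" and v w u
  define key where "key M v w = restrict (\<lambda>u. min R0 (nat \<lfloor>real R0 * pr M v w u\<rfloor>)) C"
    for M :: "'a measure" and v w
  define Keys where "Keys = PiE C (\<lambda>_. {..R0})"
  have finK: "finite Keys" unfolding Keys_def using finC by (intro finite_PiE) auto
  have keyK: "key M v w \<in> Keys" for M v w unfolding key_def Keys_def by auto
  obtain f where f: "bij_betw f Keys {0..<card Keys}" using ex_bij_betw_finite_nat[OF finK] by blast
  have "f (key M v w) < card Keys" for M v w using bij_betwE[OF f] keyK by fastforce
  moreover have "dLP (2 * k) (distr M (Rm (2 * k)) (profile_vec k v w)) (distr M (Rm (2 * k)) (profile_vec k v' w')) \<le> e"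
    if t: "tame K k M v w" "tame K k M v' w'" and eq: "f (key M v w) = f (key M v' w')" for M v w v' w'
  proof -
    interpret prob_space M using t(1) by (simp add: tame_def)
    have keq: "key M v w = key M v' w'"
      using eq keyK bij_betw_imp_inj_on[OF f] by (auto dest: inj_onD)
    have meas: "profile_vec k v w \<in> measurable M (Rm (2 * k))" if "tame K k M v w" for v w
      using that by (intro measurable_profile_vec) (auto simp: tame_def)
    have labs: "{x \<in> space M. lab (profile_vec k v w x) = u} \<in> sets M" if "tame K k M v w" "u \<in> C" for v w u
    proof -
      have "lab y = u \<longleftrightarrow> (\<forall>j\<in>{..<2 * k}. max (- zL) (min zL \<lfloor>real D * y j\<rfloor>) = u j)" for y
        using that(2) unfolding C_def lab_def by (auto simp: fun_eq_iff PiE_def extensional_def)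
      then have eq: "{x \<in> space M. lab (profile_vec k v w x) = u}
        = {x \<in> space M. \<forall>j\<in>{..<2 * k}. max (- zL) (min zL \<lfloor>real D * profile_vec k v w x j\<rfloor>) = u j}" by simp
      have [measurable]: "(\<lambda>x. profile_vec k v w x j) \<in> borel_measurable M" if "j \<in> {..<2 * k}" for j
        using measurable_compose[OF meas[OF \<open>tame K k M v w\<close>] measurable_component_singleton[OF that]] .
      show ?thesis unfolding eq by measurable
    qed
    define X where "X v w = {x \<in> space M. \<forall>j\<in>{..<k}. \<bar>w j x\<bar> < real L}" for v w :: "nat \<Rightarrow> 'a \<Rightarrow> real"
    have X: "X v w \<in> sets M" "1 - e / 4 \<le> measure M (X v w)" if t: "tame K k M v w" for v w
    proof -
      have wm: "w j \<in> borel_measurable M" if "j < k" for j using t that by (simp add: tame_def)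
      show s: "X v w \<in> sets M" unfolding X_def using wm by measurable
      have sL: "{x \<in> space M. real L \<le> \<bar>w j x\<bar>} \<in> sets M" if "j < k" for j using wm[OF that] by measurable
      have "measure M (space M - X v w) \<le> measure M (\<Union>j<k. {x \<in> space M. real L \<le> \<bar>w j x\<bar>})"
        using sL by (intro finite_measure_mono) (auto simp: X_def not_less)
      also have "\<dots> \<le> (\<Sum>j<k. measure M {x \<in> space M. real L \<le> \<bar>w j x\<bar>})"
        using sL by (intro measure_UNION_le) auto
      also have "\<dots> \<le> (\<Sum>j<k. K / real L)" using t L(1) by (intro sum_mono) (auto simp: tame_def)
      also have "\<dots> \<le> e / 4" using L by simp
      finally show "1 - e / 4 \<le> measure M (X v w)" using s by (simp add: prob_compl)
    qed
    have box: "\<bar>profile_vec k v w x j\<bar> < real L" if "tame K k M v w" "x \<in> X v w" "j < 2 * k" for v w x j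
    proof (cases "j < k")
      case True
      then have "\<bar>v j x\<bar> \<le> 1" using that by (auto simp: tame_def X_def)
      then show ?thesis using True that(3) L(1) by (simp add: profile_vec_def)
    next
      case False
      then have "\<bar>w (j - k) x\<bar> < real L" using that by (auto simp: X_def)
      then show ?thesis using False that(3) by (simp add: profile_vec_def)
    qed
    show ?thesis
    proof (rule dLP_le_labels[OF prob_space_axioms prob_space_axioms meas[OF t(1)] meas[OF t(2)] finC
          labC labC labs[OF t(1)] labs[OF t(2)] X[OF t(1)] X[OF t(2)], where b = "e / 2"])
      fix x y assume x: "x \<in> X v w" and y: "y \<in> X v' w'"
        and l: "lab (profile_vec k v w x) = lab (profile_vec k v' w' y)"
      show "eucl_dist (2 * k) (profile_vec k v w x) (profile_vec k v' w' y) < e"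
      proof (rule eucl_dist_less[OF _ D(2)])
        fix j assume j: "j < 2 * k"
        let ?a = "profile_vec k v w x j" and ?b = "profile_vec k v' w' y j"
        have clip: "max (- zL) (min zL \<lfloor>real D * a\<rfloor>) = \<lfloor>real D * a\<rfloor>" if "\<bar>a\<bar> < real L" for a
        proof -
          have "\<bar>real D * a\<bar> \<le> real (L * D)"
          proof -
            have "real D * \<bar>a\<bar> \<le> real D * real L" using that by (intro mult_left_mono) auto
            then show ?thesis by (simp add: abs_mult mult.commute)
          qed
          then have "real D * a \<le> real_of_int zL" "real_of_int (- zL) \<le> real D * a"
            unfolding zL_def by (simp_all add: abs_le_iff)
          then have "\<lfloor>real D * a\<rfloor> \<le> zL" "- zL \<le> \<lfloor>real D * a\<rfloor>" by linarith+
          then show ?thesis by simp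
        qed
        have "lab (profile_vec k v w x) j = lab (profile_vec k v' w' y) j" using l by simp
        then have "\<lfloor>real D * ?a\<rfloor> = \<lfloor>real D * ?b\<rfloor>"
          using j clip[OF box[OF t(1) x j]] clip[OF box[OF t(2) y j]] by (simp add: lab_def)
        then have "\<bar>real D * ?a - real D * ?b\<bar> \<le> 1" by linarith
        then have "real D * \<bar>?a - ?b\<bar> \<le> 1" by (simp add: abs_mult flip: right_diff_distrib)
        then show "\<bar>?a - ?b\<bar> \<le> 1 / real D" using D by (simp add: field_simps)
      qed
    next
      have "\<bar>pr M v w u - pr M v' w' u\<bar> \<le> 1 / real R0" if u: "u \<in> C" for u
      proof -
        have le: "nat \<lfloor>real R0 * pr M v w u\<rfloor> \<le> R0" for v w
        proof -
          have "real R0 * pr M v w u \<le> real R0" unfolding pr_def by (simp add: mult_left_le)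
          then have "\<lfloor>real R0 * pr M v w u\<rfloor> \<le> int R0" by linarith
          then show ?thesis by simp
        qed
        have "key M v w u = key M v' w' u" using keq by simp
        then have "nat \<lfloor>real R0 * pr M v w u\<rfloor> = nat \<lfloor>real R0 * pr M v' w' u\<rfloor>"
          using u le[of v w] le[of v' w'] by (simp add: key_def)
        moreover have "0 \<le> \<lfloor>real R0 * pr M v w u\<rfloor>" "0 \<le> \<lfloor>real R0 * pr M v' w' u\<rfloor>" by (simp_all add: pr_def)
        ultimately have "\<lfloor>real R0 * pr M v w u\<rfloor> = \<lfloor>real R0 * pr M v' w' u\<rfloor>" by (simp add: eq_nat_nat_iff)
        then have "\<bar>real R0 * pr M v w u - real R0 * pr M v' w' u\<bar> \<le> 1" by linarith
        then have "real R0 * \<bar>pr M v w u - pr M v' w' u\<bar> \<le> 1" by (simp add: abs_mult flip: right_diff_distrib)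
        then show ?thesis using R0' by (simp add: field_simps)
      qed
      then have "(\<Sum>u\<in>C. \<bar>pr M v w u - pr M v' w' u\<bar>) \<le> (\<Sum>u\<in>C. 1 / real R0)" by (intro sum_mono)
      also have "\<dots> \<le> e / 2" using cR by simp
      finally show "(\<Sum>u\<in>C. \<bar>measure M {x \<in> space M. lab (profile_vec k v w x) = u}
        - measure M {x \<in> space M. lab (profile_vec k v' w' x) = u}\<bar>) \<le> e / 2" unfolding pr_def .
    qed (use e in auto)
  qed
  ultimately show ?thesis
    by (intro exI[of _ "card Keys"] exI[of _ "\<lambda>M v w. f (key M v w)"]) blast
qed

lemma (in bounded_operator) tame_T:
  assumes "\<And>j. j < k \<Longrightarrow> v j \<in> borel_measurable M" "\<And>j x. j < k \<Longrightarrow> x \<in> space M \<Longrightarrow> \<bar>v j x\<bar> \<le> 1"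
  shows "tame K k M v (\<lambda>j. T (v j))"
proof -
  have L: "Linf M (v j)" if "j < k" for j using assms that by (intro LinfI) auto
  have "measure M {x \<in> space M. c \<le> \<bar>T (v j) x\<bar>} \<le> K / c" if "j < k" "0 < c" for j c
    using tail_bound[OF L[OF that(1)], of 1 c] assms that by auto
  then show ?thesis unfolding tame_def
    using assms P_operatorD(1)[OF T] P_operatorD(2)[OF T L] by auto
qed

text \<open>Every occupied class contributes one representative. The number \<open>R\<close> does
  not depend on \<open>i\<close>, so that the nets on all spaces can be indexed by one countable set
  and encoded at common bit positions.\<close>

lemma profile_net:
  fixes M :: "nat \<Rightarrow> 'a measure"
  assumes A: "\<And>i. bounded_operator (M i) (A i) K p q" and K: "0 \<le> K" and e: "0 < e"
  shows "\<exists>(R :: nat) g. (\<forall>i. \<forall>r<R. \<forall>j<k. g i r j \<in> borel_measurable (M i) \<and> (\<forall>x\<in>space (M i). \<bar>g i r j x\<bar> \<le> 1)) \<and>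
    (\<forall>i. \<forall>\<eta>\<in>profile k (M i) (A i). \<exists>r<R.
      dLP (2 * k) \<eta> (distr (M i) (Rm (2 * k)) (profile_vec k (g i r) (\<lambda>j. A i (g i r j)))) \<le> e)"
proof -
  obtain R and \<kappa> :: "'a measure \<Rightarrow> (nat \<Rightarrow> 'a \<Rightarrow> real) \<Rightarrow> (nat \<Rightarrow> 'a \<Rightarrow> real) \<Rightarrow> nat"
    where \<kappa>: "\<And>M v w. \<kappa> M v w < R"
    "\<And>M v w v' w'. tame K k M v w \<Longrightarrow> tame K k M v' w' \<Longrightarrow> \<kappa> M v w = \<kappa> M v' w' \<Longrightarrow>
      dLP (2 * k) (distr M (Rm (2 * k)) (profile_vec k v w)) (distr M (Rm (2 * k)) (profile_vec k v' w')) \<le> e"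
    using finite_classification[OF K e, of k, where 'a = 'a] by blast
  define ok where "ok i v \<longleftrightarrow> (\<forall>j<k. v j \<in> borel_measurable (M i) \<and> (\<forall>x\<in>space (M i). \<bar>v j x\<bar> \<le> 1))" for i and v :: "nat \<Rightarrow> 'a \<Rightarrow> real"
  \<comment> \<open>An empty class is represented by zero functions, which keeps
    \<open>g i r\<close> admissible for every \<open>r\<close>.\<close>
  define g where "g i r = (if \<exists>v. ok i v \<and> \<kappa> (M i) v (\<lambda>j. A i (v j)) = r
    then SOME v. ok i v \<and> \<kappa> (M i) v (\<lambda>j. A i (v j)) = r else (\<lambda>_ _. 0))" for i r
  have g: "ok i (g i (\<kappa> (M i) v (\<lambda>j. A i (v j)))) \<and>
      \<kappa> (M i) (g i (\<kappa> (M i) v (\<lambda>j. A i (v j)))) (\<lambda>j. A i (g i (\<kappa> (M i) v (\<lambda>j. A i (v j))) j)) = \<kappa> (M i) v (\<lambda>j. A i (v j))"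
    if "ok i v" for i v
  proof -
    have ex: "\<exists>v'. ok i v' \<and> \<kappa> (M i) v' (\<lambda>j. A i (v' j)) = \<kappa> (M i) v (\<lambda>j. A i (v j))" using that by blast
    then have "g i (\<kappa> (M i) v (\<lambda>j. A i (v j))) = (SOME v'. ok i v' \<and> \<kappa> (M i) v' (\<lambda>j. A i (v' j)) = \<kappa> (M i) v (\<lambda>j. A i (v j)))"
      by (simp add: g_def)
    then show ?thesis using someI_ex[OF ex] by simp
  qed
  have okg: "ok i (g i r)" for i r
  proof (cases "\<exists>v. ok i v \<and> \<kappa> (M i) v (\<lambda>j. A i (v j)) = r")
    case True
    then show ?thesis using g by metis
  next
    case False
    then have "g i r = (\<lambda>_ _. 0)" unfolding g_def by (rule if_not_P)
    then show ?thesis by (simp add: ok_def)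
  qed
  have tame_ok: "tame K k (M i) v (\<lambda>j. A i (v j))" if "ok i v" for i v
    using that by (intro bounded_operator.tame_T[OF A]) (auto simp: ok_def)
  have "\<exists>r<R. dLP (2 * k) \<eta> (distr (M i) (Rm (2 * k)) (profile_vec k (g i r) (\<lambda>j. A i (g i r j)))) \<le> e"
    if \<eta>: "\<eta> \<in> profile k (M i) (A i)" for i \<eta>
  proof -
    obtain v where v: "ok i v" "\<eta> = distr (M i) (Rm (2 * k)) (profile_vec k v (\<lambda>j. A i (v j)))"
      using \<eta> unfolding profile_eq ok_def by blast
    show ?thesis unfolding v(2) using \<kappa>(1) g[OF v(1)] okg
      by (intro exI[of _ "\<kappa> (M i) v (\<lambda>j. A i (v j))"] conjI \<kappa>(2) tame_ok v(1)) auto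
  qed
  then show ?thesis using okg unfolding ok_def by (intro exI[of _ R] exI[of _ g]) blast
qed

text \<open>The next bit is a function of the point and of the vector of the earlier bits, as a function on the
  whole space.\<close>
primrec bits :: "(nat \<Rightarrow> ('a \<Rightarrow> bool list) \<Rightarrow> 'a \<Rightarrow> bool) \<Rightarrow> nat \<Rightarrow> 'a \<Rightarrow> bool list" where
  "bits F 0 = (\<lambda>x. [])"
| "bits F (Suc n) = (\<lambda>x. F n (bits F n) x # bits F n x)"

lemma length_bits [simp]: "length (bits F n x) = n"
  by (induction n) auto

lemma drop_bits: "m \<le> n \<Longrightarrow> drop (n - m) (bits F n x) = bits F m x"
proof (induction n)
  case (Suc n)
  then show ?case by (cases "m = Suc n") (auto simp: Suc_diff_le)
qed auto

lemma sets_bits_eq: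
  assumes "\<And>n \<beta>. (\<And>w. {x \<in> space M. \<beta> x = w} \<in> sets M) \<Longrightarrow> {x \<in> space M. F n \<beta> x} \<in> sets M"
  shows "{x \<in> space M. bits F n x = w} \<in> sets M"
proof (induction n arbitrary: w)
  case 0
  then show ?case by (cases "w = []") auto
next
  case (Suc n)
  show ?case
  proof (cases w)
    case Nil
    then have eq: "{x \<in> space M. bits F (Suc n) x = w} = {}" by auto
    show ?thesis unfolding eq by (rule sets.empty_sets)
  next
    case (Cons b u)
    have F: "{x \<in> space M. F n (bits F n) x} \<in> sets M" using assms Suc by blast
    have "{x \<in> space M. bits F (Suc n) x = w} = (if b then {x \<in> space M. F n (bits F n) x}
      else space M - {x \<in> space M. F n (bits F n) x}) \<inter> {x \<in> space M. bits F n x = u}"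
      using Cons by auto
    then show ?thesis using F Suc[of u] by auto
  qed
qed

text \<open>A position codes a question, about some \<open>G i g\<close> or about the image of a
  word; the word refers to earlier bits only, so the recursion is not circular. The positions
  \<open>ix\<close> and \<open>gx\<close> do not depend on \<open>i\<close>: equal words on
  different spaces answer the same questions alike.\<close>

lemma bits_exist:
  fixes M :: "nat \<Rightarrow> 'a measure" and G :: "nat \<Rightarrow> 'g::countable \<Rightarrow> 'a \<Rightarrow> real"
  assumes A: "\<And>i. P_operator (M i) (A i)" and G: "\<And>i g. G i g \<in> borel_measurable (M i)"
  obtains bl :: "nat \<Rightarrow> nat \<Rightarrow> 'a \<Rightarrow> bool list" and ix gx where
    "\<And>i n x. tl (bl i (Suc n) x) = bl i n x" "\<And>i n x. length (bl i n x) = n"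
    "\<And>i n w. {x \<in> space (M i). bl i n x = w} \<in> sets (M i)"
    "\<And>i w t x. hd (bl i (Suc (ix w t)) x) \<longleftrightarrow> A i (\<lambda>y. of_bool (bl i (length w) y = w)) x < of_rat t"
    "\<And>i g t x. hd (bl i (Suc (gx g t)) x) \<longleftrightarrow> G i g x < of_rat t"
proof -
  \<comment> \<open>The unused component of the code makes every request recur at arbitrarily late positions, in
    particular at one where all the bits prescribed by \<open>w\<close> are available.\<close>
  define F where "F i n \<beta> x = (case from_nat n :: ('g + bool list) \<times> rat \<times> nat of (s, t, _) \<Rightarrow>
    (case s of Inl g \<Rightarrow> G i g x < of_rat t
      | Inr w \<Rightarrow> A i (\<lambda>y. of_bool (drop (n - length w) (\<beta> y) = w)) x < of_rat t))"
    for i n and \<beta> :: "'a \<Rightarrow> bool list" and x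
  define bl where "bl i = bits (F i)" for i
  have sets: "{x \<in> space (M i). bl i n x = w} \<in> sets (M i)" for i n w
    unfolding bl_def
  proof (rule sets_bits_eq)
    fix n and \<beta> :: "'a \<Rightarrow> bool list" assume \<beta>: "\<And>w. {x \<in> space (M i). \<beta> x = w} \<in> sets (M i)"
    have [measurable]: "\<beta> \<in> measurable (M i) (count_space UNIV)"
    proof (rule measurable_count_space_eq2_countable[THEN iffD2])
      show "\<beta> \<in> space (M i) \<rightarrow> UNIV \<and> (\<forall>a\<in>UNIV. \<beta> -` {a} \<inter> space (M i) \<in> sets (M i))"
        using \<beta> by (auto simp: vimage_def Int_def conj_commute)
    qed
    obtain s t z where st: "(from_nat n :: ('g + bool list) \<times> rat \<times> nat) = (s, t, z)" by (metis prod_cases3)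
    show "{x \<in> space (M i). F i n \<beta> x} \<in> sets (M i)"
    proof (cases s)
      case (Inl g)
      note [measurable] = G
      show ?thesis unfolding F_def st Inl prod.case sum.case by measurable
    next
      case (Inr w)
      have "(\<lambda>y. of_bool (drop (n - length w) (\<beta> y) = w) :: real) \<in> borel_measurable (M i)" by measurable
      then have "Linf (M i) (\<lambda>y. of_bool (drop (n - length w) (\<beta> y) = w))" by (rule LinfI[where C = 1]) auto
      from P_operatorD(2)[OF A this]
      have [measurable]: "A i (\<lambda>y. of_bool (drop (n - length w) (\<beta> y) = w)) \<in> borel_measurable (M i)" .
      show ?thesis unfolding F_def st Inr prod.case sum.case by measurable
    qed
  qed
  have "\<exists>z. length w \<le> to_nat (Inr w :: 'g + bool list, t :: rat, z :: nat)" for w t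
  proof -
    have "inj (\<lambda>z. to_nat (Inr w :: 'g + bool list, t :: rat, z :: nat))" by (auto intro!: injI)
    then have "infinite (range (\<lambda>z. to_nat (Inr w :: 'g + bool list, t :: rat, z :: nat)))"
      by (rule range_inj_infinite)
    then show ?thesis by (auto simp: infinite_nat_iff_unbounded_le)
  qed
  then obtain z where z: "\<And>w t. length w \<le> to_nat (Inr w :: 'g + bool list, t :: rat, z w t :: nat)" by metis
  define ix where "ix w t = to_nat (Inr w :: 'g + bool list, t, z w t)" for w t
  define gx where "gx g t = to_nat (Inl g :: 'g + bool list, t, 0 :: nat)" for g and t :: rat
  show thesis
  proof
    show "tl (bl i (Suc n) x) = bl i n x" for i n x by (simp add: bl_def)
    show "length (bl i n x) = n" for i n x by (simp add: bl_def)
    show "{x \<in> space (M i). bl i n x = w} \<in> sets (M i)" for i n w by (rule sets)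
    show "hd (bl i (Suc (ix w t)) x) \<longleftrightarrow> A i (\<lambda>y. of_bool (bl i (length w) y = w)) x < of_rat t" for i w t x
      using drop_bits[OF z, where F = "F i"] by (simp add: bl_def F_def ix_def)
    show "hd (bl i (Suc (gx g t)) x) \<longleftrightarrow> G i g x < of_rat t" for i g t x
      by (simp add: bl_def F_def gx_def)
  qed
qed

text \<open>A countable product of unit intervals is compact and metrizable, hence sequentially
  compact, and convergence in it is coordinatewise.\<close>

lemma countable_diagonal_subseq:
  fixes f :: "nat \<Rightarrow> 'c::countable \<Rightarrow> real"
  assumes "\<And>i w. 0 \<le> f i w" "\<And>i w. f i w \<le> 1"
  obtains r P where "strict_mono (r :: nat \<Rightarrow> nat)" "\<And>w. (\<lambda>i. f (r i) w) \<longlonglongrightarrow> P w"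
proof -
  have "compactin (product_topology (\<lambda>_::'c. euclidean) UNIV) (PiE UNIV (\<lambda>_. {0..1::real}))"
    by (subst compactin_PiE) auto
  then have "compact (PiE (UNIV :: 'c set) (\<lambda>_. {0..1::real}))"
    by (simp add: euclidean_product_topology)
  then have "seq_compact (PiE (UNIV :: 'c set) (\<lambda>_. {0..1::real}))"
    by (simp add: compact_eq_seq_compact_metric)
  moreover have "\<forall>i. f i \<in> PiE UNIV (\<lambda>_. {0..1::real})" using assms by auto
  ultimately obtain P r where r: "strict_mono (r :: nat \<Rightarrow> nat)" "(f \<circ> r) \<longlonglongrightarrow> P"
    unfolding seq_compact_def by metis
  have "(\<lambda>i. f (r i) w) \<longlonglongrightarrow> P w" for w
    using continuous_on_tendsto_compose[OF continuous_on_product_coordinates[of w] r(2)]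
    by (simp add: o_def)
  then show thesis using that r(1) by blast
qed

section \<open>Convergence\<close>

text \<open>Points with equal words, even on different spaces, pass the same threshold tests on the
  grid, so their values differ by at most \<open>1 / D\<close>. Hence any value met at a word may be
  assigned to it, by one \<open>\<alpha>\<close> for all \<open>i\<close>; being a value of some
  \<open>g i\<close>, it is bounded by 1.\<close>

lemma (in bit_system) step_approximation:
  assumes g: "\<And>i x. x \<in> space (M i) \<Longrightarrow> \<bar>g i x\<bar> \<le> 1"
    and gx: "\<And>i t x. x \<in> space (M i) \<Longrightarrow> hd (bl i (Suc (gx t)) x) \<longleftrightarrow> g i x < real_of_rat t"
    and D: "0 < D"
  shows "\<exists>n \<alpha>. (\<forall>u. \<bar>\<alpha> u\<bar> \<le> 1) \<and> (\<forall>i. \<forall>x\<in>space (M i). \<bar>\<alpha> (bl i n x) - g i x\<bar> \<le> 1 / real D)"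
proof -
  define t where "t z = (of_int z / of_nat D :: rat)" for z
  have t: "real_of_rat (t z) = real_of_int z / real D" for z by (simp add: t_def of_rat_divide)
  define zs where "zs = {- int D - 1..int D + 1}"
  have "finite ((\<lambda>z. Suc (gx (t z))) ` zs)" by (simp add: zs_def)
  then obtain n where n: "\<And>z. z \<in> zs \<Longrightarrow> Suc (gx (t z)) \<le> n"
    using finite_nat_set_iff_bounded_le[of "(\<lambda>z. Suc (gx (t z))) ` zs"] by auto
  have tr: "g i x < real_of_rat (t z) \<longleftrightarrow> g i' x' < real_of_rat (t z)"
    if "x \<in> space (M i)" "x' \<in> space (M i')" "bl i n x = bl i' n x'" "z \<in> zs" for i i' x x' z
    using bl_drop[OF n[OF that(4)], of i x] bl_drop[OF n[OF that(4)], of i' x'] that(3)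
      gx[OF that(1), of "t z"] gx[OF that(2), of "t z"] by simp
  have close: "\<bar>g i x - g i' x'\<bar> \<le> 1 / real D"
    if x: "x \<in> space (M i)" "x' \<in> space (M i')" "bl i n x = bl i' n x'" for i i' x x'
  proof -
    define z where "z = \<lfloor>g i x * real D\<rfloor>"
    have z: "real_of_int z \<le> g i x * real D" "g i x * real D < real_of_int z + 1" by (auto simp: z_def)
    have "real D * \<bar>g i x\<bar> \<le> real D * 1" using g[OF x(1)] by (intro mult_left_mono) auto
    then have "\<bar>g i x * real D\<bar> \<le> real D" by (simp add: abs_mult mult.commute)
    then have "real_of_int z \<le> real_of_int (int D)" "real_of_int (- int D - 1) \<le> real_of_int z"
      using z by (simp_all add: abs_le_iff)
    then have "z \<le> int D" "- int D - 1 \<le> z" by (simp_all only: of_int_le_iff)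
    then have zz: "z \<in> zs" "z + 1 \<in> zs" unfolding zs_def by simp_all
    have hz: "real_of_int z / real D \<le> g i x" "g i x < (real_of_int z + 1) / real D"
      using z D by (simp_all add: field_simps)
    have "real_of_int z / real D \<le> g i' x'" "g i' x' < (real_of_int z + 1) / real D"
      using tr[OF x zz(1)] tr[OF x zz(2)] hz by (simp_all add: t)
    then show ?thesis using hz unfolding add_divide_distrib by linarith
  qed
  \<comment> \<open>A word that occurs on no space gets 0, within the required bound.\<close>
  define \<alpha> where "\<alpha> u = (if \<exists>i x. x \<in> space (M i) \<and> bl i n x = u
    then (case SOME (i, x). x \<in> space (M i) \<and> bl i n x = u of (i, x) \<Rightarrow> g i x) else 0)" for u
  have \<alpha>: "\<exists>i' x'. x' \<in> space (M i') \<and> bl i' n x' = bl i n x \<and> \<alpha> (bl i n x) = g i' x'"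
    if "x \<in> space (M i)" for i x
  proof -
    have ex: "\<exists>s. case s of (i', x') \<Rightarrow> x' \<in> space (M i') \<and> bl i' n x' = bl i n x" using that by blast
    obtain i' x' where s: "(SOME (i', x'). x' \<in> space (M i') \<and> bl i' n x' = bl i n x) = (i', x')"
      by (cases "SOME (i', x'). x' \<in> space (M i') \<and> bl i' n x' = bl i n x") blast
    have "x' \<in> space (M i') \<and> bl i' n x' = bl i n x" using someI_ex[OF ex] unfolding s by simp
    moreover have "\<exists>i' x'. x' \<in> space (M i') \<and> bl i' n x' = bl i n x" using that by blast
    ultimately show ?thesis unfolding \<alpha>_def s by auto
  qed
  have "\<bar>\<alpha> u\<bar> \<le> 1" for u
  proof (cases "\<exists>i x. x \<in> space (M i) \<and> bl i n x = u")
    case True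
    then show ?thesis using \<alpha> g by metis
  next
    case False
    then have "\<alpha> u = 0" unfolding \<alpha>_def by (rule if_not_P)
    then show ?thesis by simp
  qed
  moreover have "\<bar>\<alpha> (bl i n x) - g i x\<bar> \<le> 1 / real D" if "x \<in> space (M i)" for i x
    using \<alpha>[OF that] close that by metis
  ultimately show ?thesis by blast
qed

lemma (in bit_system) bounded_operator_A: "bounded_operator (M i) (A i) K p q"
  using P_op p1 q1 K0 bound by unfold_locales

text \<open>Three steps of \<open>e / 3\<close>: from an element of the profile to the net, from the
  net to word functions, and from these on \<open>M i\<close> to the same word functions in the
  limit. Only the last step needs large \<open>i\<close>, and it concerns finitely many
  \<open>r\<close>, so the estimate is uniform over the profile.\<close>

lemma (in bit_system) profile_approx:
  fixes R :: nat
  assumes e: "0 < e"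
    and g: "\<And>i r j. r < R \<Longrightarrow> j < k \<Longrightarrow> g i r j \<in> borel_measurable (M i)"
      "\<And>i r j x. r < R \<Longrightarrow> j < k \<Longrightarrow> x \<in> space (M i) \<Longrightarrow> \<bar>g i r j x\<bar> \<le> 1"
    and net: "\<And>i \<eta>. \<eta> \<in> profile k (M i) (A i) \<Longrightarrow>
      \<exists>r<R. dLP (2 * k) \<eta> (distr (M i) (Rm (2 * k)) (profile_vec k (g i r) (\<lambda>j. A i (g i r j)))) \<le> e / 3"
    and gx: "\<And>i r j t x. r < R \<Longrightarrow> j < k \<Longrightarrow> x \<in> space (M i) \<Longrightarrow>
      hd (bl i (Suc (gx r j t)) x) \<longleftrightarrow> g i r j x < real_of_rat t"
  shows "\<forall>\<^sub>F i in sequentially. \<forall>\<eta>\<in>profile k (M i) (A i). \<exists>\<nu>\<in>profile k N Op. dLP (2 * k) \<eta> \<nu> \<le> e"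
proof -
  \<comment> \<open>The summand 1 covers \<open>k = 0\<close> and makes the bound for
    \<open>2 * k\<close> coordinates strict.\<close>
  define c where "c = e / (3 * (2 * real k + 1))"
  have c: "0 < c" "real (2 * k) * c < e / 3" using e by (auto simp: c_def field_simps)
  \<comment> \<open>\<open>profile_perturb\<close> makes two demands on the mesh:
    \<open>1 / D \<le> c\<close>, and an exceptional set of mass at most
    \<open>e / 3\<close>.\<close>
  obtain D0 where D0: "max (1 / c) (real k * K / c / (e / 3)) < real D0" using reals_Archimedean2 by blast
  define D where "D = Suc D0"
  have D: "0 < D" "1 / real D \<le> c" using D0 c(1) by (auto simp: D_def field_simps)
  have kD: "real k * (K * (1 / real D) / c) \<le> e / 3"
  proof -
    have "real k * K / c / (e / 3) < real D" using D0 by (simp add: D_def)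
    then have "real k * K / c < real D * (e / 3)" using e by (subst (asm) pos_divide_less_eq) auto
    then have "real k * K / c / real D \<le> e / 3" using D(1) by (subst pos_divide_le_eq) (auto simp: mult.commute)
    then show ?thesis by (simp add: mult.commute)
  qed
  have "\<exists>n \<alpha>. (\<forall>u. \<bar>\<alpha> u\<bar> \<le> 1) \<and> (\<forall>i. \<forall>x\<in>space (M i). \<bar>\<alpha> (bl i n x) - g i r j x\<bar> \<le> 1 / real D)"
    if "r < R" "j < k" for r j
    by (rule step_approximation[of "\<lambda>i. g i r j", OF g(2)[OF that] gx[OF that] D(1)])
  then obtain n \<alpha> where \<alpha>: "\<And>r j u. r < R \<Longrightarrow> j < k \<Longrightarrow> \<bar>\<alpha> r j u\<bar> \<le> 1"
    "\<And>r j i x. r < R \<Longrightarrow> j < k \<Longrightarrow> x \<in> space (M i) \<Longrightarrow> \<bar>\<alpha> r j (bl i (n r j) x) - g i r j x\<bar> \<le> 1 / real D"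
    by metis
  define xs where "xs r j = word_list (n r j) (\<alpha> r j)" for r j
  let ?\<mu> = "\<lambda>r i. distr (M i) (Rm (2 * k)) (profile_vec k (\<lambda>j. S i (xs r j)) (\<lambda>j. Z i (xs r j)))"
  let ?\<nu> = "\<lambda>r. distr N (Rm (2 * k)) (profile_vec k (\<lambda>j. S' (xs r j)) (\<lambda>j. Z' (xs r j)))"
  let ?\<eta> = "\<lambda>r i. distr (M i) (Rm (2 * k)) (profile_vec k (g i r) (\<lambda>j. A i (g i r j)))"
  have \<mu>: "?\<mu> r i \<in> profile k (M i) (A i)" if "r < R" for r i
    unfolding xs_def using \<alpha>(1)[OF that] by (rule profile_S(1))
  have \<nu>: "?\<nu> r \<in> profile k N Op" if "r < R" for r
    unfolding xs_def using \<alpha>(1)[OF that] by (rule profile_S(2))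
  have Lg: "Linf (M i) (g i r j)" if "r < R" "j < k" for i r j
    using g(1)[OF that] g(2)[OF that] by (rule LinfI)
  have \<eta>: "?\<eta> r i \<in> profile k (M i) (A i)" if "r < R" for r i
    using g that by (intro profileI[OF P_op]) (auto intro: P_operatorD(2)[OF P_op Lg])
  have \<eta>\<mu>: "dLP (2 * k) (?\<eta> r i) (?\<mu> r i) \<le> e / 3" if r: "r < R" for r i
  proof -
    have "dLP (2 * k) (?\<eta> r i) (distr (M i) (Rm (2 * k)) (profile_vec k (\<lambda>j. S i (xs r j)) (\<lambda>j. A i (S i (xs r j))))) \<le> e / 3"
    proof (rule bounded_operator.profile_perturb[OF bounded_operator_A _ _ _ _ D(2) c kD])
      show "\<bar>g i r j x - S i (xs r j) x\<bar> \<le> 1 / real D" if "j < k" "x \<in> space (M i)" for j x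
        using \<alpha>(2)[OF r that] by (simp add: xs_def abs_minus_commute)
    qed (use Lg[OF r] Linf_S in auto)
    also have "distr (M i) (Rm (2 * k)) (profile_vec k (\<lambda>j. S i (xs r j)) (\<lambda>j. A i (S i (xs r j)))) = ?\<mu> r i"
      unfolding profile_vec_def
      by (rule distr_joint_cong_AE) (auto intro: P_operatorD(2)[OF P_op Linf_S] A_S)
    finally show ?thesis .
  qed
  have "\<forall>\<^sub>F i in sequentially. \<forall>r\<in>{..<R}. dLP (2 * k) (?\<mu> r i) (?\<nu> r) \<le> e / 3"
    using e by (intro eventually_ball_finite ballI profile_S_lim) auto
  then show ?thesis
  proof eventually_elim
    case (elim i)
    show ?case
    proof
      fix \<eta> assume \<eta>': "\<eta> \<in> profile k (M i) (A i)"
      obtain r where r: "r < R" "dLP (2 * k) \<eta> (?\<eta> r i) \<le> e / 3" using net[OF \<eta>'] by blast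
      note ps = profile_prob_space[OF \<eta>' P_op] profile_prob_space[OF \<eta>[OF r(1), of i] P_op]
        profile_prob_space[OF \<mu>[OF r(1), of i] P_op] profile_prob_space[OF \<nu>[OF r(1)] P_operator_Op]
      have "dLP (2 * k) \<eta> (?\<nu> r) \<le> dLP (2 * k) \<eta> (?\<eta> r i) + dLP (2 * k) (?\<eta> r i) (?\<nu> r)"
        by (intro dLP_triangle ps)
      also have "dLP (2 * k) (?\<eta> r i) (?\<nu> r) \<le> dLP (2 * k) (?\<eta> r i) (?\<mu> r i) + dLP (2 * k) (?\<mu> r i) (?\<nu> r)"
        by (intro dLP_triangle ps)
      finally have "dLP (2 * k) \<eta> (?\<nu> r) \<le> e" using r \<eta>\<mu>[OF r(1), of i] elim by force
      then show "\<exists>\<nu>\<in>profile k N Op. dLP (2 * k) \<eta> \<nu> \<le> e" using \<nu>[OF r(1)] by blast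
    qed
  qed
qed

lemma dH_profile_less1:
  assumes "P_operator M S" "P_operator N T" "\<eta> \<in> profile k M S" "dH (2 * k) (profile k M S) (profile k N T) < e"
  shows "\<exists>\<nu>\<in>profile k N T. dLP (2 * k) \<eta> \<nu> < e"
  by (rule dH_less1[OF profile_nonempty[OF assms(1)] profile_prob_space(1)[OF _ assms(1)]
    profile_nonempty[OF assms(2)] profile_prob_space(1)[OF _ assms(2)] assms(3,4)])

lemma dH_profile_less2:
  assumes "P_operator M S" "P_operator N T" "\<nu> \<in> profile k N T" "dH (2 * k) (profile k M S) (profile k N T) < e"
  shows "\<exists>\<eta>\<in>profile k M S. dLP (2 * k) \<eta> \<nu> < e"
  by (rule dH_less2[OF profile_nonempty[OF assms(1)] profile_prob_space(1)[OF _ assms(1)]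
    profile_nonempty[OF assms(2)] profile_prob_space(1)[OF _ assms(2)] assms(3,4)])

text \<open>Compactness yields approximations along \<open>r\<close> only; the Cauchy property moves
  any profile beyond \<open>i0\<close> to one of the subsequence at cost \<open>d\<close>. The
  hypothesis \<open>lo\<close> is not uniform in \<open>\<nu>\<close>, but it is needed at a single
  \<open>l\<close>, which may be chosen after \<open>\<nu>\<close> because \<open>i0\<close> is
  already fixed.\<close>

lemma dH_profile_tendsto:
  fixes N :: "'b measure"
  assumes A: "\<And>i. P_operator (M i) (A i)" and B: "P_operator N B" and k: "1 \<le> k"
    and cauchy: "action_convergent M A" and r: "strict_mono r"
    and up: "\<And>e. 0 < e \<Longrightarrow> \<forall>\<^sub>F i in sequentially. \<forall>\<eta>\<in>profile k (M (r i)) (A (r i)).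
      \<exists>\<nu>\<in>profile k N B. dLP (2 * k) \<eta> \<nu> \<le> e"
    and lo: "\<And>e \<nu>. 0 < e \<Longrightarrow> \<nu> \<in> profile k N B \<Longrightarrow>
      \<forall>\<^sub>F i in sequentially. \<exists>\<eta>\<in>profile k (M (r i)) (A (r i)). dLP (2 * k) \<eta> \<nu> \<le> e"
  shows "(\<lambda>i. dH (2 * k) (profile k (M i) (A i)) (profile k N B)) \<longlonglongrightarrow> 0"
proof (rule tendstoI)
  fix e :: real assume e: "0 < e"
  define d where "d = e / 4"
  have d: "0 < d" "2 * d < e" using e by (auto simp: d_def)
  obtain i0 where i0: "\<And>i j. i \<ge> i0 \<Longrightarrow> j \<ge> i0 \<Longrightarrow>
      dH (2 * k) (profile k (M i) (A i)) (profile k (M j) (A j)) < d"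
    using cauchy k d(1) unfolding action_convergent_def by blast
  have r_ge: "\<forall>\<^sub>F l in sequentially. i0 \<le> r l"
    using filterlim_subseq[OF r] by (simp add: filterlim_at_top)
  note pA = profile_prob_space[OF _ A] and pB = profile_prob_space[OF _ B]
  have "dH (2 * k) (profile k (M i) (A i)) (profile k N B) \<le> 2 * d" if i: "i \<ge> i0" for i
  proof (rule dH_leI)
    show "profile k (M i) (A i) \<noteq> {}" "profile k N B \<noteq> {}" using profile_nonempty A B by auto
    show "prob_space x" if "x \<in> profile k (M i) (A i)" for x using pA(1)[OF that] .
    show "prob_space x" if "x \<in> profile k N B" for x using pB(1)[OF that] .
    fix \<eta> assume \<eta>: "\<eta> \<in> profile k (M i) (A i)"
    obtain l where l: "i0 \<le> r l" "\<And>\<eta>. \<eta> \<in> profile k (M (r l)) (A (r l)) \<Longrightarrow> \<exists>\<nu>\<in>profile k N B. dLP (2 * k) \<eta> \<nu> \<le> d"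
      using eventually_happens[OF eventually_conj[OF r_ge up[OF d(1)]]] by auto
    obtain \<mu> where \<mu>: "\<mu> \<in> profile k (M (r l)) (A (r l))" "dLP (2 * k) \<eta> \<mu> < d"
      using dH_profile_less1[OF A A \<eta> i0[OF i l(1)]] by blast
    obtain \<nu> where \<nu>: "\<nu> \<in> profile k N B" "dLP (2 * k) \<mu> \<nu> \<le> d" using l(2)[OF \<mu>(1)] by blast
    have "dLP (2 * k) \<eta> \<nu> \<le> dLP (2 * k) \<eta> \<mu> + dLP (2 * k) \<mu> \<nu>"
      by (intro dLP_triangle pA[OF \<eta>] pA[OF \<mu>(1)] pB[OF \<nu>(1)])
    then have "dLP (2 * k) \<eta> \<nu> \<le> 2 * d" using \<mu>(2) \<nu>(2) by simp
    then show "\<exists>\<nu>\<in>profile k N B. dLP (2 * k) \<eta> \<nu> \<le> 2 * d" using \<nu>(1) by blast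
  next
    fix \<nu> assume \<nu>: "\<nu> \<in> profile k N B"
    obtain l where l: "i0 \<le> r l" "\<exists>\<mu>\<in>profile k (M (r l)) (A (r l)). dLP (2 * k) \<mu> \<nu> \<le> d"
      using eventually_happens[OF eventually_conj[OF r_ge lo[OF d(1) \<nu>]]] by auto
    obtain \<mu> where \<mu>: "\<mu> \<in> profile k (M (r l)) (A (r l))" "dLP (2 * k) \<mu> \<nu> \<le> d" using l(2) by blast
    obtain \<eta> where \<eta>: "\<eta> \<in> profile k (M i) (A i)" "dLP (2 * k) \<eta> \<mu> < d"
      using dH_profile_less2[OF A A \<mu>(1) i0[OF i l(1)]] by blast
    have "dLP (2 * k) \<eta> \<nu> \<le> dLP (2 * k) \<eta> \<mu> + dLP (2 * k) \<mu> \<nu>"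
      by (intro dLP_triangle pA[OF \<eta>(1)] pA[OF \<mu>(1)] pB[OF \<nu>])
    then have "dLP (2 * k) \<eta> \<nu> \<le> 2 * d" using \<mu>(2) \<eta>(2) by simp
    then show "\<exists>\<eta>\<in>profile k (M i) (A i). dLP (2 * k) \<eta> \<nu> \<le> 2 * d" using \<eta>(1) by blast
  qed
  moreover have "0 \<le> dH (2 * k) (profile k (M i) (A i)) (profile k N B)" for i
    by (rule dH_nonneg[OF profile_nonempty[OF A] pA(1) profile_nonempty[OF B] pB(1)])
  ultimately have "dist (dH (2 * k) (profile k (M i) (A i)) (profile k N B)) 0 < e" if "i \<ge> i0" for i
    using that d(2) by (force simp: dist_real_def)
  then show "\<forall>\<^sub>F i in sequentially. dist (dH (2 * k) (profile k (M i) (A i)) (profile k N B)) 0 < e"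
    by (auto simp: eventually_sequentially)
qed

text \<open>All Hausdorff distances are at most 1, so the geometric weights dominate and Tannery's
  theorem allows the limit termwise.\<close>

lemma dM_tendsto:
  fixes N :: "'b measure"
  assumes A: "\<And>i. P_operator (M i) (A i)" and B: "P_operator N B"
    and lim: "\<And>k. 1 \<le> k \<Longrightarrow> (\<lambda>i. dH (2 * k) (profile k (M i) (A i)) (profile k N B)) \<longlonglongrightarrow> 0"
  shows "(\<lambda>i. dM (M i) (A i) N B) \<longlonglongrightarrow> 0"
proof -
  let ?d = "\<lambda>k i. dH (2 * Suc k) (profile (Suc k) (M i) (A i)) (profile (Suc k) N B)"
  note ps = profile_nonempty[OF A] profile_prob_space(1)[OF _ A] profile_nonempty[OF B] profile_prob_space(1)[OF _ B]
  have d0: "0 \<le> ?d k i" for k i by (rule dH_nonneg) (rule ps, assumption?)+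
  have d1: "?d k i \<le> 1" for k i by (rule dH_le_1) (rule ps, assumption?)+
  have "(\<lambda>i. \<Sum>k. (1 / 2) ^ Suc k * ?d k i) \<longlonglongrightarrow> (\<Sum>k. (0 :: real))"
  proof (rule conjunct2[OF conjunct2[OF tannerys_theorem]])
    show "((\<lambda>i. (1 / 2) ^ Suc k * ?d k i) \<longlongrightarrow> 0) sequentially" for k
      using tendsto_mult[OF tendsto_const lim[of "Suc k"], of "(1 / 2) ^ Suc k"] by simp
    have "norm ((1 / 2) ^ Suc k * ?d k i) \<le> (1 / 2) ^ Suc k" for k i
      using d0[of k i] d1[of k i] by (simp add: abs_mult mult_left_le)
    then show "\<forall>\<^sub>F (k, i) in at_top \<times>\<^sub>F sequentially. norm ((1 / 2) ^ Suc k * ?d k i) \<le> (1 / 2) ^ Suc k"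
      by (intro always_eventually) auto
    show "summable (\<lambda>k. (1 / 2) ^ Suc k :: real)"
      using summable_geometric[of "1 / 2 :: real"] by (subst summable_Suc_iff) auto
  qed auto
  then show ?thesis unfolding dM_def by simp
qed

theorem theorem2p10:
  fixes p :: real and q :: ennreal
    and M :: "nat \<Rightarrow> 'a measure" and A :: "nat \<Rightarrow> ('a \<Rightarrow> real) \<Rightarrow> ('a \<Rightarrow> real)"
  assumes "1 \<le> p" and "1 \<le> q"
    and "\<And>i. P_operator (M i) (A i)"
    and "action_convergent M A"
    and "(SUP i. opnorm (M i) (A i) (ennreal p) q) < \<infinity>"
  shows "\<exists>(N :: real measure) (B :: (real \<Rightarrow> real) \<Rightarrow> (real \<Rightarrow> real)).
           P_operator N B \<and>
           (\<lambda>i. dM (M i) (A i) N B) \<longlonglongrightarrow> 0 \<and>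
           opnorm N B (ennreal p) q \<le> (SUP i. opnorm (M i) (A i) (ennreal p) q)"
proof -
  note P_op = assms(3)
  obtain K where K: "0 \<le> K" "(SUP i. opnorm (M i) (A i) (ennreal p) q) = ennreal K"
    using assms(5) by (cases "SUP i. opnorm (M i) (A i) (ennreal p) q") auto
  have "opnorm (M i) (A i) (ennreal p) q \<le> ennreal K" for i
    unfolding K(2)[symmetric] by (rule SUP_upper) simp
  then have bound: "lpnorm (M i) q (A i v) \<le> ennreal (K * c)"
    if "Linf (M i) v" "0 \<le> c" "lpnorm (M i) (ennreal p) v \<le> ennreal c" for i v c
    using opnorm_bound[OF P_op assms(1,2) K(1) _ that] by blast
  have bo: "bounded_operator (M i) (A i) K p q" for i
    using P_op assms(1,2) K(1) bound by unfold_locales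
  define good_net where "good_net k e R g \<longleftrightarrow>
    (\<forall>i. \<forall>r<R. \<forall>j<k. g i r j \<in> borel_measurable (M i) \<and> (\<forall>x\<in>space (M i). \<bar>g i r j x\<bar> \<le> 1)) \<and>
    (\<forall>i. \<forall>\<eta>\<in>profile k (M i) (A i). \<exists>r<R.
      dLP (2 * k) \<eta> (distr (M i) (Rm (2 * k)) (profile_vec k (g i r) (\<lambda>j. A i (g i r j)))) \<le> e)"
    for k e R and g :: "nat \<Rightarrow> nat \<Rightarrow> nat \<Rightarrow> 'a \<Rightarrow> real"
  \<comment> \<open>The accuracies \<open>1 / (n + 1)\<close> suffice, which leaves countably many
    families of functions to be encoded in bits.\<close>
  have "\<exists>R g. good_net k (inverse (real (Suc n))) R g" for k n
    unfolding good_net_def by (rule profile_net[OF bo K(1)]) simp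
  then obtain R g where net: "\<And>k n. good_net k (inverse (real (Suc n))) (R k n) (g k n)" by metis
  \<comment> \<open>The quadruple indexes the functions of all nets; outside the ranges the zero
    function keeps \<open>G\<close> measurable.\<close>
  define G where "G i = (\<lambda>(k, n, r, j). if r < R k n \<and> j < k then g k n i r j else (\<lambda>_. 0))" for i :: nat
  have G: "G i s \<in> borel_measurable (M i)" for i s
    using net by (cases s) (auto simp: G_def good_net_def)
  obtain bl :: "nat \<Rightarrow> nat \<Rightarrow> 'a \<Rightarrow> bool list" and ix gx where bl:
    "\<And>i n x. tl (bl i (Suc n) x) = bl i n x" "\<And>i n x. length (bl i n x) = n"
    "\<And>i n w. {x \<in> space (M i). bl i n x = w} \<in> sets (M i)"
    "\<And>i w t x. hd (bl i (Suc (ix w t)) x) \<longleftrightarrow> A i (\<lambda>y. of_bool (bl i (length w) y = w)) x < of_rat t"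
    "\<And>i s t x. hd (bl i (Suc (gx s t)) x) \<longleftrightarrow> G i s x < of_rat t"
    by (rule bits_exist[OF P_op G]) (rule that)
  \<comment> \<open>Only word probabilities are made to converge; the limit space and operator are
    read off from them and from the positions \<open>ix\<close>, which are the same along any
    subsequence.\<close>
  obtain r P where r: "strict_mono r"
    and P: "\<And>w. (\<lambda>i. measure (M (r i)) {x \<in> space (M (r i)). bl (r i) (length w) x = w}) \<longlonglongrightarrow> P w"
    using countable_diagonal_subseq[of "\<lambda>i w. measure (M i) {x \<in> space (M i). bl i (length w) x = w}",
      OF measure_nonneg prob_space.prob_le_1[OF P_operatorD(1)[OF P_op]]] by blast
  interpret bit_system "\<lambda>i. M (r i)" "\<lambda>i. A (r i)" K p q "\<lambda>i. bl (r i)" P ix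
    using assms(1,2) K(1) assms(3) bound bl P by unfold_locales auto
  have up: "\<forall>\<^sub>F i in sequentially. \<forall>\<eta>\<in>profile k (M (r i)) (A (r i)).
      \<exists>\<nu>\<in>profile k bit_space Op. dLP (2 * k) \<eta> \<nu> \<le> e" if e: "0 < e" for k e
  proof -
    have "0 < e / 3" using e by simp
    then obtain n where n: "inverse (real (Suc n)) < e / 3" using reals_Archimedean by blast
    have gn: "good_net k (inverse (real (Suc n))) (R k n) (g k n)" by (rule net)
    show ?thesis
    proof (rule profile_approx[OF e, where R = "R k n" and g = "\<lambda>i. g k n (r i)" and gx = "\<lambda>s j. gx (k, n, s, j)"])
      show "g k n (r i) s j \<in> borel_measurable (M (r i))" if "s < R k n" "j < k" for i s j
        using gn that by (simp add: good_net_def)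
      show "\<bar>g k n (r i) s j x\<bar> \<le> 1" if "s < R k n" "j < k" "x \<in> space (M (r i))" for i s j x
        using gn that by (simp add: good_net_def)
      show "\<exists>s<R k n. dLP (2 * k) \<eta> (distr (M (r i)) (Rm (2 * k))
        (profile_vec k (g k n (r i) s) (\<lambda>j. A (r i) (g k n (r i) s j)))) \<le> e / 3"
        if "\<eta> \<in> profile k (M (r i)) (A (r i))" for i \<eta>
        using gn that n unfolding good_net_def by (meson less_imp_le order_trans)
      show "hd (bl (r i) (Suc (gx (k, n, s, j) t)) x) \<longleftrightarrow> g k n (r i) s j x < real_of_rat t"
        if "s < R k n" "j < k" "x \<in> space (M (r i))" for i s j t x
        using bl(5)[of "r i" "(k, n, s, j)" t x] that by (simp add: G_def)
    qed
  qed
  have "(\<lambda>i. dM (M i) (A i) bit_space Op) \<longlonglongrightarrow> 0"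
  proof (rule dM_tendsto[OF assms(3) P_operator_Op])
    show "(\<lambda>i. dH (2 * k) (profile k (M i) (A i)) (profile k bit_space Op)) \<longlonglongrightarrow> 0" if "1 \<le> k" for k
    proof (rule dH_profile_tendsto[OF assms(3) P_operator_Op that assms(4) r up])
      show "\<forall>\<^sub>F i in sequentially. \<exists>\<mu>\<in>profile k (M (r i)) (A (r i)). dLP (2 * k) \<mu> \<nu> \<le> e"
        if "0 < e" "\<nu> \<in> profile k bit_space Op" for e \<nu>
        using that(2,1) by (rule profile_Op_approx)
    qed
  qed
  then show ?thesis unfolding K(2) using P_operator_Op opnorm_Op by blast
qed

end
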